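(* Let $R$ be a regular local $F$-finite ring of characteristic $p>0$, and let $\mathcal{M}$ be a finitely generated unit $R[F^e]$-module. Then $\mathcal{M}$ has a unique minimal root.
   Context: $R$ is $F$-finite if it is a finite module over its subring of $p$-th powers. Fix $e\ge1$. $R^e$ denotes $R$ as an $R$-$R$-bimodule with usual left structure and right structure $s\cdot r=r^{p^e}s$; $F^{e*}M=R^e\otimes_R M$. An $R[F^e]$-module is an $R$-module $\mathcal{M}$ with an $R$-linear map $\theta^e\colon F^{e*}\mathcal{M}\to\mathcal{M}$; equivalently, a left module over the noncommutative ring $R[F^e]=R\langle F^e\rangle/(r^{p^e}F^e-F^er)$, where $F^e(m)=\theta^e(1\otimes m)$. It is unit if $\theta^e$ is an isomorphism, and finitely generated if it is finitely generated as a left module over $R[F^e]$. For an $R$-submodule $N\subseteq\mathcal{M}$, $F^e(N)$ denotes the $R$-submodule generated by all $F^e(n)$, $n\in N$. A root of a unit $R[F^e]$-module $\mathcal{M}$ is a finitely generated $R$-submodule $M\subseteq\mathcal{M}$ with $M\subseteq F^e(M)$ and $\bigcup_rF^{er}(M)=\mathcal{M}$. The minimal root is a root contained in every other root. *)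

theory Defs
  imports "HOL-Algebra.Algebra" "HOL-Library.Extended_Nat"
begin

section \<open>Regular local rings\<close>

definition local_ring :: "('a, 'r) ring_scheme \<Rightarrow> bool" where
  "local_ring R \<longleftrightarrow> cring R \<and> (\<exists>!m. maximalideal m R)"

text \<open>Supremum of the lengths \<open>n\<close> of chains \<open>P 0 \<subset> \<dots> \<subset> P n\<close> of prime ideals.\<close>

definition krull_dim :: "('a, 'r) ring_scheme \<Rightarrow> enat" where
  "krull_dim R = (SUP n \<in> {n. \<exists>P :: nat \<Rightarrow> 'a set.
      (\<forall>i\<le>n. primeideal (P i) R) \<and> (\<forall>i<n. P i \<subset> P (Suc i))}. enat n)"

definition min_generators :: "('a, 'r) ring_scheme \<Rightarrow> 'a set \<Rightarrow> nat" where
  "min_generators R I =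
     (LEAST n. \<exists>S \<subseteq> carrier R. finite S \<and> card S = n \<and> genideal R S = I)"

definition regular_local_ring :: "('a, 'r) ring_scheme \<Rightarrow> bool" where
  "regular_local_ring R \<longleftrightarrow> local_ring R \<and> noetherian_ring R \<and>
     (\<forall>m. maximalideal m R \<longrightarrow> enat (min_generators R m) = krull_dim R)"

definition has_characteristic :: "('a, 'r) ring_scheme \<Rightarrow> nat \<Rightarrow> bool" where
  "has_characteristic R n \<longleftrightarrow> (\<forall>k::nat. [k] \<cdot>\<^bsub>R\<^esub> \<one>\<^bsub>R\<^esub> = \<zero>\<^bsub>R\<^esub> \<longleftrightarrow> n dvd k)"


section \<open>Modules\<close>

text \<open>
  Modules are records extending rings, so they carry a multiplication and a unit;
  these two fields play no role for modules and are ignored (or left undefined) throughout.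
\<close>

definition submodule_span ::
  "('a, 'r) ring_scheme \<Rightarrow> ('a, 'm, 'x) module_scheme \<Rightarrow> 'm set \<Rightarrow> 'm set" where
  "submodule_span R M S = (\<lambda>N. submodule N R M) hull S"

definition fg_submodule ::
  "('a, 'r) ring_scheme \<Rightarrow> ('a, 'm, 'x) module_scheme \<Rightarrow> 'm set \<Rightarrow> bool" where
  "fg_submodule R M N \<longleftrightarrow> submodule N R M \<and> (\<exists>S \<subseteq> N. finite S \<and> submodule_span R M S = N)"

definition linear_maps ::
  "('a, 'r) ring_scheme \<Rightarrow> ('a, 'm, 'x) module_scheme \<Rightarrow> ('a, 'n, 'y) module_scheme
     \<Rightarrow> ('m \<Rightarrow> 'n) set" where
  "linear_maps R M N = {f \<in> carrier M \<rightarrow> carrier N.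
     (\<forall>x \<in> carrier M. \<forall>y \<in> carrier M. f (x \<oplus>\<^bsub>M\<^esub> y) = f x \<oplus>\<^bsub>N\<^esub> f y) \<and>
     (\<forall>a \<in> carrier R. \<forall>x \<in> carrier M. f (a \<odot>\<^bsub>M\<^esub> x) = a \<odot>\<^bsub>N\<^esub> f x)}"

definition regular_module :: "('a, 'r) ring_scheme \<Rightarrow> ('a, 'a) module" where
  "regular_module R = \<lparr>carrier = carrier R, monoid.mult = monoid.mult R, monoid.one = monoid.one R,
     ring.zero = ring.zero R, ring.add = ring.add R, smult = monoid.mult R\<rparr>"

text \<open>\<open>R\<close> is a finite module over its subring of \<open>p\<close>-th powers.\<close>

definition F_finite :: "nat \<Rightarrow> ('a, 'r) ring_scheme \<Rightarrow> bool" where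
  "F_finite p R \<longleftrightarrow>
     fg_submodule (R\<lparr>carrier := {x [^]\<^bsub>R\<^esub> p | x. x \<in> carrier R}\<rparr>) (regular_module R) (carrier R)"


section \<open>Tensor products\<close>

text \<open>
  For an \<open>R\<close>-\<open>R\<close>-bimodule, given by a left module \<open>B\<close> and a right action \<open>\<rho> b r\<close>, and a left
  module \<open>M\<close>, the tensor product \<open>B \<otimes>\<^sub>R M\<close> is the quotient of the free abelian group on
  \<open>B \<times> M\<close> by the subgroup generated by the usual relations.  It is an \<open>R\<close>-module through the
  left structure of \<open>B\<close>.
\<close>

definition tensor_relations ::
  "('b \<Rightarrow> 'a \<Rightarrow> 'b) \<Rightarrow> ('a, 'r) ring_scheme \<Rightarrow> ('a, 'b, 'y) module_scheme
     \<Rightarrow> ('a, 'm, 'x) module_scheme \<Rightarrow> ('b \<times> 'm \<Rightarrow>\<^sub>0 int) set" where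
  "tensor_relations \<rho> R B M =
     {frag_of (b \<oplus>\<^bsub>B\<^esub> b', m) - frag_of (b, m) - frag_of (b', m) | b b' m.
        b \<in> carrier B \<and> b' \<in> carrier B \<and> m \<in> carrier M} \<union>
     {frag_of (b, m \<oplus>\<^bsub>M\<^esub> m') - frag_of (b, m) - frag_of (b, m') | b m m'.
        b \<in> carrier B \<and> m \<in> carrier M \<and> m' \<in> carrier M} \<union>
     {frag_of (\<rho> b r, m) - frag_of (b, r \<odot>\<^bsub>M\<^esub> m) | b r m.
        b \<in> carrier B \<and> r \<in> carrier R \<and> m \<in> carrier M}"

definition tensor_kernel ::
  "('b \<Rightarrow> 'a \<Rightarrow> 'b) \<Rightarrow> ('a, 'r) ring_scheme \<Rightarrow> ('a, 'b, 'y) module_scheme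
     \<Rightarrow> ('a, 'm, 'x) module_scheme \<Rightarrow> ('b \<times> 'm \<Rightarrow>\<^sub>0 int) set" where
  "tensor_kernel \<rho> R B M =
     generate (free_Abelian_group (carrier B \<times> carrier M)) (tensor_relations \<rho> R B M)"

definition pure_tensor ::
  "('b \<Rightarrow> 'a \<Rightarrow> 'b) \<Rightarrow> ('a, 'r) ring_scheme \<Rightarrow> ('a, 'b, 'y) module_scheme
     \<Rightarrow> ('a, 'm, 'x) module_scheme \<Rightarrow> 'b \<Rightarrow> 'm \<Rightarrow> ('b \<times> 'm \<Rightarrow>\<^sub>0 int) set" where
  "pure_tensor \<rho> R B M b m =
     tensor_kernel \<rho> R B M #>\<^bsub>free_Abelian_group (carrier B \<times> carrier M)\<^esub> frag_of (b, m)"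

text \<open>
  The scalar \<open>r\<close> sends the class of a formal sum \<open>x\<close> of pairs \<open>(b, m)\<close> to the class of the
  corresponding sum of the \<open>(r \<odot> b, m)\<close>; the union below runs over the representatives \<open>x\<close>
  of a class, all of which give the same result.
\<close>

definition tensor_product ::
  "('b \<Rightarrow> 'a \<Rightarrow> 'b) \<Rightarrow> ('a, 'r) ring_scheme \<Rightarrow> ('a, 'b, 'y) module_scheme
     \<Rightarrow> ('a, 'm, 'x) module_scheme \<Rightarrow> ('a, ('b \<times> 'm \<Rightarrow>\<^sub>0 int) set) module" where
  "tensor_product \<rho> R B M =
     (let G = free_Abelian_group (carrier B \<times> carrier M);
          K = tensor_kernel \<rho> R B M
      in \<lparr>carrier = carrier (G Mod K), monoid.mult = undefined, monoid.one = undefined,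
          ring.zero = monoid.one (G Mod K), ring.add = monoid.mult (G Mod K),
          smult = (\<lambda>r C. \<Union>x\<in>C. K #>\<^bsub>G\<^esub> frag_extend (\<lambda>(b, m). frag_of (r \<odot>\<^bsub>B\<^esub> b, m)) x)\<rparr>)"


section \<open>Frobenius modules\<close>

text \<open>The right structure \<open>s \<cdot> r = r\<^sup>q s\<close>, with \<open>q = p\<^sup>e\<close>, of the bimodule \<open>R\<^sup>e\<close>.\<close>

definition frob_right :: "nat \<Rightarrow> nat \<Rightarrow> ('a, 'r) ring_scheme \<Rightarrow> 'a \<Rightarrow> 'a \<Rightarrow> 'a" where
  "frob_right p e R s r = (r [^]\<^bsub>R\<^esub> (p ^ e)) \<otimes>\<^bsub>R\<^esub> s"

definition frob_pullback ::
  "nat \<Rightarrow> nat \<Rightarrow> ('a, 'r) ring_scheme \<Rightarrow> ('a, 'm, 'x) module_scheme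
     \<Rightarrow> ('a, ('a \<times> 'm \<Rightarrow>\<^sub>0 int) set) module" where
  "frob_pullback p e R M = tensor_product (frob_right p e R) R (regular_module R) M"

definition RF_module ::
  "nat \<Rightarrow> nat \<Rightarrow> ('a, 'r) ring_scheme \<Rightarrow> ('a, 'm, 'x) module_scheme
     \<Rightarrow> (('a \<times> 'm \<Rightarrow>\<^sub>0 int) set \<Rightarrow> 'm) \<Rightarrow> bool" where
  "RF_module p e R M \<theta> \<longleftrightarrow> module R M \<and> \<theta> \<in> linear_maps R (frob_pullback p e R M) M"

definition unit_RF_module ::
  "nat \<Rightarrow> nat \<Rightarrow> ('a, 'r) ring_scheme \<Rightarrow> ('a, 'm, 'x) module_scheme
     \<Rightarrow> (('a \<times> 'm \<Rightarrow>\<^sub>0 int) set \<Rightarrow> 'm) \<Rightarrow> bool" where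
  "unit_RF_module p e R M \<theta> \<longleftrightarrow>
     RF_module p e R M \<theta> \<and> bij_betw \<theta> (carrier (frob_pullback p e R M)) (carrier M)"

text \<open>The action \<open>F\<^sup>e(m) = \<theta>\<^sup>e(1 \<otimes> m)\<close>.\<close>

definition frob_act ::
  "nat \<Rightarrow> nat \<Rightarrow> ('a, 'r) ring_scheme \<Rightarrow> ('a, 'm, 'x) module_scheme
     \<Rightarrow> (('a \<times> 'm \<Rightarrow>\<^sub>0 int) set \<Rightarrow> 'm) \<Rightarrow> 'm \<Rightarrow> 'm" where
  "frob_act p e R M \<theta> m = \<theta> (pure_tensor (frob_right p e R) R (regular_module R) M \<one>\<^bsub>R\<^esub> m)"

text \<open>
  The ring \<open>R[F\<^sup>e]\<close> is generated by \<open>R\<close> and \<open>F\<^sup>e\<close>, so its left submodules of \<open>M\<close> are the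
  \<open>R\<close>-submodules stable under the action of \<open>F\<^sup>e\<close>.
\<close>

definition RF_submodule ::
  "nat \<Rightarrow> nat \<Rightarrow> ('a, 'r) ring_scheme \<Rightarrow> ('a, 'm, 'x) module_scheme
     \<Rightarrow> (('a \<times> 'm \<Rightarrow>\<^sub>0 int) set \<Rightarrow> 'm) \<Rightarrow> 'm set \<Rightarrow> bool" where
  "RF_submodule p e R M \<theta> N \<longleftrightarrow> submodule N R M \<and> frob_act p e R M \<theta> ` N \<subseteq> N"

definition fg_RF_module ::
  "nat \<Rightarrow> nat \<Rightarrow> ('a, 'r) ring_scheme \<Rightarrow> ('a, 'm, 'x) module_scheme
     \<Rightarrow> (('a \<times> 'm \<Rightarrow>\<^sub>0 int) set \<Rightarrow> 'm) \<Rightarrow> bool" where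
  "fg_RF_module p e R M \<theta> \<longleftrightarrow>
     (\<exists>S \<subseteq> carrier M. finite S \<and> RF_submodule p e R M \<theta> hull S = carrier M)"

text \<open>The submodule \<open>F\<^sup>e\<^sup>r(N)\<close> generated by the images of the elements of \<open>N\<close> under the
  \<open>r\<close>-th iterate of \<open>F\<^sup>e\<close>.\<close>

definition frob_image ::
  "nat \<Rightarrow> nat \<Rightarrow> ('a, 'r) ring_scheme \<Rightarrow> ('a, 'm, 'x) module_scheme
     \<Rightarrow> (('a \<times> 'm \<Rightarrow>\<^sub>0 int) set \<Rightarrow> 'm) \<Rightarrow> nat \<Rightarrow> 'm set \<Rightarrow> 'm set" where
  "frob_image p e R M \<theta> r N = submodule_span R M ((frob_act p e R M \<theta> ^^ r) ` N)"

definition is_root ::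
  "nat \<Rightarrow> nat \<Rightarrow> ('a, 'r) ring_scheme \<Rightarrow> ('a, 'm, 'x) module_scheme
     \<Rightarrow> (('a \<times> 'm \<Rightarrow>\<^sub>0 int) set \<Rightarrow> 'm) \<Rightarrow> 'm set \<Rightarrow> bool" where
  "is_root p e R M \<theta> N \<longleftrightarrow> fg_submodule R M N \<and> N \<subseteq> frob_image p e R M \<theta> 1 N \<and>
     (\<Union>r. frob_image p e R M \<theta> r N) = carrier M"

definition is_minimal_root ::
  "nat \<Rightarrow> nat \<Rightarrow> ('a, 'r) ring_scheme \<Rightarrow> ('a, 'm, 'x) module_scheme
     \<Rightarrow> (('a \<times> 'm \<Rightarrow>\<^sub>0 int) set \<Rightarrow> 'm) \<Rightarrow> 'm set \<Rightarrow> bool" where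
  "is_minimal_root p e R M \<theta> N \<longleftrightarrow>
     is_root p e R M \<theta> N \<and> (\<forall>N'. is_root p e R M \<theta> N' \<longrightarrow> N \<subseteq> N')"

end

theory Submission
  imports Defs
begin

text \<open>
  Write \<open>q = p\<^sup>e\<close>, \<open>F\<close> for the Frobenius action on elements, and \<open>F(N)\<close> for the submodule spanned
  by the images of the elements of \<open>N\<close>. Uniqueness is immediate, so the point is to find a smallest root.

  The regularity of \<open>R\<close> enters through Kunz's theorem: \<open>R\<close> is free over its subring of \<open>q\<close>-th powers
  (\<open>frobenius_free\<close>). Choose a basis \<open>e\<^sub>i\<close>. As \<open>\<theta>\<close> is bijective, every element of \<open>M\<close> is uniquely
  \<open>\<Sum> e\<^sub>i F(m\<^sub>i)\<close>, and the coordinates \<open>m\<^sub>i = \<pi>\<^sub>i(m)\<close> are additive with \<open>\<pi>\<^sub>i(c\<^sup>q m) = c \<pi>\<^sub>i(m)\<close>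
  (\<open>coordinate_map\<close>). Consequently \<open>m \<in> F(N)\<close> means that all coordinates of \<open>m\<close> lie in \<open>N\<close>
  (\<open>mem_frob_iff\<close>), and every submodule \<open>A\<close> has a least submodule \<open>C(A)\<close> with \<open>A \<subseteq> F(C(A))\<close>,
  namely the span of the coordinates of its elements.

  If \<open>N\<close> is a root, then so is \<open>C(N) \<subseteq> N\<close>. Any root \<open>N'\<close> satisfies \<open>N \<subseteq> F\<^sup>k(N')\<close> for some \<open>k\<close>, that is,
  \<open>C\<^sup>k(N) \<subseteq> N'\<close>. So the smallest root exists as soon as the decreasing sequence \<open>L\<^sub>r = C\<^sup>r(N)\<close> becomes
  stationary. This is the Hartshorne-Speiser-Lyubeznik-Gabber theorem, and Gabber's proof works here
  (\<open>coord_pow_stabilizes\<close>): the ideals \<open>(L\<^sub>r\<^sub>+\<^sub>1 : L\<^sub>r)\<close> increase, hence are eventually equal to one ideal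
  \<open>I\<close>, and squares of elements of \<open>I\<close> multiply \<open>L\<^sub>r\<close> into all later terms. If \<open>I\<close> were
  proper, then at a minimal prime of \<open>I\<close> the sequence would live in a module of finite length, so it
  would have a locally stationary step, which contradicts the choice of the prime.

  Kunz's theorem rests on the fact that generators \<open>x\<^sub>1, \<dots>, x\<^sub>d\<close> of the maximal ideal, \<open>d = dim R\<close>,
  form a regular sequence, which follows from Krull's principal ideal theorem by counting chains of
  primes. Their \<open>q\<close>-th powers then form a regular sequence too, and a minimal family of generators of
  \<open>R\<close> over the \<open>q\<close>-th powers satisfies no relation, by Nakayama's lemma applied along this sequence.

  Localisation is replaced throughout by saturation: \<open>sat P Y\<close> consists of the elements that some
  scalar outside the prime \<open>P\<close> multiplies into \<open>Y\<close>. The same local descending chain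
  condition (\<open>descending_chain_sat\<close>) serves the principal ideal theorem and Gabber's argument.
\<close>

section \<open>Submodules and spans\<close>

context module
begin

lemma submoduleI_linear:
  assumes "H \<subseteq> carrier M" "\<zero>\<^bsub>M\<^esub> \<in> H"
    and "\<And>a b. a \<in> H \<Longrightarrow> b \<in> H \<Longrightarrow> a \<oplus>\<^bsub>M\<^esub> b \<in> H"
    and smult: "\<And>c a. c \<in> carrier R \<Longrightarrow> a \<in> H \<Longrightarrow> c \<odot>\<^bsub>M\<^esub> a \<in> H"
  shows "submodule H R M"
proof (rule submoduleI)
  fix a assume a: "a \<in> H"
  then have "a \<in> carrier M" using assms(1) by blast
  then have "\<ominus>\<^bsub>M\<^esub> a = (\<ominus> \<one>) \<odot>\<^bsub>M\<^esub> a"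
    by (simp add: smult_l_minus)
  then show "\<ominus>\<^bsub>M\<^esub> a \<in> H" using smult[of "\<ominus> \<one>" a] a by simp
qed (use assms in auto)

lemma submodule_subset: "submodule N R M \<Longrightarrow> N \<subseteq> carrier M"
  by (rule submoduleE(1))

lemma submodule_zero: "submodule N R M \<Longrightarrow> \<zero>\<^bsub>M\<^esub> \<in> N"
  using subgroup.one_closed[OF submodule.axioms(1), of N R M] by simp

lemma submodule_add: "submodule N R M \<Longrightarrow> x \<in> N \<Longrightarrow> y \<in> N \<Longrightarrow> x \<oplus>\<^bsub>M\<^esub> y \<in> N"
  by (rule submoduleE(5))

lemma submodule_smult: "submodule N R M \<Longrightarrow> c \<in> carrier R \<Longrightarrow> x \<in> N \<Longrightarrow> c \<odot>\<^bsub>M\<^esub> x \<in> N"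
  by (rule submoduleE(4))

lemma submodule_minus: "submodule N R M \<Longrightarrow> x \<in> N \<Longrightarrow> y \<in> N \<Longrightarrow> x \<ominus>\<^bsub>M\<^esub> y \<in> N"
  by (simp add: a_minus_def submodule_add submoduleE(3))

lemma submodule_add_cancel:
  assumes "submodule N R M" "x \<oplus>\<^bsub>M\<^esub> y \<in> N" "y \<in> N" "x \<in> carrier M"
  shows "x \<in> N"
proof -
  have y: "y \<in> carrier M" using assms submodule_subset by blast
  have "(x \<oplus>\<^bsub>M\<^esub> y) \<ominus>\<^bsub>M\<^esub> y = x"
    using y assms(4) by (simp add: a_minus_def M.a_assoc M.r_neg)
  then show ?thesis using submodule_minus[OF assms(1-3)] by simp
qed

lemma submodule_Int: "submodule N R M \<Longrightarrow> submodule N' R M \<Longrightarrow> submodule (N \<inter> N') R M"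
  using submodule_subset by (intro submoduleI_linear)
    (auto simp: submodule_zero submodule_add submodule_smult)

lemma submodule_Inter:
  assumes "C \<noteq> {}" "\<And>N. N \<in> C \<Longrightarrow> submodule N R M"
  shows "submodule (\<Inter>C) R M"
proof (rule submoduleI_linear)
  show "\<Inter>C \<subseteq> carrier M" using assms submodule_subset by blast
qed (use assms in \<open>auto simp: submodule_zero submodule_add submodule_smult\<close>)

lemma submodule_UN_chain:
  assumes "\<And>n::nat. submodule (N n) R M" "\<And>n. N n \<subseteq> N (Suc n)"
  shows "submodule (\<Union>n. N n) R M"
proof (rule submoduleI_linear)
  have mono: "N i \<subseteq> N j" if "i \<le> j" for i j
    using lift_Suc_mono_le[of N, OF assms(2) that] .
  show "(\<Union>n. N n) \<subseteq> carrier M" using assms(1) submodule_subset by blast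
  show "\<zero>\<^bsub>M\<^esub> \<in> (\<Union>n. N n)" using assms(1) submodule_zero by blast
  fix a b assume "a \<in> (\<Union>n. N n)" "b \<in> (\<Union>n. N n)"
  then obtain i j where "a \<in> N i" "b \<in> N j" by blast
  then have "a \<in> N (max i j)" "b \<in> N (max i j)"
    using mono[of i "max i j"] mono[of j "max i j"] by auto
  then show "a \<oplus>\<^bsub>M\<^esub> b \<in> (\<Union>n. N n)" using assms(1) submodule_add by blast
next
  fix c a assume "c \<in> carrier R" "a \<in> (\<Union>n. N n)"
  then show "c \<odot>\<^bsub>M\<^esub> a \<in> (\<Union>n. N n)" using assms(1) submodule_smult by blast
qed

lemma scalar_preimage_submodule:
  assumes N: "submodule N R M" and x: "x \<in> carrier R"
  shows "submodule {a \<in> carrier M. x \<odot>\<^bsub>M\<^esub> a \<in> N} R M"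
proof (rule submoduleI_linear)
  show "\<zero>\<^bsub>M\<^esub> \<in> {a \<in> carrier M. x \<odot>\<^bsub>M\<^esub> a \<in> N}" using x submodule_zero[OF N] by simp
next
  fix c a assume c: "c \<in> carrier R" and a: "a \<in> {a \<in> carrier M. x \<odot>\<^bsub>M\<^esub> a \<in> N}"
  have "x \<odot>\<^bsub>M\<^esub> (c \<odot>\<^bsub>M\<^esub> a) = c \<odot>\<^bsub>M\<^esub> (x \<odot>\<^bsub>M\<^esub> a)"
    using x a c by (simp add: smult_assoc1[symmetric] R.m_comm)
  then show "c \<odot>\<^bsub>M\<^esub> a \<in> {a \<in> carrier M. x \<odot>\<^bsub>M\<^esub> a \<in> N}"
    using a c submodule_smult[OF N c] by simp
qed (use x submodule_add[OF N] in \<open>auto simp: smult_r_distr\<close>)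

lemma span_submodule:
  assumes "S \<subseteq> carrier M"
  shows "submodule (submodule_span R M S) R M"
  unfolding submodule_span_def hull_def
  by (rule submodule_Inter) (use assms carrier_is_submodule in auto)

lemma span_superset: "S \<subseteq> submodule_span R M S"
  unfolding submodule_span_def by (rule hull_subset)

lemma span_least: "S \<subseteq> N \<Longrightarrow> submodule N R M \<Longrightarrow> submodule_span R M S \<subseteq> N"
  unfolding submodule_span_def by (rule hull_minimal)

lemma span_mono: "S \<subseteq> T \<Longrightarrow> submodule_span R M S \<subseteq> submodule_span R M T"
  unfolding submodule_span_def by (rule hull_mono)

lemma span_of_submodule: "submodule N R M \<Longrightarrow> submodule_span R M N = N"
  unfolding submodule_span_def by (rule hull_same)

lemma span_subset_carrier: "S \<subseteq> carrier M \<Longrightarrow> submodule_span R M S \<subseteq> carrier M"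
  using span_submodule submodule_subset by blast

lemma span_empty: "submodule_span R M {} = {\<zero>\<^bsub>M\<^esub>}"
proof
  have "submodule {\<zero>\<^bsub>M\<^esub>} R M" by (rule submoduleI_linear) auto
  then show "submodule_span R M {} \<subseteq> {\<zero>\<^bsub>M\<^esub>}" by (intro span_least) auto
  show "{\<zero>\<^bsub>M\<^esub>} \<subseteq> submodule_span R M {}"
    using submodule_zero[OF span_submodule, of "{}"] by simp
qed

lemma span_insert:
  assumes a: "a \<in> carrier M" and S: "S \<subseteq> carrier M"
  shows "submodule_span R M (insert a S) =
    {c \<odot>\<^bsub>M\<^esub> a \<oplus>\<^bsub>M\<^esub> z | c z. c \<in> carrier R \<and> z \<in> submodule_span R M S}" (is "?L = ?T")
proof
  note sub = span_submodule[OF S]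
  have carr: "z \<in> carrier M" if "z \<in> submodule_span R M S" for z
    using that submodule_subset[OF sub] by blast
  have "submodule ?T R M"
  proof (rule submoduleI_linear)
    show "?T \<subseteq> carrier M" using a carr by auto
    have "\<zero>\<^bsub>M\<^esub> = \<zero> \<odot>\<^bsub>M\<^esub> a \<oplus>\<^bsub>M\<^esub> \<zero>\<^bsub>M\<^esub>" using a by simp
    then show "\<zero>\<^bsub>M\<^esub> \<in> ?T" using submodule_zero[OF sub] by blast
    fix u v assume "u \<in> ?T" "v \<in> ?T"
    then obtain c z d w where cd: "c \<in> carrier R" "d \<in> carrier R"
      and zw: "z \<in> submodule_span R M S" "w \<in> submodule_span R M S"
      and uv: "u = c \<odot>\<^bsub>M\<^esub> a \<oplus>\<^bsub>M\<^esub> z" "v = d \<odot>\<^bsub>M\<^esub> a \<oplus>\<^bsub>M\<^esub> w" by blast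
    have "u \<oplus>\<^bsub>M\<^esub> v = (c \<oplus> d) \<odot>\<^bsub>M\<^esub> a \<oplus>\<^bsub>M\<^esub> (z \<oplus>\<^bsub>M\<^esub> w)"
      unfolding uv using cd a carr[OF zw(1)] carr[OF zw(2)]
      by (simp add: smult_l_distr M.a_ac)
    then show "u \<oplus>\<^bsub>M\<^esub> v \<in> ?T" using submodule_add[OF sub zw] cd by blast
  next
    fix d u assume d: "d \<in> carrier R" and "u \<in> ?T"
    then obtain c z where c: "c \<in> carrier R" and z: "z \<in> submodule_span R M S"
      and u: "u = c \<odot>\<^bsub>M\<^esub> a \<oplus>\<^bsub>M\<^esub> z" by blast
    have "d \<odot>\<^bsub>M\<^esub> u = (d \<otimes> c) \<odot>\<^bsub>M\<^esub> a \<oplus>\<^bsub>M\<^esub> d \<odot>\<^bsub>M\<^esub> z"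
      unfolding u using c d a carr[OF z] by (simp add: smult_r_distr smult_assoc1)
    then show "d \<odot>\<^bsub>M\<^esub> u \<in> ?T" using submodule_smult[OF sub d z] c d by blast
  qed
  moreover have "insert a S \<subseteq> ?T"
  proof -
    have "a = \<one> \<odot>\<^bsub>M\<^esub> a \<oplus>\<^bsub>M\<^esub> \<zero>\<^bsub>M\<^esub>" using a by simp
    then have "a \<in> ?T" using submodule_zero[OF sub] by blast
    moreover have "s \<in> ?T" if "s \<in> S" for s
    proof -
      have "s = \<zero> \<odot>\<^bsub>M\<^esub> a \<oplus>\<^bsub>M\<^esub> s" using a that S by auto
      then show ?thesis using that span_superset[of S] by blast
    qed
    ultimately show ?thesis by blast
  qed
  ultimately show "?L \<subseteq> ?T" by (intro span_least)
  have L: "submodule ?L R M" using a S by (intro span_submodule) auto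
  have "a \<in> ?L" using span_superset[of "insert a S"] by blast
  moreover have "submodule_span R M S \<subseteq> ?L" by (rule span_mono) auto
  ultimately show "?T \<subseteq> ?L"
    using submodule_add[OF L] submodule_smult[OF L] by blast
qed

lemma span_insert_submodule:
  assumes "a \<in> carrier M" and "submodule Y R M"
  shows "submodule_span R M (insert a Y) = {c \<odot>\<^bsub>M\<^esub> a \<oplus>\<^bsub>M\<^esub> z | c z. c \<in> carrier R \<and> z \<in> Y}"
  using span_insert[OF assms(1) submodule_subset[OF assms(2)]] span_of_submodule[OF assms(2)]
  by simp

end

section \<open>The ring as a module over itself\<close>

lemma regular_module_simps [simp]:
  "carrier (regular_module R) = carrier R"
  "ring.add (regular_module R) = ring.add R"
  "ring.zero (regular_module R) = ring.zero R"
  "module.smult (regular_module R) = monoid.mult R"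
  by (simp_all add: regular_module_def)

lemma (in cring) module_regular_module: "module R (regular_module R)"
proof (rule moduleI)
  show "abelian_group (regular_module R)"
  proof (rule abelian_groupI)
    fix x assume "x \<in> carrier (regular_module R)"
    then show "\<exists>y \<in> carrier (regular_module R).
        y \<oplus>\<^bsub>regular_module R\<^esub> x = \<zero>\<^bsub>regular_module R\<^esub>"
      by (intro bexI[of _ "\<ominus> x"]) (auto simp: l_neg)
  qed (auto simp: a_ac)
qed (auto simp: is_cring l_distr r_distr m_assoc)

lemma (in cring) submodule_regular_iff_ideal:
  "submodule I R (regular_module R) \<longleftrightarrow> ideal I R"
proof
  interpret N: module R "regular_module R" by (rule module_regular_module)
  show "ideal I R" if I: "submodule I R (regular_module R)"
  proof (rule idealI)
    have "\<ominus> x \<in> I" if "x \<in> I" for x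
    proof -
      have "x \<in> carrier R" using that N.submodule_subset[OF I] by auto
      then have "\<ominus> x = \<ominus> \<one> \<otimes> x" by (simp add: l_minus)
      then show ?thesis using N.submodule_smult[OF I, of "\<ominus> \<one>" x] that by simp
    qed
    then show "subgroup I (add_monoid R)"
      using N.submodule_subset[OF I] N.submodule_zero[OF I] N.submodule_add[OF I]
      by (intro add.subgroupI) (auto simp: a_inv_def)
    fix a x assume "a \<in> I" "x \<in> carrier R"
    then show "x \<otimes> a \<in> I" "a \<otimes> x \<in> I"
      using N.submodule_smult[OF I, of x a] N.submodule_subset[OF I] m_comm by force+
  qed (rule ring_axioms)
  show "submodule I R (regular_module R)" if I: "ideal I R"
  proof (rule N.submoduleI_linear)
    interpret ideal I R by (rule I)
    show "I \<subseteq> carrier (regular_module R)" using a_subset by simp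
    show "\<zero>\<^bsub>regular_module R\<^esub> \<in> I" by simp
    fix a b assume "a \<in> I" "b \<in> I"
    then show "a \<oplus>\<^bsub>regular_module R\<^esub> b \<in> I" by simp
  next
    interpret ideal I R by (rule I)
    fix c a assume "c \<in> carrier R" "a \<in> I"
    then show "c \<odot>\<^bsub>regular_module R\<^esub> a \<in> I" by (simp add: I_l_closed)
  qed
qed

lemma (in cring) span_regular_eq_genideal:
  "submodule_span R (regular_module R) S = Idl S"
  by (simp add: submodule_span_def hull_def genideal_def submodule_regular_iff_ideal)

section \<open>Noetherian modules\<close>

context module
begin

text \<open>Formulated for a submodule of a fixed ambient module, so that submodules need not be
  regarded as modules of their own.\<close>

definition noetherian_sub :: "'c set \<Rightarrow> bool" where
  "noetherian_sub L \<longleftrightarrow> submodule L R M \<and> (\<forall>N. submodule N R M \<and> N \<subseteq> L \<longrightarrow> fg_submodule R M N)"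

lemma fg_submodule_span: "finite S \<Longrightarrow> S \<subseteq> carrier M \<Longrightarrow> fg_submodule R M (submodule_span R M S)"
  unfolding fg_submodule_def using span_submodule span_superset by blast

lemma noetherian_subD: "noetherian_sub L \<Longrightarrow> submodule L R M"
  "noetherian_sub L \<Longrightarrow> submodule N R M \<Longrightarrow> N \<subseteq> L \<Longrightarrow> fg_submodule R M N"
  unfolding noetherian_sub_def by auto

lemma noetherian_sub_mono:
  "noetherian_sub L \<Longrightarrow> submodule Y R M \<Longrightarrow> Y \<subseteq> L \<Longrightarrow> noetherian_sub Y"
  unfolding noetherian_sub_def by auto

text \<open>The finitely many generators already occur at one stage of the chain.\<close>

lemma fg_submodule_subset_chain:
  assumes fg: "fg_submodule R M N" and sub: "\<And>n::nat. submodule (Y n) R M"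
    and inc: "\<And>n. Y n \<subseteq> Y (Suc n)" and N: "N \<subseteq> (\<Union>n. Y n)"
  obtains n where "N \<subseteq> Y n"
proof -
  obtain S where S: "S \<subseteq> N" "finite S" "submodule_span R M S = N"
    using fg unfolding fg_submodule_def by blast
  have mono: "Y i \<subseteq> Y j" if "i \<le> j" for i j
    using lift_Suc_mono_le[of Y, OF inc that] .
  have "\<exists>n. S \<subseteq> Y n"
    using S(2) S(1)
  proof (induction S)
    case (insert x F)
    then obtain n where n: "F \<subseteq> Y n" by blast
    obtain m where m: "x \<in> Y m" using insert.prems N by blast
    have "insert x F \<subseteq> Y (max n m)"
      using n m mono[of n "max n m"] mono[of m "max n m"] by auto
    then show ?case by blast
  qed auto
  then obtain n where "S \<subseteq> Y n" ..
  then have "N \<subseteq> Y n" using span_least[OF _ sub] S(3) by blast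
  then show thesis by (rule that)
qed

text \<open>If a nonempty family had no maximal member, it would contain a strictly increasing
  sequence, whose union is finitely generated and hence equal to one of its terms.\<close>

lemma noetherian_sub_maximal:
  assumes L: "noetherian_sub L" and Y: "P Y"
    and P: "\<And>Y. P Y \<Longrightarrow> submodule Y R M \<and> Y \<subseteq> L"
  shows "\<exists>Z. P Z \<and> (\<forall>Z'. P Z' \<longrightarrow> Z \<subseteq> Z' \<longrightarrow> Z' = Z)"
proof (rule ccontr)
  assume "\<not> ?thesis"
  then have "\<forall>Z. \<exists>Z'. P Z \<longrightarrow> P Z' \<and> Z \<subset> Z'" by blast
  then obtain nxt where nxt: "\<And>Z. P Z \<Longrightarrow> P (nxt Z) \<and> Z \<subset> nxt Z" by metis
  define W where "W n = (nxt ^^ n) Y" for n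
  have PW: "P (W n)" for n
    by (induction n) (auto simp: W_def Y nxt)
  have strict: "W n \<subset> W (Suc n)" for n
    using nxt[OF PW[of n]] by (simp add: W_def)
  have "submodule (\<Union>n. W n) R M"
    by (rule submodule_UN_chain) (use P PW strict in blast)+
  moreover have "(\<Union>n. W n) \<subseteq> L" using P PW by blast
  ultimately have "fg_submodule R M (\<Union>n. W n)"
    using noetherian_subD(2)[OF L] by blast
  then obtain n where "(\<Union>n. W n) \<subseteq> W n"
    by (rule fg_submodule_subset_chain[where Y = W]) (use P PW strict in blast)+
  then show False using strict[of n] by blast
qed

text \<open>A submodule of \<open>Ra + U\<close> is generated by its intersection with \<open>U\<close> together with elements
  whose coefficients at \<open>a\<close> generate the ideal of all such coefficients.\<close>

lemma noetherian_sub_insert: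
  assumes R: "noetherian_ring R" and a: "a \<in> carrier M" and S: "S \<subseteq> carrier M"
    and N0: "noetherian_sub (submodule_span R M S)"
  shows "noetherian_sub (submodule_span R M (insert a S))"
  unfolding noetherian_sub_def
proof (intro conjI allI impI)
  let ?U = "submodule_span R M S"
  have U: "submodule ?U R M" by (rule span_submodule[OF S])
  have Uc: "z \<in> carrier M" if "z \<in> ?U" for z using submodule_subset[OF U] that by blast
  show "submodule (submodule_span R M (insert a S)) R M" using a S by (intro span_submodule) auto
  fix N assume "submodule N R M \<and> N \<subseteq> submodule_span R M (insert a S)"
  then have N: "submodule N R M" and sub: "N \<subseteq> submodule_span R M (insert a S)" by auto
  \<comment> \<open>The coefficients of \<open>a\<close> in the elements of a submodule form an ideal.\<close>
  define K where "K Y = {c \<in> carrier R. \<exists>z\<in>?U. c \<odot>\<^bsub>M\<^esub> a \<oplus>\<^bsub>M\<^esub> z \<in> Y}" for Y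
  interpret reg: module R "regular_module R" by (rule R.module_regular_module)
  have K: "ideal (K Y) R" if Y: "submodule Y R M" for Y
    unfolding R.submodule_regular_iff_ideal[symmetric]
  proof (rule reg.submoduleI_linear)
    show "K Y \<subseteq> carrier (regular_module R)" by (auto simp: K_def)
    have "\<zero> \<odot>\<^bsub>M\<^esub> a \<oplus>\<^bsub>M\<^esub> \<zero>\<^bsub>M\<^esub> \<in> Y" using a submodule_zero[OF Y] by simp
    then show "\<zero>\<^bsub>regular_module R\<^esub> \<in> K Y" using submodule_zero[OF U] by (auto simp: K_def)
  next
    fix c d assume "c \<in> K Y" "d \<in> K Y"
    then obtain z w where *: "c \<in> carrier R" "d \<in> carrier R" "z \<in> ?U" "w \<in> ?U"
      "c \<odot>\<^bsub>M\<^esub> a \<oplus>\<^bsub>M\<^esub> z \<in> Y" "d \<odot>\<^bsub>M\<^esub> a \<oplus>\<^bsub>M\<^esub> w \<in> Y" unfolding K_def by blast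
    have "(c \<odot>\<^bsub>M\<^esub> a \<oplus>\<^bsub>M\<^esub> z) \<oplus>\<^bsub>M\<^esub> (d \<odot>\<^bsub>M\<^esub> a \<oplus>\<^bsub>M\<^esub> w) = (c \<oplus> d) \<odot>\<^bsub>M\<^esub> a \<oplus>\<^bsub>M\<^esub> (z \<oplus>\<^bsub>M\<^esub> w)"
      using * a Uc by (simp add: smult_l_distr M.a_ac)
    then have "(c \<oplus> d) \<odot>\<^bsub>M\<^esub> a \<oplus>\<^bsub>M\<^esub> (z \<oplus>\<^bsub>M\<^esub> w) \<in> Y"
      using submodule_add[OF Y *(5,6)] by simp
    then show "c \<oplus>\<^bsub>regular_module R\<^esub> d \<in> K Y"
      using * submodule_add[OF U] unfolding K_def by auto
  next
    fix d c assume d: "d \<in> carrier R" and "c \<in> K Y"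
    then obtain z where *: "c \<in> carrier R" "z \<in> ?U" "c \<odot>\<^bsub>M\<^esub> a \<oplus>\<^bsub>M\<^esub> z \<in> Y" unfolding K_def by blast
    have "d \<odot>\<^bsub>M\<^esub> (c \<odot>\<^bsub>M\<^esub> a \<oplus>\<^bsub>M\<^esub> z) = (d \<otimes> c) \<odot>\<^bsub>M\<^esub> a \<oplus>\<^bsub>M\<^esub> d \<odot>\<^bsub>M\<^esub> z"
      using * d a Uc by (simp add: smult_r_distr smult_assoc1)
    then have "(d \<otimes> c) \<odot>\<^bsub>M\<^esub> a \<oplus>\<^bsub>M\<^esub> d \<odot>\<^bsub>M\<^esub> z \<in> Y"
      using submodule_smult[OF Y d *(3)] by simp
    then show "d \<odot>\<^bsub>regular_module R\<^esub> c \<in> K Y"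
      using * d submodule_smult[OF U] unfolding K_def by auto
  qed
  obtain C where C: "C \<subseteq> carrier R" "finite C" "K N = Idl C"
    using noetherian_ring.finetely_gen[OF R K[OF N]] by blast
  have "C \<subseteq> K N" using R.genideal_self[OF C(1)] C(3) by simp
  then have "\<forall>c\<in>C. \<exists>z\<in>?U. c \<odot>\<^bsub>M\<^esub> a \<oplus>\<^bsub>M\<^esub> z \<in> N" by (auto simp: K_def)
  then obtain z where z: "\<And>c. c \<in> C \<Longrightarrow> z c \<in> ?U \<and> c \<odot>\<^bsub>M\<^esub> a \<oplus>\<^bsub>M\<^esub> z c \<in> N" by metis
  have "fg_submodule R M (N \<inter> ?U)"
    using noetherian_subD(2)[OF N0 submodule_Int[OF N U]] by blast
  then obtain T where T: "T \<subseteq> N \<inter> ?U" "finite T" "submodule_span R M T = N \<inter> ?U"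
    unfolding fg_submodule_def by blast
  define G where "G = T \<union> (\<lambda>c. c \<odot>\<^bsub>M\<^esub> a \<oplus>\<^bsub>M\<^esub> z c) ` C"
  let ?W = "submodule_span R M G"
  have GN: "G \<subseteq> N" using T z by (auto simp: G_def)
  then have Gc: "G \<subseteq> carrier M" using submodule_subset[OF N] by blast
  have W: "submodule ?W R M" by (rule span_submodule[OF Gc])
  have WN: "?W \<subseteq> N" by (rule span_least[OF GN N])
  have UW: "N \<inter> ?U \<subseteq> ?W"
    using span_mono[of T G] T(3) by (auto simp: G_def)
  have "C \<subseteq> K ?W"
  proof
    fix c assume c: "c \<in> C"
    then have "c \<odot>\<^bsub>M\<^esub> a \<oplus>\<^bsub>M\<^esub> z c \<in> ?W" using span_superset[of G] by (auto simp: G_def)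
    then show "c \<in> K ?W" using c z C(1) by (auto simp: K_def)
  qed
  then have KW: "K N \<subseteq> K ?W" using R.genideal_minimal[OF K[OF W]] C(3) by simp
  have "N \<subseteq> ?W"
  proof
    fix n assume n: "n \<in> N"
    then obtain c w where c: "c \<in> carrier R" and w: "w \<in> ?U" and nc: "n = c \<odot>\<^bsub>M\<^esub> a \<oplus>\<^bsub>M\<^esub> w"
      using sub span_insert[OF a S] by blast
    then have "c \<in> K N" using n by (auto simp: K_def)
    then obtain w' where w': "w' \<in> ?U" "c \<odot>\<^bsub>M\<^esub> a \<oplus>\<^bsub>M\<^esub> w' \<in> ?W"
      using KW by (auto simp: K_def)
    let ?d = "w \<ominus>\<^bsub>M\<^esub> w'"
    have eq: "n = ?d \<oplus>\<^bsub>M\<^esub> (c \<odot>\<^bsub>M\<^esub> a \<oplus>\<^bsub>M\<^esub> w')"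
    proof -
      have "?d \<oplus>\<^bsub>M\<^esub> (c \<odot>\<^bsub>M\<^esub> a \<oplus>\<^bsub>M\<^esub> w') = (w' \<oplus>\<^bsub>M\<^esub> \<ominus>\<^bsub>M\<^esub> w') \<oplus>\<^bsub>M\<^esub> (c \<odot>\<^bsub>M\<^esub> a \<oplus>\<^bsub>M\<^esub> w)"
        using Uc[OF w] Uc[OF w'(1)] a c by (simp add: a_minus_def M.a_ac)
      then show ?thesis using Uc[OF w] Uc[OF w'(1)] a c nc by (simp add: M.r_neg)
    qed
    have d: "?d \<in> ?U" using submodule_minus[OF U w w'(1)] .
    have "?d \<in> N"
      using submodule_add_cancel[OF N, of ?d "c \<odot>\<^bsub>M\<^esub> a \<oplus>\<^bsub>M\<^esub> w'"] n eq w'(2) WN Uc[OF d] by auto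
    then have "?d \<in> ?W" using d UW by blast
    then show "n \<in> ?W" using eq submodule_add[OF W] w'(2) by simp
  qed
  then have "N = ?W" using WN by blast
  moreover have "finite G" using T(2) C(2) by (simp add: G_def)
  ultimately show "fg_submodule R M N" using fg_submodule_span[OF _ Gc] by simp
qed

lemma noetherian_sub_of_fg:
  assumes R: "noetherian_ring R" and L: "fg_submodule R M L"
  shows "noetherian_sub L"
proof -
  obtain S where S: "S \<subseteq> L" "finite S" "submodule_span R M S = L"
    using L unfolding fg_submodule_def by blast
  have "S \<subseteq> carrier M" using S(1) L submodule_subset unfolding fg_submodule_def by blast
  with S(2) have "noetherian_sub (submodule_span R M S)"
  proof (induction S)
    case empty
    have "fg_submodule R M {\<zero>\<^bsub>M\<^esub>}" using fg_submodule_span[of "{}"] by (simp add: span_empty)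
    moreover have "N = {\<zero>\<^bsub>M\<^esub>}" if "submodule N R M" "N \<subseteq> {\<zero>\<^bsub>M\<^esub>}" for N
      using submodule_zero[OF that(1)] that(2) by blast
    ultimately show ?case
      unfolding noetherian_sub_def span_empty fg_submodule_def by metis
  next
    case (insert x F)
    then show ?case using noetherian_sub_insert[OF R] by simp
  qed
  then show ?thesis using S(3) by simp
qed

end

lemma (in noetherian_ring) noetherian_sub_carrier:
  assumes "cring R"
  shows "module.noetherian_sub R (regular_module R) (carrier R)"
proof -
  interpret cring R by fact
  interpret reg: module R "regular_module R" by (rule module_regular_module)
  have "Idl {\<one>} = carrier R" by (rule genideal_one)
  then have "fg_submodule R (regular_module R) (carrier R)"
    using reg.fg_submodule_span[of "{\<one>}"] by (simp add: span_regular_eq_genideal)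
  then show ?thesis
    by (rule reg.noetherian_sub_of_fg[OF noetherian_ring_axioms])
qed

lemma (in primeideal) compl_mult:
  "s \<in> carrier R - I \<Longrightarrow> t \<in> carrier R - I \<Longrightarrow> s \<otimes> t \<in> carrier R - I"
  using I_prime by auto

lemma (in primeideal) one_compl: "\<one> \<in> carrier R - I"
  using I_notcarr one_imp_carrier by auto

section \<open>Saturation with respect to a prime ideal\<close>

context module
begin

text \<open>The elements of \<open>M\<close> whose images in the localisation at \<open>P\<close> lie in the localisation of \<open>Y\<close>.\<close>

definition sat :: "'a set \<Rightarrow> 'c set \<Rightarrow> 'c set" where
  "sat P Y = {a \<in> carrier M. \<exists>s \<in> carrier R - P. s \<odot>\<^bsub>M\<^esub> a \<in> Y}"

lemma sat_mono: "Y \<subseteq> Z \<Longrightarrow> sat P Y \<subseteq> sat P Z"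
  by (auto simp: sat_def)

lemma sat_submodule:
  assumes "primeideal P R" "submodule Y R M"
  shows "submodule (sat P Y) R M"
proof (rule submoduleI_linear)
  interpret P: primeideal P R by fact
  show "sat P Y \<subseteq> carrier M" by (auto simp: sat_def)
  show "\<zero>\<^bsub>M\<^esub> \<in> sat P Y"
    using P.one_compl submodule_zero[OF assms(2)] by (auto simp: sat_def)
  fix a b assume "a \<in> sat P Y" "b \<in> sat P Y"
  then obtain s t where s: "s \<in> carrier R - P" "s \<odot>\<^bsub>M\<^esub> a \<in> Y" and t: "t \<in> carrier R - P" "t \<odot>\<^bsub>M\<^esub> b \<in> Y"
    and ab: "a \<in> carrier M" "b \<in> carrier M" by (auto simp: sat_def)
  have "(s \<otimes> t) \<odot>\<^bsub>M\<^esub> (a \<oplus>\<^bsub>M\<^esub> b) = t \<odot>\<^bsub>M\<^esub> (s \<odot>\<^bsub>M\<^esub> a) \<oplus>\<^bsub>M\<^esub> s \<odot>\<^bsub>M\<^esub> (t \<odot>\<^bsub>M\<^esub> b)"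
    using s t ab by (simp add: smult_r_distr smult_assoc1[symmetric] R.m_comm)
  also have "\<dots> \<in> Y"
    using submodule_add[OF assms(2) submodule_smult[OF assms(2) _ s(2)] submodule_smult[OF assms(2) _ t(2)]]
      s t by blast
  finally show "a \<oplus>\<^bsub>M\<^esub> b \<in> sat P Y"
    using P.compl_mult[OF s(1) t(1)] ab by (auto simp: sat_def)
next
  fix c a assume c: "c \<in> carrier R" and "a \<in> sat P Y"
  then obtain s where s: "s \<in> carrier R - P" "s \<odot>\<^bsub>M\<^esub> a \<in> Y" and a: "a \<in> carrier M" by (auto simp: sat_def)
  have "s \<odot>\<^bsub>M\<^esub> (c \<odot>\<^bsub>M\<^esub> a) = c \<odot>\<^bsub>M\<^esub> (s \<odot>\<^bsub>M\<^esub> a)"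
    using s a c by (simp add: smult_assoc1[symmetric] R.m_comm)
  also have "\<dots> \<in> Y" using submodule_smult[OF assms(2) c s(2)] .
  finally show "c \<odot>\<^bsub>M\<^esub> a \<in> sat P Y" using s a c by (auto simp: sat_def)
qed

lemma sat_superset:
  assumes "primeideal P R" "Y \<subseteq> carrier M"
  shows "Y \<subseteq> sat P Y"
proof
  interpret P: primeideal P R by fact
  fix y assume y: "y \<in> Y"
  then have "\<one> \<odot>\<^bsub>M\<^esub> y \<in> Y" using assms(2) by auto
  then show "y \<in> sat P Y" using P.one_compl y assms(2) unfolding sat_def by blast
qed

lemma sat_sat:
  assumes "primeideal P R" "a \<in> sat P (sat P Y)"
  shows "a \<in> sat P Y"
proof -
  interpret P: primeideal P R by fact
  obtain s t where s: "s \<in> carrier R - P" and t: "t \<in> carrier R - P"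
    and a: "a \<in> carrier M" and *: "t \<odot>\<^bsub>M\<^esub> (s \<odot>\<^bsub>M\<^esub> a) \<in> Y" using assms(2) by (auto simp: sat_def)
  have "(t \<otimes> s) \<odot>\<^bsub>M\<^esub> a \<in> Y" using * s t a by (simp add: smult_assoc1)
  then show ?thesis using P.compl_mult[OF t s] a by (auto simp: sat_def)
qed

lemma satI: "s \<in> carrier R \<Longrightarrow> s \<notin> P \<Longrightarrow> a \<in> carrier M \<Longrightarrow> s \<odot>\<^bsub>M\<^esub> a \<in> Y \<Longrightarrow> a \<in> sat P Y"
  by (auto simp: sat_def)

lemma sat_cancel:
  assumes "primeideal P R" "s \<in> carrier R" "s \<notin> P" "a \<in> carrier M" "s \<odot>\<^bsub>M\<^esub> a \<in> sat P Y"
  shows "a \<in> sat P Y"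
  by (rule sat_sat[OF assms(1)]) (use assms satI in blast)

text \<open>The product of the denominators of finitely many generators is a common denominator.\<close>

lemma sat_uniform_denominator:
  assumes P: "primeideal P R" and fg: "fg_submodule R M L" and Y: "submodule Y R M" and LY: "L \<subseteq> sat P Y"
  obtains s where "s \<in> carrier R - P" "\<And>a. a \<in> L \<Longrightarrow> s \<odot>\<^bsub>M\<^esub> a \<in> Y"
proof -
  interpret P: primeideal P R by fact
  obtain S where S: "S \<subseteq> L" "finite S" "submodule_span R M S = L"
    using fg unfolding fg_submodule_def by blast
  have "\<exists>s \<in> carrier R - P. \<forall>a\<in>S. s \<odot>\<^bsub>M\<^esub> a \<in> Y"
    using S(2) S(1)
  proof (induction S)
    case empty
    then show ?case using P.one_compl by blast
  next
    case (insert x F)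
    then obtain s where s: "s \<in> carrier R - P" "\<forall>a\<in>F. s \<odot>\<^bsub>M\<^esub> a \<in> Y" by blast
    obtain t where t: "t \<in> carrier R - P" "t \<odot>\<^bsub>M\<^esub> x \<in> Y" and x: "x \<in> carrier M"
      using insert.prems LY unfolding sat_def by blast
    have "(s \<otimes> t) \<odot>\<^bsub>M\<^esub> a \<in> Y" if a: "a \<in> insert x F" for a
    proof -
      have ac: "a \<in> carrier M" using a insert.prems LY unfolding sat_def by blast
      have "(s \<otimes> t) \<odot>\<^bsub>M\<^esub> a = s \<odot>\<^bsub>M\<^esub> (t \<odot>\<^bsub>M\<^esub> a)" "(s \<otimes> t) \<odot>\<^bsub>M\<^esub> a = t \<odot>\<^bsub>M\<^esub> (s \<odot>\<^bsub>M\<^esub> a)"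
        using s t ac by (simp_all add: smult_assoc1[symmetric] R.m_comm)
      then show ?thesis using a s t submodule_smult[OF Y] by (metis DiffD1 insert_iff)
    qed
    then show ?case using P.compl_mult[OF s(1) t(1)] by blast
  qed
  then obtain s where s: "s \<in> carrier R - P" "\<forall>a\<in>S. s \<odot>\<^bsub>M\<^esub> a \<in> Y" by blast
  have "submodule {a \<in> carrier M. s \<odot>\<^bsub>M\<^esub> a \<in> Y} R M"
    using scalar_preimage_submodule[OF Y] s(1) by blast
  moreover have "L \<subseteq> carrier M" using LY by (auto simp: sat_def)
  then have "S \<subseteq> {a \<in> carrier M. s \<odot>\<^bsub>M\<^esub> a \<in> Y}" using S(1) s(2) by auto
  ultimately have "L \<subseteq> {a \<in> carrier M. s \<odot>\<^bsub>M\<^esub> a \<in> Y}"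
    using span_least[of S] S(3) by simp
  then show thesis using that[OF s(1)] by blast
qed

text \<open>Nakayama's lemma over the localisation at \<open>P\<close>. Otherwise there is a maximal proper saturated
  submodule \<open>Z\<close> of \<open>L\<close> containing \<open>L \<inter> Y\<close>. Maximality forces \<open>PL \<subseteq> Z\<close>: for \<open>pa \<notin> Z\<close> the saturation of \<open>Z + Rpa\<close>
  contains \<open>a\<close>, and a relation \<open>ta = cpa + z\<close> puts \<open>(t - cp)a\<close> into \<open>Z\<close> with \<open>t - cp \<notin> P\<close>. Hence
  \<open>L = Y + PL\<close>, read locally, gives \<open>L \<subseteq> Z\<close>.\<close>

lemma nakayama_sat:
  assumes L: "noetherian_sub L" and Y: "submodule Y R M" and P: "primeideal P R"
    and gen: "\<And>a. a \<in> L \<Longrightarrow> \<exists>s \<in> carrier R - P. \<exists>y \<in> Y.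
      \<exists>z \<in> submodule_span R M {p \<odot>\<^bsub>M\<^esub> b | p b. p \<in> P \<and> b \<in> L}. s \<odot>\<^bsub>M\<^esub> a = y \<oplus>\<^bsub>M\<^esub> z"
  shows "L \<subseteq> sat P Y"
proof (rule ccontr)
  assume notsub: "\<not> L \<subseteq> sat P Y"
  interpret P: primeideal P R by fact
  have Ls: "submodule L R M" by (rule noetherian_subD(1)[OF L])
  have Lc: "a \<in> carrier M" if "a \<in> L" for a using that submodule_subset[OF Ls] by blast
  define good where "good Z \<longleftrightarrow> submodule Z R M \<and> Z \<subseteq> L \<and> sat P Z \<inter> L \<subseteq> Z \<and> Y \<inter> L \<subseteq> Z \<and> Z \<noteq> L" for Z
  have "good (sat P Y \<inter> L)"
    unfolding good_def
    using submodule_Int[OF sat_submodule[OF P Y] Ls] sat_mono[of "sat P Y \<inter> L" "sat P Y" P]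
      sat_sat[OF P, of _ Y] sat_superset[OF P submodule_subset[OF Y]] notsub by blast
  moreover have "submodule Z R M \<and> Z \<subseteq> L" if "good Z" for Z using that by (simp add: good_def)
  ultimately obtain Z where Z: "good Z" and max: "\<And>Z'. good Z' \<Longrightarrow> Z \<subseteq> Z' \<Longrightarrow> Z' = Z"
    using noetherian_sub_maximal[where P = good, OF L] by blast
  have Zs: "submodule Z R M" and ZL: "Z \<subseteq> L" and Zsat: "sat P Z \<inter> L \<subseteq> Z"
    and YZ: "Y \<inter> L \<subseteq> Z" and ZneL: "Z \<noteq> L" using Z unfolding good_def by auto
  have big: "L \<subseteq> sat P (submodule_span R M (insert a Z))" if a: "a \<in> L" "a \<notin> Z" for a
  proof (rule ccontr)
    let ?W = "submodule_span R M (insert a Z)"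
    assume not: "\<not> L \<subseteq> sat P ?W"
    have W: "submodule ?W R M" using Lc[OF a(1)] submodule_subset[OF Zs] by (intro span_submodule) auto
    have W': "?W \<subseteq> sat P ?W" by (rule sat_superset[OF P submodule_subset[OF W]])
    have aW: "a \<in> ?W" "Z \<subseteq> ?W" using span_superset[of "insert a Z"] by auto
    have "good (sat P ?W \<inter> L)"
      unfolding good_def
      using submodule_Int[OF sat_submodule[OF P W] Ls] sat_mono[of "sat P ?W \<inter> L" "sat P ?W" P]
      sat_sat[OF P, of _ ?W] W' not YZ aW by blast
    then have "sat P ?W \<inter> L = Z" using max aW W' ZL by blast
    then show False using a aW W' by blast
  qed
  have PL: "p \<odot>\<^bsub>M\<^esub> a \<in> Z" if p: "p \<in> P" and a: "a \<in> L" for p a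
  proof (rule ccontr)
    assume pa: "p \<odot>\<^bsub>M\<^esub> a \<notin> Z"
    have pc: "p \<in> carrier R" using p by (rule P.Icarr)
    have aZ: "a \<notin> Z" using pa submodule_smult[OF Zs pc] by blast
    have "p \<odot>\<^bsub>M\<^esub> a \<in> L" using submodule_smult[OF Ls pc a] .
    then have "a \<in> sat P (submodule_span R M (insert (p \<odot>\<^bsub>M\<^esub> a) Z))" using big[OF _ pa] a by blast
    then obtain t where t: "t \<in> carrier R - P"
      and ta: "t \<odot>\<^bsub>M\<^esub> a \<in> submodule_span R M (insert (p \<odot>\<^bsub>M\<^esub> a) Z)" by (auto simp: sat_def)
    then obtain c z where c: "c \<in> carrier R" and z: "z \<in> Z" and eq: "t \<odot>\<^bsub>M\<^esub> a = c \<odot>\<^bsub>M\<^esub> (p \<odot>\<^bsub>M\<^esub> a) \<oplus>\<^bsub>M\<^esub> z"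
      using span_insert_submodule[OF _ Zs, of "p \<odot>\<^bsub>M\<^esub> a"] pc Lc[OF a] by auto
    have zc: "z \<in> carrier M" using z ZL Lc by blast
    have cp: "c \<otimes> p \<in> P" using P.I_l_closed[OF p c] .
    have d: "t \<ominus> c \<otimes> p \<in> carrier R" using t c pc by auto
    have tcp: "t \<ominus> c \<otimes> p \<notin> P"
    proof
      assume "t \<ominus> c \<otimes> p \<in> P"
      then have "(t \<ominus> c \<otimes> p) \<oplus> c \<otimes> p \<in> P" using cp by simp
      moreover have "(t \<ominus> c \<otimes> p) \<oplus> c \<otimes> p = t" using t c pc by (simp add: a_minus_def R.a_assoc R.l_neg)
      ultimately show False using t by simp
    qed
    have "(t \<ominus> c \<otimes> p) \<odot>\<^bsub>M\<^esub> a = t \<odot>\<^bsub>M\<^esub> a \<oplus>\<^bsub>M\<^esub> \<ominus>\<^bsub>M\<^esub> (c \<odot>\<^bsub>M\<^esub> (p \<odot>\<^bsub>M\<^esub> a))"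
      using t c pc Lc[OF a] by (simp add: a_minus_def smult_l_distr smult_l_minus smult_assoc1)
    also have "\<dots> = z"
      unfolding eq using c pc Lc[OF a] zc by (simp add: M.a_ac M.r_neg1 M.r_neg)
    finally have "a \<in> sat P Z" using satI[OF d tcp Lc[OF a]] z by simp
    then show False using Zsat a aZ by blast
  qed
  obtain a where a: "a \<in> L" "a \<notin> Z" using ZL ZneL by blast
  obtain s y z where s: "s \<in> carrier R - P" and y: "y \<in> Y"
    and z: "z \<in> submodule_span R M {p \<odot>\<^bsub>M\<^esub> b | p b. p \<in> P \<and> b \<in> L}" and eq: "s \<odot>\<^bsub>M\<^esub> a = y \<oplus>\<^bsub>M\<^esub> z"
    using gen[OF a(1)] by blast
  have "submodule_span R M {p \<odot>\<^bsub>M\<^esub> b | p b. p \<in> P \<and> b \<in> L} \<subseteq> Z"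
    by (rule span_least[OF _ Zs]) (use PL in blast)
  then have zZ: "z \<in> Z" using z by blast
  have "y \<oplus>\<^bsub>M\<^esub> z \<in> L" using submodule_smult[OF Ls _ a(1), of s] s eq by simp
  then have "y \<in> L" using submodule_add_cancel[OF Ls, of y z] zZ ZL y submodule_subset[OF Y] by blast
  then have "s \<odot>\<^bsub>M\<^esub> a \<in> Z" using submodule_add[OF Zs _ zZ] eq y YZ by auto
  then have "a \<in> sat P Z" using satI s Lc[OF a(1)] by blast
  then show False using Zsat a by blast
qed

text \<open>The hypothesis says that, localised at \<open>P\<close>, some power of each element of \<open>P\<close> annihilates
  \<open>L 0\<close> modulo the intersection of the chain, so that this quotient has finite length and the
  chain must be stationary at some step. The proof avoids lengths: it takes a maximal \<open>Y\<close> for which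
  the traces \<open>L r \<inter> Y\<close> are eventually locally stationary. If \<open>Y\<close> were not locally all of \<open>L 0\<close>,
  there would be an \<open>a \<notin> sat P Y\<close> with \<open>Pa \<subseteq> sat P Y\<close>, and \<open>Y + Ra\<close> would
  do as well, because \<open>Ra\<close> contributes at most a one-dimensional space over the residue field.\<close>

lemma descending_chain_sat:
  fixes L :: "nat \<Rightarrow> 'c set"
  assumes R: "noetherian_ring R" and L0: "noetherian_sub (L 0)" and Ls: "\<And>r. submodule (L r) R M"
    and dec: "\<And>r. L (Suc r) \<subseteq> L r" and P: "primeideal P R"
    and nil: "\<And>y. y \<in> P \<Longrightarrow> \<exists>s \<in> carrier R - P. \<exists>n::nat. \<forall>r. \<forall>a \<in> L 0. (s \<otimes> y [^] n) \<odot>\<^bsub>M\<^esub> a \<in> L r"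
  shows "\<exists>r. L r \<subseteq> sat P (L (Suc r))"
proof -
  interpret P: primeideal P R by fact
  interpret reg: module R "regular_module R" by (rule R.module_regular_module)
  have anti: "L j \<subseteq> L i" if "i \<le> j" for i j
    using lift_Suc_antimono_le[of L, OF dec that] .
  have Lc: "a \<in> carrier M" if "a \<in> L r" for a r using that submodule_subset[OF Ls] by blast
  define good where "good Y \<longleftrightarrow> submodule Y R M \<and> Y \<subseteq> L 0 \<and> (\<Inter>r. L r) \<subseteq> Y \<and>
     (\<exists>r0. \<forall>r\<ge>r0. L r \<inter> Y \<subseteq> sat P (L (Suc r)))" for Y
  have "good (\<Inter>r. L r)"
    unfolding good_def
  proof (intro conjI exI allI impI)
    show "submodule (\<Inter>r. L r) R M" by (rule submodule_Inter) (use Ls in auto)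
    fix r show "L r \<inter> (\<Inter>r. L r) \<subseteq> sat P (L (Suc r))"
      using sat_superset[OF P submodule_subset[OF Ls]] by blast
  qed auto
  moreover have "submodule Y R M \<and> Y \<subseteq> L 0" if "good Y" for Y using that by (simp add: good_def)
  ultimately obtain Y where Y: "good Y" and max: "\<And>Z'. good Z' \<Longrightarrow> Y \<subseteq> Z' \<Longrightarrow> Z' = Y"
    using noetherian_sub_maximal[where P = good, OF L0] by blast
  from Y obtain r0 where Ys: "submodule Y R M" and YL: "Y \<subseteq> L 0" and IY: "(\<Inter>r. L r) \<subseteq> Y"
    and r0: "\<And>r. r \<ge> r0 \<Longrightarrow> L r \<inter> Y \<subseteq> sat P (L (Suc r))" unfolding good_def by blast
  have satY: "submodule (sat P Y) R M" by (rule sat_submodule[OF P Ys])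
  have "L 0 \<subseteq> sat P Y"
  proof (rule ccontr)
    assume "\<not> L 0 \<subseteq> sat P Y"
    then obtain a0 where a0: "a0 \<in> L 0" "a0 \<notin> sat P Y" by blast
    define Ann where "Ann a = {c \<in> carrier R. c \<odot>\<^bsub>M\<^esub> a \<in> sat P Y}" for a
    define Q where "Q I \<longleftrightarrow> (\<exists>a \<in> L 0. a \<notin> sat P Y \<and> I = Ann a)" for I
    have Ann: "submodule (Ann a) R (regular_module R)" if a: "a \<in> L 0" for a
    proof (rule reg.submoduleI_linear)
      note ac = Lc[OF a]
      show "\<zero>\<^bsub>regular_module R\<^esub> \<in> Ann a" using ac submodule_zero[OF satY] by (simp add: Ann_def)
      show "c \<oplus>\<^bsub>regular_module R\<^esub> d \<in> Ann a" if "c \<in> Ann a" "d \<in> Ann a" for c d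
        using that ac submodule_add[OF satY] by (simp add: Ann_def smult_l_distr)
      show "c \<odot>\<^bsub>regular_module R\<^esub> d \<in> Ann a" if "c \<in> carrier R" "d \<in> Ann a" for c d
        using that ac submodule_smult[OF satY] by (simp add: Ann_def smult_assoc1)
    qed (auto simp: Ann_def)
    have Q0: "Q (Ann a0)" using a0 by (auto simp: Q_def)
    have "\<exists>I. Q I \<and> (\<forall>I'. Q I' \<longrightarrow> I \<subseteq> I' \<longrightarrow> I' = I)"
    proof (rule reg.noetherian_sub_maximal[where P = Q and L = "carrier R" and Y = "Ann a0"])
      show "reg.noetherian_sub (carrier R)"
        by (rule noetherian_ring.noetherian_sub_carrier[OF R R.is_cring])
      show "submodule Z R (regular_module R) \<and> Z \<subseteq> carrier R" if "Q Z" for Z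
        using that Ann unfolding Q_def Ann_def by auto
    qed (rule Q0)
    then obtain I where QI: "Q I" and maxI: "\<And>I'. Q I' \<Longrightarrow> I \<subseteq> I' \<Longrightarrow> I' = I" by blast
    then obtain a where a: "a \<in> L 0" "a \<notin> sat P Y" and I: "I = Ann a" by (auto simp: Q_def)
    note ac = Lc[OF a(1)]
    \<comment> \<open>By maximality of the annihilator, \<open>P\<close> kills \<open>a\<close> modulo \<open>sat P Y\<close>.\<close>
    have Pa: "y \<odot>\<^bsub>M\<^esub> a \<in> sat P Y" if y: "y \<in> P" for y
    proof (rule ccontr)
      assume ya: "y \<odot>\<^bsub>M\<^esub> a \<notin> sat P Y"
      have yc: "y \<in> carrier R" using y by (rule P.Icarr)
      obtain s n where s: "s \<in> carrier R - P" and sn: "\<forall>r. \<forall>a \<in> L 0. (s \<otimes> y [^] (n::nat)) \<odot>\<^bsub>M\<^esub> a \<in> L r"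
        using nil[OF y] by blast
      have "(s \<otimes> y [^] n) \<odot>\<^bsub>M\<^esub> a \<in> Y" using sn a IY by blast
      then have "s \<odot>\<^bsub>M\<^esub> ((y [^] n) \<odot>\<^bsub>M\<^esub> a) \<in> Y" using s yc ac by (simp add: smult_assoc1)
      then have ex: "(y [^] n) \<odot>\<^bsub>M\<^esub> a \<in> sat P Y" using satI[of s P] s yc ac by auto
      define k where "k = (LEAST k::nat. (y [^] k) \<odot>\<^bsub>M\<^esub> a \<in> sat P Y)"
      have k: "(y [^] k) \<odot>\<^bsub>M\<^esub> a \<in> sat P Y" unfolding k_def using ex by (rule LeastI)
      have k0: "k \<noteq> 0" using k a(2) ac by (metis R.nat_pow_0 smult_one)
      then obtain j where j: "k = Suc j" using not0_implies_Suc by blast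
      let ?b = "(y [^] j) \<odot>\<^bsub>M\<^esub> a"
      have bY: "?b \<notin> sat P Y" using not_less_Least[of j "\<lambda>k. (y [^] k) \<odot>\<^bsub>M\<^esub> a \<in> sat P Y"] j k_def by auto
      have b0: "?b \<in> L 0" using submodule_smult[OF Ls _ a(1)] yc by simp
      have yb: "y \<odot>\<^bsub>M\<^esub> ?b \<in> sat P Y" using k yc ac j by (simp add: smult_assoc1[symmetric] R.m_comm)
      have "Ann a \<subseteq> Ann ?b"
      proof
        fix c assume c: "c \<in> Ann a"
        then have "c \<odot>\<^bsub>M\<^esub> ?b = (y [^] j) \<odot>\<^bsub>M\<^esub> (c \<odot>\<^bsub>M\<^esub> a)"
          using yc ac by (simp add: smult_assoc1[symmetric] R.m_comm Ann_def)
        then show "c \<in> Ann ?b" using c submodule_smult[OF satY, of "y [^] j"] yc by (simp add: Ann_def)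
      qed
      then have "Ann ?b = Ann a" using maxI[of "Ann ?b"] I bY b0 by (auto simp: Q_def)
      moreover have "y \<in> Ann ?b" using yb yc by (simp add: Ann_def)
      ultimately show False using ya by (simp add: Ann_def)
    qed
    let ?W = "submodule_span R M (insert a Y)"
    have W: "submodule ?W R M" using ac submodule_subset[OF Ys] by (intro span_submodule) auto
    have Wel: "w \<in> ?W \<longleftrightarrow> (\<exists>c z. c \<in> carrier R \<and> z \<in> Y \<and> w = c \<odot>\<^bsub>M\<^esub> a \<oplus>\<^bsub>M\<^esub> z)" for w
      using span_insert_submodule[OF ac Ys] by auto
    have zc: "z \<in> carrier M" if "z \<in> Y" for z using that YL Lc by blast
    \<comment> \<open>Either some term of the chain has no element with coefficient at \<open>a\<close> outside \<open>P\<close>, and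
      \<open>a\<close> is locally lost from then on, or every term has one, and \<open>a\<close> can always be eliminated.\<close>
    have "\<exists>r1. \<forall>r\<ge>r1. L r \<inter> ?W \<subseteq> sat P (L (Suc r))"
    proof (cases "\<exists>r1. \<forall>c z. c \<in> carrier R \<and> z \<in> Y \<and> c \<odot>\<^bsub>M\<^esub> a \<oplus>\<^bsub>M\<^esub> z \<in> L r1 \<longrightarrow> c \<in> P")
      case True
      then obtain r1 where r1: "\<And>c z. c \<in> carrier R \<Longrightarrow> z \<in> Y \<Longrightarrow> c \<odot>\<^bsub>M\<^esub> a \<oplus>\<^bsub>M\<^esub> z \<in> L r1 \<Longrightarrow> c \<in> P"
        by blast
      show ?thesis
      proof (intro exI[of _ "max r0 r1"] allI impI subsetI)
        fix r w assume r: "max r0 r1 \<le> r" and w: "w \<in> L r \<inter> ?W"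
        then obtain c z where c: "c \<in> carrier R" and z: "z \<in> Y" and wcz: "w = c \<odot>\<^bsub>M\<^esub> a \<oplus>\<^bsub>M\<^esub> z"
          using Wel by blast
        have "w \<in> L r1" using w r anti[of r1 r] by auto
        then have "c \<in> P" using r1[OF c z] wcz by simp
        then have "w \<in> sat P Y"
          using submodule_add[OF satY Pa, of c z] z sat_superset[OF P submodule_subset[OF Ys]] wcz by blast
        then obtain s where s: "s \<in> carrier R - P" "s \<odot>\<^bsub>M\<^esub> w \<in> Y" by (auto simp: sat_def)
        have "s \<odot>\<^bsub>M\<^esub> w \<in> L r" using submodule_smult[OF Ls] s w by blast
        then have "s \<odot>\<^bsub>M\<^esub> w \<in> sat P (L (Suc r))" using r0[of r] r s by auto
        then show "w \<in> sat P (L (Suc r))" using sat_cancel[OF P _ _ _ \<open>s \<odot>\<^bsub>M\<^esub> w \<in> sat P _\<close>] s w Lc by blast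
      qed
    next
      case False
      show ?thesis
      proof (intro exI[of _ r0] allI impI subsetI)
        fix r w assume r: "r0 \<le> r" and w: "w \<in> L r \<inter> ?W"
        then obtain c z where c: "c \<in> carrier R" and z: "z \<in> Y" and wcz: "w = c \<odot>\<^bsub>M\<^esub> a \<oplus>\<^bsub>M\<^esub> z"
          using Wel by blast
        obtain d u where d: "d \<in> carrier R" "d \<notin> P" and u: "u \<in> Y"
          and v: "d \<odot>\<^bsub>M\<^esub> a \<oplus>\<^bsub>M\<^esub> u \<in> L (Suc r)" using False by blast
        let ?v = "d \<odot>\<^bsub>M\<^esub> a \<oplus>\<^bsub>M\<^esub> u"
        \<comment> \<open>Eliminate \<open>a\<close> between \<open>w\<close> and an element of \<open>L (Suc r)\<close> with coefficient outside \<open>P\<close>.\<close>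
        have cv: "c \<odot>\<^bsub>M\<^esub> ?v \<in> L (Suc r)" by (rule submodule_smult[OF Ls c v])
        have dw: "d \<odot>\<^bsub>M\<^esub> w \<in> L r" using submodule_smult[OF Ls d(1)] w by blast
        let ?e = "d \<odot>\<^bsub>M\<^esub> w \<ominus>\<^bsub>M\<^esub> c \<odot>\<^bsub>M\<^esub> ?v"
        have "?e = d \<odot>\<^bsub>M\<^esub> z \<ominus>\<^bsub>M\<^esub> c \<odot>\<^bsub>M\<^esub> u"
        proof -
          let ?t = "(c \<otimes> d) \<odot>\<^bsub>M\<^esub> a"
          have carr: "?t \<in> carrier M" "d \<odot>\<^bsub>M\<^esub> z \<in> carrier M" "c \<odot>\<^bsub>M\<^esub> u \<in> carrier M"
            using c d ac zc[OF z] zc[OF u] by auto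
          have 1: "d \<odot>\<^bsub>M\<^esub> w = ?t \<oplus>\<^bsub>M\<^esub> d \<odot>\<^bsub>M\<^esub> z" "c \<odot>\<^bsub>M\<^esub> ?v = ?t \<oplus>\<^bsub>M\<^esub> c \<odot>\<^bsub>M\<^esub> u"
            unfolding wcz using c d ac zc[OF z] zc[OF u]
            by (simp_all add: smult_r_distr smult_assoc1[symmetric] R.m_comm)
          have "(?t \<oplus>\<^bsub>M\<^esub> d \<odot>\<^bsub>M\<^esub> z) \<oplus>\<^bsub>M\<^esub> (\<ominus>\<^bsub>M\<^esub> ?t \<oplus>\<^bsub>M\<^esub> \<ominus>\<^bsub>M\<^esub> (c \<odot>\<^bsub>M\<^esub> u)) =
             (?t \<oplus>\<^bsub>M\<^esub> \<ominus>\<^bsub>M\<^esub> ?t) \<oplus>\<^bsub>M\<^esub> (d \<odot>\<^bsub>M\<^esub> z \<oplus>\<^bsub>M\<^esub> \<ominus>\<^bsub>M\<^esub> (c \<odot>\<^bsub>M\<^esub> u))"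
            using carr by (simp add: M.a_ac)
          then show ?thesis unfolding 1 using carr by (simp add: a_minus_def M.minus_add M.r_neg)
        qed
        then have "?e \<in> Y" using submodule_minus[OF Ys] submodule_smult[OF Ys] c d z u by simp
        moreover have "?e \<in> L r" using submodule_minus[OF Ls dw] cv dec by blast
        ultimately have e: "?e \<in> sat P (L (Suc r))" using r0[OF r] by blast
        note sL = sat_submodule[OF P Ls[of "Suc r"]]
        have "?e \<oplus>\<^bsub>M\<^esub> c \<odot>\<^bsub>M\<^esub> ?v \<in> sat P (L (Suc r))"
          using submodule_add[OF sL e] cv sat_superset[OF P submodule_subset[OF Ls]] by blast
        moreover have "?e \<oplus>\<^bsub>M\<^esub> c \<odot>\<^bsub>M\<^esub> ?v = d \<odot>\<^bsub>M\<^esub> w"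
          using Lc[OF dw] Lc[OF cv] by (simp add: a_minus_def M.a_assoc M.l_neg)
        ultimately show "w \<in> sat P (L (Suc r))" using sat_cancel[OF P d] w Lc by auto
      qed
    qed
    moreover have "?W \<subseteq> L 0" using a YL Ls by (intro span_least) auto
    moreover have "Y \<subseteq> ?W" "a \<in> ?W" using span_superset[of "insert a Y"] by auto
    moreover have "(\<Inter>r. L r) \<subseteq> ?W" using IY \<open>Y \<subseteq> ?W\<close> by (rule subset_trans)
    ultimately have "good ?W" using W unfolding good_def by (intro conjI)
    then have "?W = Y" using max \<open>Y \<subseteq> ?W\<close> by simp
    then show False using \<open>a \<in> ?W\<close> a(2) sat_superset[OF P submodule_subset[OF Ys]] by blast
  qed
  have "L r0 \<subseteq> sat P (L (Suc r0))"
  proof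
    fix w assume w: "w \<in> L r0"
    then have "w \<in> sat P Y" using anti[of 0 r0] \<open>L 0 \<subseteq> sat P Y\<close> by auto
    then obtain s where s: "s \<in> carrier R - P" "s \<odot>\<^bsub>M\<^esub> w \<in> Y" by (auto simp: sat_def)
    have "s \<odot>\<^bsub>M\<^esub> w \<in> L r0" using submodule_smult[OF Ls] s w by blast
    then have "s \<odot>\<^bsub>M\<^esub> w \<in> sat P (L (Suc r0))" using r0[of r0] s by auto
    then show "w \<in> sat P (L (Suc r0))" using sat_cancel[OF P _ _ _ \<open>s \<odot>\<^bsub>M\<^esub> w \<in> sat P _\<close>] s w Lc by blast
  qed
  then show ?thesis ..
qed

end

section \<open>Minimal primes and the principal ideal theorem\<close>

locale noetherian_cring = cring + noetherian_ring

lemma (in cring) ideal_submodule_regular: "ideal I R \<Longrightarrow> submodule I R (regular_module R)"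
  by (simp add: submodule_regular_iff_ideal)

text \<open>By induction on \<open>m + n\<close>: write one factor \<open>a \<oplus> b\<close> as a sum and absorb \<open>a\<close> or \<open>b\<close> into \<open>u\<close>.\<close>

lemma (in cring) add_pow_mem_ideal:
  assumes I: "ideal I R" and abu: "a \<in> carrier R" "b \<in> carrier R" "u \<in> carrier R"
    and "u \<otimes> a [^] (m::nat) \<in> I" "u \<otimes> b [^] (n::nat) \<in> I"
  shows "u \<otimes> (a \<oplus> b) [^] (m + n) \<in> I"
  using abu(3) assms(5,6)
proof (induction "m + n" arbitrary: m n u)
  case 0
  then show ?case by simp
next
  case (Suc k)
  interpret I: ideal I R by (rule I)
  show ?case
  proof (cases "m = 0 \<or> n = 0")
    case True
    then have "u \<in> I" using Suc.prems by auto
    then show ?thesis using abu by (simp add: I.I_r_closed)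
  next
    case False
    then obtain m' n' where mn: "m = Suc m'" "n = Suc n'" by (meson not0_implies_Suc)
    have "(u \<otimes> a) \<otimes> (a \<oplus> b) [^] (m' + n) \<in> I"
    proof (rule Suc.hyps(1))
      show "k = m' + n" using Suc.hyps(2) mn by simp
      show "u \<otimes> a \<in> carrier R" using Suc.prems abu by simp
      have "(u \<otimes> a) \<otimes> a [^] m' = u \<otimes> a [^] m" using Suc.prems abu mn by (simp add: m_ac)
      then show "(u \<otimes> a) \<otimes> a [^] m' \<in> I" using Suc.prems by simp
      have "(u \<otimes> a) \<otimes> b [^] n = a \<otimes> (u \<otimes> b [^] n)" using Suc.prems abu by (simp add: m_ac)
      then show "(u \<otimes> a) \<otimes> b [^] n \<in> I" using Suc.prems abu by (simp add: I.I_l_closed)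
    qed
    moreover have "(u \<otimes> b) \<otimes> (a \<oplus> b) [^] (m + n') \<in> I"
    proof (rule Suc.hyps(1))
      show "k = m + n'" using Suc.hyps(2) mn by simp
      show "u \<otimes> b \<in> carrier R" using Suc.prems abu by simp
      have "(u \<otimes> b) \<otimes> b [^] n' = u \<otimes> b [^] n" using Suc.prems abu mn by (simp add: m_ac)
      then show "(u \<otimes> b) \<otimes> b [^] n' \<in> I" using Suc.prems by simp
      have "(u \<otimes> b) \<otimes> a [^] m = b \<otimes> (u \<otimes> a [^] m)" using Suc.prems abu by (simp add: m_ac)
      then show "(u \<otimes> b) \<otimes> a [^] m \<in> I" using Suc.prems abu by (simp add: I.I_l_closed)
    qed
    moreover have "u \<otimes> (a \<oplus> b) [^] (m + n) = (u \<otimes> a) \<otimes> (a \<oplus> b) [^] (m' + n) \<oplus> (u \<otimes> b) \<otimes> (a \<oplus> b) [^] (m + n')"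
    proof -
      let ?c = "(a \<oplus> b) [^] (m' + n)"
      have "(a \<oplus> b) [^] (m + n) = ?c \<otimes> (a \<oplus> b)" "(a \<oplus> b) [^] (m + n') = ?c"
        using mn by simp_all
      then show ?thesis using Suc.prems abu by (simp add: r_distr l_distr m_ac)
    qed
    ultimately show ?thesis using I.a_closed by simp
  qed
qed

context noetherian_cring
begin

text \<open>Among the multiplicative sets disjoint from \<open>I\<close> and containing the complement of \<open>N\<close>,
  take one for which the radical of the localised ideal is as large as possible. If that radical
  does not contain \<open>z\<close>, then adjoining the powers of \<open>z\<close> to the multiplicative set does not
  enlarge the radical, which makes the radical a prime ideal. The last conclusion says that \<open>P\<close> is minimal over \<open>I\<close>.\<close>

lemma minimal_prime_exists:
  assumes I: "ideal I R" and N: "primeideal N R" and IN: "I \<subseteq> N"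
  obtains P where "primeideal P R" "I \<subseteq> P" "P \<subseteq> N"
    "\<And>y. y \<in> P \<Longrightarrow> \<exists>s \<in> carrier R - P. \<exists>n::nat. s \<otimes> y [^] n \<in> I"
proof -
  interpret I: ideal I R by (rule I)
  interpret N: primeideal N R by (rule N)
  interpret reg: module R "regular_module R" by (rule module_regular_module)
  define mult where "mult T \<longleftrightarrow> carrier R - N \<subseteq> T \<and> T \<subseteq> carrier R \<and> T \<inter> I = {} \<and>
    (\<forall>s\<in>T. \<forall>t\<in>T. s \<otimes> t \<in> T)" for T
  define rad where "rad T = {a \<in> carrier R. \<exists>t\<in>T. \<exists>n::nat. t \<otimes> a [^] n \<in> I}" for T
  have rad: "ideal (rad T) R" if T: "mult T" for T
    unfolding submodule_regular_iff_ideal[symmetric]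
  proof (rule reg.submoduleI_linear)
    have Tc: "t \<in> carrier R" if "t \<in> T" for t using that T by (auto simp: mult_def)
    have T1: "\<one> \<in> T" using T N.one_compl by (auto simp: mult_def)
    show "rad T \<subseteq> carrier (regular_module R)" by (auto simp: rad_def)
    have "\<one> \<otimes> \<zero> [^] (1::nat) \<in> I" by simp
    then show "\<zero>\<^bsub>regular_module R\<^esub> \<in> rad T" using T1 unfolding rad_def by (auto intro!: bexI[of _ \<one>] exI[of _ "1::nat"])
    fix a b assume "a \<in> rad T" "b \<in> rad T"
    then obtain s t m n where s: "s \<in> T" "s \<otimes> a [^] (m::nat) \<in> I" and t: "t \<in> T" "t \<otimes> b [^] (n::nat) \<in> I"
      and ab: "a \<in> carrier R" "b \<in> carrier R" by (auto simp: rad_def)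
    have st: "s \<otimes> t \<in> T" using T s t by (auto simp: mult_def)
    have "s \<otimes> t \<otimes> a [^] m = t \<otimes> (s \<otimes> a [^] m)" "s \<otimes> t \<otimes> b [^] n = s \<otimes> (t \<otimes> b [^] n)"
      using Tc[OF s(1)] Tc[OF t(1)] ab by (simp_all add: m_ac)
    then have "(s \<otimes> t) \<otimes> (a \<oplus> b) [^] (m + n) \<in> I"
      using Tc[OF s(1)] Tc[OF t(1)] ab s t by (intro add_pow_mem_ideal[OF I]) (simp_all add: I.I_l_closed)
    then show "a \<oplus>\<^bsub>regular_module R\<^esub> b \<in> rad T" using st ab unfolding rad_def by auto
  next
    fix c a assume c: "c \<in> carrier R" and "a \<in> rad T"
    then obtain s m where s: "s \<in> T" "s \<otimes> a [^] (m::nat) \<in> I" and a: "a \<in> carrier R" by (auto simp: rad_def)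
    have sc: "s \<in> carrier R" using s T by (auto simp: mult_def)
    have "s \<otimes> (c \<otimes> a) [^] m = c [^] m \<otimes> (s \<otimes> a [^] m)" using a c sc by (simp add: nat_pow_distrib m_ac)
    then have "s \<otimes> (c \<otimes> a) [^] m \<in> I" using s c by (simp add: I.I_l_closed)
    then show "c \<odot>\<^bsub>regular_module R\<^esub> a \<in> rad T" using s a c unfolding rad_def by auto
  qed
  have mult0: "mult (carrier R - N)" using N.compl_mult IN by (auto simp: mult_def)
  have "\<exists>P. (\<exists>T. mult T \<and> P = rad T) \<and> (\<forall>P'. (\<exists>T. mult T \<and> P' = rad T) \<longrightarrow> P \<subseteq> P' \<longrightarrow> P' = P)"
  proof (rule reg.noetherian_sub_maximal[where P = "\<lambda>P. \<exists>T. mult T \<and> P = rad T"])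
    show "reg.noetherian_sub (carrier R)" by (rule noetherian_sub_carrier[OF is_cring])
    show "\<exists>T. mult T \<and> rad (carrier R - N) = rad T" using mult0 by blast
    show "submodule Z R (regular_module R) \<and> Z \<subseteq> carrier R" if "\<exists>T. mult T \<and> Z = rad T" for Z
      using that rad by (auto simp: submodule_regular_iff_ideal rad_def)
  qed
  then obtain P T where T: "mult T" and PT: "P = rad T"
    and maxP: "\<And>P'. \<exists>T. mult T \<and> P' = rad T \<Longrightarrow> P \<subseteq> P' \<Longrightarrow> P' = P" by blast
  have Tc: "t \<in> carrier R" if "t \<in> T" for t using that T by (auto simp: mult_def)
  have T1: "\<one> \<in> T" using T N.one_compl by (auto simp: mult_def)
  have TP: "t \<notin> P" if t: "t \<in> T" for t
  proof
    assume "t \<in> P"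
    then obtain s n where s: "s \<in> T" "s \<otimes> t [^] (n::nat) \<in> I" by (auto simp: PT rad_def)
    have "s \<otimes> t [^] k \<in> T" for k :: nat
    proof (induction k)
      case (Suc k)
      have "s \<otimes> t [^] Suc k = (s \<otimes> t [^] k) \<otimes> t" using Tc s t by (simp add: m_ac)
      then show ?case using Suc t T unfolding mult_def by metis
    qed (use s Tc in simp)
    then show False using s(2) T by (auto simp: mult_def)
  qed
  have prime: "primeideal P R"
  proof (rule primeidealI)
    show "ideal P R" using rad[OF T] PT by simp
    show "cring R" by (rule is_cring)
    show "carrier R \<noteq> P" using TP[OF T1] by auto
    fix y z assume y: "y \<in> carrier R" and z: "z \<in> carrier R" and yz: "y \<otimes> z \<in> P"
    show "y \<in> P \<or> z \<in> P"
    proof (rule disjCI)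
      assume zP: "z \<notin> P"
      define T' where "T' = {t \<otimes> z [^] n | t n. t \<in> T \<and> n \<in> (UNIV :: nat set)}"
      have TT': "T \<subseteq> T'"
      proof
        fix t assume "t \<in> T"
        moreover from this have "t = t \<otimes> z [^] (0::nat)" using Tc by simp
        ultimately show "t \<in> T'" unfolding T'_def by blast
      qed
      have "mult T'"
        unfolding mult_def
      proof (intro conjI ballI)
        show "carrier R - N \<subseteq> T'" using TT' T by (auto simp: mult_def)
        show "T' \<subseteq> carrier R" using Tc z by (auto simp: T'_def)
        show "T' \<inter> I = {}" using zP z by (auto simp: T'_def PT rad_def)
        fix a b assume "a \<in> T'" "b \<in> T'"
        then obtain s t m n where st: "s \<in> T" "t \<in> T" "a = s \<otimes> z [^] (m::nat)" "b = t \<otimes> z [^] (n::nat)"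
          by (auto simp: T'_def)
        then have "a \<otimes> b = (s \<otimes> t) \<otimes> z [^] (m + n)"
          using Tc z by (simp add: nat_pow_mult[symmetric] m_ac)
        moreover have "s \<otimes> t \<in> T" using st T by (auto simp: mult_def)
        ultimately show "a \<otimes> b \<in> T'" unfolding T'_def by blast
      qed
      moreover have "P \<subseteq> rad T'" using TT' by (auto simp: PT rad_def)
      ultimately have PT': "rad T' = P" using maxP[of "rad T'"] by blast
      obtain t n where t: "t \<in> T" "t \<otimes> (y \<otimes> z) [^] (n::nat) \<in> I" using yz by (auto simp: PT rad_def)
      have "t \<otimes> (y \<otimes> z) [^] n = (t \<otimes> z [^] n) \<otimes> y [^] n"
        using Tc[OF t(1)] y z by (simp add: nat_pow_distrib m_ac)
      then have "(t \<otimes> z [^] n) \<otimes> y [^] n \<in> I" using t by simp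
      moreover have "t \<otimes> z [^] n \<in> T'" using t by (auto simp: T'_def)
      ultimately have "y \<in> rad T'" using y by (auto simp: rad_def)
      then show "y \<in> P" using PT' by simp
    qed
  qed
  show thesis
  proof (rule that[OF prime])
    show "I \<subseteq> P"
    proof
      fix a assume a: "a \<in> I"
      then have "\<one> \<otimes> a [^] (1::nat) \<in> I" using I.Icarr by simp
      then show "a \<in> P" using T1 a I.Icarr unfolding PT rad_def by blast
    qed
    show "P \<subseteq> N" using TP T by (auto simp: mult_def PT rad_def)
    fix y assume "y \<in> P"
    then show "\<exists>s \<in> carrier R - P. \<exists>n::nat. s \<otimes> y [^] n \<in> I"
      using TP Tc by (auto simp: PT rad_def)
  qed
qed

text \<open>Krull's argument. Suppose \<open>N\<close> is minimal over \<open>P0 + xR\<close>. Then \<open>R/(P0 + xR)\<close> is Artinian locally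
  at \<open>N\<close>, so two consecutive symbolic powers \<open>q r\<close> and \<open>q (Suc r)\<close> of \<open>Q\<close> agree modulo
  \<open>x\<close>. Nakayama's lemma at \<open>N\<close> makes them equal, and Nakayama's lemma at \<open>Q\<close> then gives
  \<open>q r \<subseteq> P0\<close>, so that \<open>Q \<subseteq> P0\<close>.\<close>

lemma principal_ideal_theorem_aux:
  assumes P0: "primeideal P0 R" and Q: "primeideal Q R" and N: "primeideal N R"
    and sub: "P0 \<subset> Q" "Q \<subset> N" and x: "x \<in> N"
    and nil: "\<And>y. y \<in> N \<Longrightarrow> \<exists>s \<in> carrier R - N. \<exists>n::nat. \<exists>c \<in> carrier R. \<exists>z \<in> P0. s \<otimes> y [^] n = c \<otimes> x \<oplus> z"
  shows False
proof -
  interpret P0: primeideal P0 R by (rule P0)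
  interpret Q: primeideal Q R by (rule Q)
  interpret N: primeideal N R by (rule N)
  interpret reg: module R "regular_module R" by (rule module_regular_module)
  have xc: "x \<in> carrier R" using x N.Icarr by blast
  have xQ: "x \<notin> Q"
  proof
    assume xQ: "x \<in> Q"
    obtain y where y: "y \<in> N" and yQ: "y \<notin> Q" using sub by blast
    then obtain s n c z where s: "s \<in> carrier R - N" and cz: "c \<in> carrier R" "z \<in> P0"
      and eq: "s \<otimes> y [^] (n::nat) = c \<otimes> x \<oplus> z" using nil[OF y] by blast
    have "s \<otimes> y [^] n \<in> Q" using eq cz xQ sub(1) Q.I_l_closed[OF xQ cz(1)] by auto
    moreover have "s \<otimes> y [^] n \<notin> Q"
    proof (induction n)
      case 0
      then show ?case using s sub by auto
    next
      case (Suc k)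
      have "s \<otimes> y [^] Suc k = (s \<otimes> y [^] k) \<otimes> y" using s y N.Icarr by (simp add: m_ac)
      then show ?case using Suc y yQ s N.Icarr Q.I_prime[of "s \<otimes> y [^] k" y] by auto
    qed
    ultimately show False by simp
  qed
  have Pz: "submodule P0 R (regular_module R)" by (rule ideal_submodule_regular) (rule P0.is_ideal)
  define prd where "prd W = {u \<otimes> v | u v. u \<in> Q \<and> v \<in> W}" for W
  define nxt where "nxt W = reg.sat Q (submodule_span R (regular_module R) (prd W \<union> P0))" for W
  \<comment> \<open>The symbolic powers of \<open>Q\<close> modulo \<open>P0\<close>.\<close>
  define q where "q n = (nxt ^^ n) (carrier R)" for n
  have q0: "q 0 = carrier R" and qS: "q (Suc n) = nxt (q n)" for n by (simp_all add: q_def)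
  have prdc: "prd W \<subseteq> carrier R" if "W \<subseteq> carrier R" for W
    using that Q.Icarr by (auto simp: prd_def)
  have spn: "submodule (submodule_span R (regular_module R) (prd W \<union> P0)) R (regular_module R)" if "W \<subseteq> carrier R" for W
    using prdc[OF that] P0.a_subset by (intro reg.span_submodule) auto
  have qsub: "submodule (q n) R (regular_module R)" for n
  proof (induction n)
    case 0
    then show ?case using reg.carrier_is_submodule by (simp add: q0)
  next
    case (Suc n)
    then show ?case unfolding qS nxt_def
      using reg.submodule_subset[OF Suc] by (intro reg.sat_submodule[OF Q] spn) simp
  qed
  have qc: "q n \<subseteq> carrier R" for n using reg.submodule_subset[OF qsub, of n] by simp
  have sat_q: "a \<in> q n" if "t \<in> carrier R" "t \<notin> Q" "a \<in> carrier R" "t \<otimes> a \<in> q n" for t a n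
    using that by (cases n) (auto simp: q0 qS nxt_def intro: reg.sat_cancel[OF Q, of t a])
  have q_dec: "q (Suc n) \<subseteq> q n" for n
  proof (induction n)
    case 0
    then show ?case using qc by (simp add: q0)
  next
    case (Suc n)
    then have "prd (q (Suc n)) \<union> P0 \<subseteq> prd (q n) \<union> P0" by (auto simp: prd_def)
    from reg.sat_mono[OF reg.span_mono[OF this], of Q] show ?case
      by (simp add: qS nxt_def)
  qed
  have P0q: "P0 \<subseteq> q n" for n
  proof (cases n)
    case 0
    then show ?thesis using P0.a_subset by (simp add: q0)
  next
    case (Suc m)
    have "P0 \<subseteq> submodule_span R (regular_module R) (prd (q m) \<union> P0)"
      using reg.span_superset[of "prd (q m) \<union> P0"] by blast
    also have "\<dots> \<subseteq> q n" unfolding Suc qS nxt_def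
      using reg.sat_superset[OF Q reg.submodule_subset[OF spn[OF qc]]] .
    finally show ?thesis .
  qed
  have noeth: "reg.noetherian_sub (carrier R)" by (rule noetherian_sub_carrier[OF is_cring])
  have noeth': "reg.noetherian_sub W" if "submodule W R (regular_module R)" for W
    using reg.noetherian_sub_mono[OF noeth that] reg.submodule_subset[OF that] by simp
  define L where "L n = submodule_span R (regular_module R) (insert x (q n))" for n
  have Lel: "L n = {c \<otimes> x \<oplus> z | c z. c \<in> carrier R \<and> z \<in> q n}" for n
    unfolding L_def using reg.span_insert_submodule[OF _ qsub, of x n] xc by simp
  have Lsub: "submodule (L n) R (regular_module R)" for n
    unfolding L_def using xc qc by (intro reg.span_submodule) auto
  have "\<exists>r. L r \<subseteq> reg.sat N (L (Suc r))"
  proof (rule reg.descending_chain_sat[OF noetherian_ring_axioms noeth'[OF Lsub] Lsub _ N])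
    show "L (Suc r) \<subseteq> L r" for r unfolding Lel using q_dec by blast
    fix y assume y: "y \<in> N"
    then obtain s n c z where s: "s \<in> carrier R - N" and cz: "c \<in> carrier R" "z \<in> P0"
      and eq: "s \<otimes> y [^] (n::nat) = c \<otimes> x \<oplus> z" using nil[OF y] by blast
    have "s \<otimes> y [^] n \<in> L r" for r unfolding Lel eq using cz P0q by blast
    then have "a \<otimes> (s \<otimes> y [^] n) \<in> L r" if "a \<in> carrier R" for a r
      using reg.submodule_smult[OF Lsub that] by simp
    moreover have "a \<in> carrier R" if "a \<in> L 0" for a using that reg.submodule_subset[OF Lsub] by auto
    moreover have "s \<otimes> y [^] n \<in> carrier R" using s y N.Icarr by auto
    ultimately have "\<forall>r. \<forall>a \<in> L 0. (s \<otimes> y [^] n) \<odot>\<^bsub>regular_module R\<^esub> a \<in> L r"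
      using m_comm by auto
    then show "\<exists>s \<in> carrier R - N. \<exists>n::nat. \<forall>r. \<forall>a \<in> L 0. (s \<otimes> y [^] n) \<odot>\<^bsub>regular_module R\<^esub> a \<in> L r"
      using s by blast
  qed
  then obtain r where r: "L r \<subseteq> reg.sat N (L (Suc r))" ..
  \<comment> \<open>Since \<open>x \<notin> Q\<close>, the multiple of \<open>x\<close> that occurs has its coefficient in \<open>q r\<close>.\<close>
  have "q r \<subseteq> reg.sat N (q (Suc r))"
  proof (rule reg.nakayama_sat[OF noeth'[OF qsub] qsub N])
    fix a assume a: "a \<in> q r"
    then have ac: "a \<in> carrier R" using qc by blast
    then have "a = \<zero> \<otimes> x \<oplus> a" using xc by simp
    then have "a \<in> L r" unfolding Lel using a by blast
    then obtain s where s: "s \<in> carrier R - N" "s \<otimes> a \<in> L (Suc r)" using r by (auto simp: reg.sat_def)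
    then obtain c z where c: "c \<in> carrier R" and z: "z \<in> q (Suc r)" and eq: "s \<otimes> a = c \<otimes> x \<oplus> z"
      unfolding Lel by blast
    have zc: "z \<in> carrier R" using z qc by blast
    have "c \<otimes> x \<oplus> z \<in> q r" using reg.submodule_smult[OF qsub, of s a r] a s eq by simp
    then have "c \<otimes> x \<in> q r"
      using reg.submodule_add_cancel[OF qsub, of "c \<otimes> x" z r] z q_dec c xc by auto
    then have "c \<in> q r" using sat_q[of x c r] c xc xQ m_comm by simp
    then have "x \<otimes> c \<in> submodule_span R (regular_module R)
        {p \<odot>\<^bsub>regular_module R\<^esub> b | p b. p \<in> N \<and> b \<in> q r}"
      using x reg.span_superset by fastforce
    moreover have "s \<odot>\<^bsub>regular_module R\<^esub> a = z \<oplus>\<^bsub>regular_module R\<^esub> x \<otimes> c"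
      using eq c xc zc m_comm a_comm by simp
    ultimately show "\<exists>s \<in> carrier R - N. \<exists>y \<in> q (Suc r).
      \<exists>z \<in> submodule_span R (regular_module R) {p \<odot>\<^bsub>regular_module R\<^esub> b | p b. p \<in> N \<and> b \<in> q r}.
        s \<odot>\<^bsub>regular_module R\<^esub> a = y \<oplus>\<^bsub>regular_module R\<^esub> z"
      using s(1) z by blast
  qed
  have qr: "q r \<subseteq> q (Suc r)"
  proof
    fix a assume "a \<in> q r"
    then have "a \<in> reg.sat N (q (Suc r))" using \<open>q r \<subseteq> reg.sat N (q (Suc r))\<close> by blast
    then obtain s where "s \<in> carrier R" "s \<notin> N" "a \<in> carrier R" "s \<otimes> a \<in> q (Suc r)"
      by (auto simp: reg.sat_def)
    then show "a \<in> q (Suc r)" using sat_q[of s a "Suc r"] sub(2) by blast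
  qed
  have "q r \<subseteq> reg.sat Q P0"
  proof (rule reg.nakayama_sat[OF noeth'[OF qsub] Pz Q])
    fix a assume a: "a \<in> q r"
    then have "a \<in> nxt (q r)" using qr qS by auto
    then obtain s where s: "s \<in> carrier R - Q"
      "s \<otimes> a \<in> submodule_span R (regular_module R) (prd (q r) \<union> P0)"
      by (auto simp: nxt_def reg.sat_def)
    let ?D = "submodule_span R (regular_module R) (prd (q r))"
    have D: "submodule ?D R (regular_module R)" using prdc[OF qc] by (intro reg.span_submodule) simp
    have "ideal (P0 <+> ?D) R"
      using D P0.is_ideal by (intro add_ideals) (simp_all add: submodule_regular_iff_ideal)
    then have "submodule (P0 <+> ?D) R (regular_module R)" by (rule ideal_submodule_regular)
    moreover have "prd (q r) \<union> P0 \<subseteq> P0 <+> ?D"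
    proof
      fix b assume "b \<in> prd (q r) \<union> P0"
      then show "b \<in> P0 <+> ?D"
      proof
        assume b: "b \<in> prd (q r)"
        then have "b \<in> carrier R" using prdc[OF qc] by blast
        then have "b = \<zero> \<oplus> b" "b \<in> ?D" using b reg.span_superset[of "prd (q r)"] by auto
        then show ?thesis using P0.zero_closed unfolding set_add_def set_mult_def by auto
      next
        assume b: "b \<in> P0"
        then have "b = b \<oplus> \<zero>" "\<zero> \<in> ?D" using P0.Icarr reg.submodule_zero[OF D] by auto
        then show ?thesis using b unfolding set_add_def set_mult_def by fastforce
      qed
    qed
    ultimately have "s \<otimes> a \<in> P0 <+> ?D" using reg.span_least s(2) by blast
    then obtain y z where "y \<in> P0" "z \<in> ?D" "s \<otimes> a = y \<oplus> z"
      unfolding set_add_def set_mult_def by auto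
    then show "\<exists>s \<in> carrier R - Q. \<exists>y \<in> P0.
      \<exists>z \<in> submodule_span R (regular_module R) {p \<odot>\<^bsub>regular_module R\<^esub> b | p b. p \<in> Q \<and> b \<in> q r}.
        s \<odot>\<^bsub>regular_module R\<^esub> a = y \<oplus>\<^bsub>regular_module R\<^esub> z"
      using s(1) unfolding prd_def by auto
  qed
  have qP: "q r \<subseteq> P0"
  proof
    fix a assume "a \<in> q r"
    then have "a \<in> reg.sat Q P0" using \<open>q r \<subseteq> reg.sat Q P0\<close> by blast
    then obtain s where "s \<in> carrier R" "s \<notin> Q" "a \<in> carrier R" "s \<otimes> a \<in> P0"
      by (auto simp: reg.sat_def)
    then show "a \<in> P0" using P0.I_prime[of s a] sub(1) by blast
  qed
  obtain u where u: "u \<in> Q" "u \<notin> P0" using sub(1) by blast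
  have uc: "u \<in> carrier R" using u Q.Icarr by blast
  have "u [^] n \<in> q n" for n :: nat
  proof (induction n)
    case (Suc n)
    have "u [^] Suc n = u \<otimes> u [^] n" using uc by (simp add: m_comm)
    then have "u [^] Suc n \<in> prd (q n)" using Suc u by (auto simp: prd_def)
    then have "u [^] Suc n \<in> submodule_span R (regular_module R) (prd (q n) \<union> P0)"
      using reg.span_superset[of "prd (q n) \<union> P0"] by blast
    then show ?case unfolding qS nxt_def
      using reg.sat_superset[OF Q reg.submodule_subset[OF spn[OF qc]]] by blast
  qed (simp add: q0)
  then have "u [^] r \<in> P0" using qP by blast
  moreover have "u [^] n \<notin> P0" for n :: nat
  proof (induction n)
    case 0
    then show ?case using P0.one_compl by simp
  next
    case (Suc n)
    then show ?case using P0.I_prime[of "u [^] n" u] u uc by auto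
  qed
  ultimately show False by blast
qed

text \<open>Take for \<open>P\<close> a minimal prime of \<open>P0 + xR\<close> inside \<open>N\<close>; by the previous lemma it is not \<open>N\<close> itself.\<close>

lemma principal_ideal_theorem:
  assumes P0: "primeideal P0 R" and Q: "primeideal Q R" and N: "primeideal N R"
    and sub: "P0 \<subset> Q" "Q \<subset> N" and x: "x \<in> N"
  obtains P where "primeideal P R" "P0 \<subset> P" "P \<subset> N" "x \<in> P"
proof (cases "x \<in> P0")
  case True
  then show ?thesis using that[OF Q sub] sub(1) by blast
next
  case False
  interpret P0: primeideal P0 R by (rule P0)
  interpret N: primeideal N R by (rule N)
  interpret reg: module R "regular_module R" by (rule module_regular_module)
  have xc: "x \<in> carrier R" using x N.Icarr by blast
  have Ps: "submodule P0 R (regular_module R)" by (rule ideal_submodule_regular) (rule P0.is_ideal)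
  have Ns: "submodule N R (regular_module R)" by (rule ideal_submodule_regular) (rule N.is_ideal)
  let ?I = "submodule_span R (regular_module R) (insert x P0)"
  have I: "ideal ?I R"
    using xc P0.a_subset reg.span_submodule[of "insert x P0"] by (simp add: submodule_regular_iff_ideal)
  have IN: "?I \<subseteq> N" using x sub by (intro reg.span_least[OF _ Ns]) auto
  have Iel: "?I = {c \<otimes> x \<oplus> z | c z. c \<in> carrier R \<and> z \<in> P0}"
    using reg.span_insert_submodule[OF _ Ps, of x] xc by simp
  obtain P where P: "primeideal P R" "?I \<subseteq> P" "P \<subseteq> N"
    and nil: "\<And>y. y \<in> P \<Longrightarrow> \<exists>s \<in> carrier R - P. \<exists>n::nat. s \<otimes> y [^] n \<in> ?I"
    using minimal_prime_exists[OF I N IN] by blast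
  have "insert x P0 \<subseteq> P" using P(2) reg.span_superset[of "insert x P0"] by blast
  then have 1: "x \<in> P" "P0 \<subset> P" using False by auto
  have "P \<noteq> N"
  proof
    assume "P = N"
    then have "\<exists>s \<in> carrier R - N. \<exists>n::nat. \<exists>c \<in> carrier R. \<exists>z \<in> P0. s \<otimes> y [^] n = c \<otimes> x \<oplus> z" if "y \<in> N" for y
      using nil[of y] that unfolding Iel by blast
    then show False by (rule principal_ideal_theorem_aux[OF P0 Q N sub x])
  qed
  then show thesis using that[OF P(1) 1(2) _ 1(1)] P(3) by blast
qed

end

section \<open>Regular local rings\<close>

text \<open>The recursion starts at the lowest prime, because that end of a chain is the one to be modified.\<close>

primrec prime_chain :: "('a, 'r) ring_scheme \<Rightarrow> nat \<Rightarrow> 'a set \<Rightarrow> 'a set \<Rightarrow> bool" where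
  "prime_chain R 0 P N \<longleftrightarrow> primeideal P R \<and> P = N"
| "prime_chain R (Suc n) P N \<longleftrightarrow> primeideal P R \<and> (\<exists>Q. P \<subset> Q \<and> prime_chain R n Q N)"

lemma prime_chain_prime: "prime_chain R n P N \<Longrightarrow> primeideal P R"
  by (cases n) auto

lemma prime_chain_subset: "prime_chain R n P N \<Longrightarrow> P \<subseteq> N"
  by (induction n arbitrary: P) (auto dest: psubset_imp_subset)

lemma prime_chain_extend:
  assumes "\<forall>i\<le>n. primeideal (P i) R" "\<forall>i<n. P i \<subset> P (Suc i)"
  shows "prime_chain R n (P 0) (P n)"
  using assms
proof (induction n arbitrary: P)
  case (Suc n)
  have "\<forall>i\<le>n. primeideal (P (Suc i)) R" "\<forall>i<n. P (Suc i) \<subset> P (Suc (Suc i))"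
    using Suc.prems by simp_all
  then have "prime_chain R n (P (Suc 0)) (P (Suc n))" by (rule Suc.IH)
  moreover have "P 0 \<subset> P (Suc 0)" "primeideal (P 0) R" using Suc.prems by simp_all
  ultimately show ?case unfolding prime_chain.simps by blast
qed auto

context noetherian_cring
begin

text \<open>Move \<open>x\<close> down the chain, one prime at a time, with the principal ideal theorem.\<close>

lemma prime_chain_through:
  assumes "prime_chain R (Suc n) P N" "x \<in> N"
  shows "\<exists>Q. P \<subset> Q \<and> x \<in> Q \<and> prime_chain R n Q N"
  using assms
proof (induction n arbitrary: P)
  case 0
  then show ?case by auto
next
  case (Suc n)
  then obtain P1 where P: "primeideal P R" "P \<subset> P1" and P1: "prime_chain R (Suc n) P1 N" by auto
  obtain P2 where P2: "P1 \<subset> P2" "x \<in> P2" "prime_chain R n P2 N" using Suc.IH[OF P1 Suc.prems(2)] by blast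
  obtain Q where "primeideal Q R" "P \<subset> Q" "Q \<subset> P2" "x \<in> Q"
    using principal_ideal_theorem[OF P(1) prime_chain_prime[OF P1] prime_chain_prime[OF P2(3)] P(2) P2(1,2)] .
  then show ?case using P2(3) by auto
qed

end

text \<open>This is weak regularity of \<open>xs\<close> on \<open>R / J\<close>: the quotient by all of \<open>xs\<close> may vanish.\<close>

primrec regular_mod :: "('a, 'r) ring_scheme \<Rightarrow> 'a set \<Rightarrow> 'a list \<Rightarrow> bool" where
  "regular_mod R J [] \<longleftrightarrow> True"
| "regular_mod R J (x # xs) \<longleftrightarrow> (\<forall>a \<in> carrier R. x \<otimes>\<^bsub>R\<^esub> a \<in> J \<longrightarrow> a \<in> J) \<and>
     regular_mod R (genideal R (insert x J)) xs"

context cring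
begin

lemma genideal_insert:
  assumes "ideal J R" "x \<in> carrier R"
  shows "Idl (insert x J) = {c \<otimes> x \<oplus> z | c z. c \<in> carrier R \<and> z \<in> J}"
proof -
  interpret reg: module R "regular_module R" by (rule module_regular_module)
  show ?thesis
    using reg.span_insert_submodule[OF _ ideal_submodule_regular[OF assms(1)], of x] assms(2)
    by (simp add: span_regular_eq_genideal)
qed

lemma genideal_insert_ideal:
  assumes "ideal J R" "x \<in> carrier R"
  shows "ideal (Idl (insert x J)) R"
  using assms ideal.Icarr[OF assms(1)] by (intro genideal_ideal) auto

lemma genideal_insert_superset:
  assumes "ideal J R" "x \<in> carrier R"
  shows "x \<in> Idl (insert x J)" "J \<subseteq> Idl (insert x J)"
proof -
  have "insert x J \<subseteq> Idl (insert x J)"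
    using assms ideal.Icarr[OF assms(1)] by (intro genideal_self) auto
  then show "x \<in> Idl (insert x J)" "J \<subseteq> Idl (insert x J)" by auto
qed

lemma genideal_idem:
  assumes "ideal J R" shows "Idl J = J"
  using genideal_minimal[OF assms] genideal_self[of J] ideal.Icarr[OF assms] by blast

lemma genideal_mono_gen:
  assumes "S \<subseteq> T" "T \<subseteq> carrier R" shows "Idl S \<subseteq> Idl T"
  using genideal_minimal[OF genideal_ideal[OF assms(2)]] genideal_self[OF assms(2)] assms(1) by blast

lemma genideal_Un_genideal:
  assumes "S \<subseteq> carrier R" "T \<subseteq> carrier R" shows "Idl (Idl S \<union> T) = Idl (S \<union> T)"
proof
  have ST: "S \<union> T \<subseteq> carrier R" using assms by auto
  have IS: "Idl S \<subseteq> carrier R" using ideal.Icarr[OF genideal_ideal[OF assms(1)]] by blast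
  show "Idl (Idl S \<union> T) \<subseteq> Idl (S \<union> T)"
  proof (rule genideal_minimal[OF genideal_ideal[OF ST]])
    show "Idl S \<union> T \<subseteq> Idl (S \<union> T)"
      using genideal_mono_gen[OF Un_upper1 ST] genideal_self[OF ST] by simp
  qed
  show "Idl (S \<union> T) \<subseteq> Idl (Idl S \<union> T)"
  proof (rule genideal_mono_gen)
    show "S \<union> T \<subseteq> Idl S \<union> T" using genideal_self[OF assms(1)] by (rule Un_mono) simp
    show "Idl S \<union> T \<subseteq> carrier R" using IS assms(2) by simp
  qed
qed

text \<open>Put \<open>C = B + xR\<close>. In the exact sequence \<open>0 \<rightarrow> R/A \<rightarrow> R/B \<rightarrow> R/C \<rightarrow> 0\<close>, whose first map is
  multiplication by \<open>x\<close>, a sequence that is regular on the outer terms is regular on the middle one.\<close>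

lemma regular_mod_extension:
  assumes "ideal A R" "ideal B R" "x \<in> carrier R"
    and "A = {a \<in> carrier R. x \<otimes> a \<in> B}" and "set ys \<subseteq> carrier R"
    and "regular_mod R A ys" "regular_mod R (Idl (insert x B)) ys"
  shows "regular_mod R B ys"
  using assms
proof (induction ys arbitrary: A B)
  case (Cons y ys)
  let ?C = "Idl (insert x B)"
  interpret A: ideal A R by (rule Cons.prems(1))
  interpret B: ideal B R by (rule Cons.prems(2))
  note x = Cons.prems(3)
  have y: "y \<in> carrier R" using Cons.prems(5) by simp
  have C: "ideal ?C R" by (rule genideal_insert_ideal[OF B.is_ideal x])
  have Cel: "?C = {c \<otimes> x \<oplus> z | c z. c \<in> carrier R \<and> z \<in> B}" by (rule genideal_insert[OF B.is_ideal x])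
  have BC: "B \<subseteq> ?C" by (rule genideal_insert_superset[OF B.is_ideal x])
  have nA: "a \<in> A" if "a \<in> carrier R" "y \<otimes> a \<in> A" for a
    using Cons.prems(6) that unfolding regular_mod.simps by blast
  have nC: "a \<in> ?C" if "a \<in> carrier R" "y \<otimes> a \<in> ?C" for a
    using Cons.prems(7) that unfolding regular_mod.simps by blast
  have Adef: "a \<in> A \<longleftrightarrow> a \<in> carrier R \<and> x \<otimes> a \<in> B" for a using Cons.prems(4) by blast
  have nB: "a \<in> B" if a: "a \<in> carrier R" "y \<otimes> a \<in> B" for a
  proof -
    have "a \<in> ?C" using nC a BC by blast
    then obtain c z where c: "c \<in> carrier R" and z: "z \<in> B" and eq: "a = c \<otimes> x \<oplus> z" unfolding Cel by blast
    have zc: "z \<in> carrier R" using z by (rule B.Icarr)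
    have "x \<otimes> (y \<otimes> c) = y \<otimes> a \<ominus> y \<otimes> z"
      unfolding eq using x y c zc by algebra
    also have "\<dots> \<in> B" using a z y by (simp add: a_minus_def B.I_l_closed)
    finally have "c \<in> A" using nA[OF c] x y c by (simp add: Adef)
    then show ?thesis using z c x unfolding eq Adef by (simp add: m_comm)
  qed
  have "regular_mod R (Idl (insert y B)) ys"
  proof (rule Cons.IH)
    let ?A' = "Idl (insert y A)" and ?B' = "Idl (insert y B)"
    show A': "ideal ?A' R" by (rule genideal_insert_ideal[OF A.is_ideal y])
    show B': "ideal ?B' R" by (rule genideal_insert_ideal[OF B.is_ideal y])
    have A'el: "?A' = {c \<otimes> y \<oplus> z | c z. c \<in> carrier R \<and> z \<in> A}" by (rule genideal_insert[OF A.is_ideal y])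
    have B'el: "?B' = {c \<otimes> y \<oplus> z | c z. c \<in> carrier R \<and> z \<in> B}" by (rule genideal_insert[OF B.is_ideal y])
    show "?A' = {a \<in> carrier R. x \<otimes> a \<in> ?B'}"
    proof (intro equalityI subsetI)
      fix a assume "a \<in> ?A'"
      then obtain c z where c: "c \<in> carrier R" and z: "z \<in> A" and eq: "a = c \<otimes> y \<oplus> z" unfolding A'el by blast
      have zc: "z \<in> carrier R" using z by (rule A.Icarr)
      have "x \<otimes> a = (x \<otimes> c) \<otimes> y \<oplus> x \<otimes> z" unfolding eq using x y c zc by algebra
      then have "x \<otimes> a \<in> ?B'" unfolding B'el using x c z Adef by blast
      then show "a \<in> {a \<in> carrier R. x \<otimes> a \<in> ?B'}" using eq c y zc by simp
    next
      fix a assume "a \<in> {a \<in> carrier R. x \<otimes> a \<in> ?B'}"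
      then have a: "a \<in> carrier R" and "x \<otimes> a \<in> ?B'" by auto
      then obtain d z where d: "d \<in> carrier R" and z: "z \<in> B" and eq: "x \<otimes> a = d \<otimes> y \<oplus> z" unfolding B'el by blast
      have zc: "z \<in> carrier R" using z by (rule B.Icarr)
      have "y \<otimes> d = a \<otimes> x \<oplus> (\<ominus> z)"
      proof -
        have "a \<otimes> x = d \<otimes> y \<oplus> z" using eq a x by (simp add: m_comm)
        then show ?thesis using x y d a zc by algebra
      qed
      also have "\<dots> \<in> ?C" unfolding Cel using a z by auto
      finally have "d \<in> ?C" using nC d by simp
      then obtain d' b where d': "d' \<in> carrier R" and b: "b \<in> B" and deq: "d = d' \<otimes> x \<oplus> b" unfolding Cel by blast
      have bc: "b \<in> carrier R" using b by (rule B.Icarr)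
      have "x \<otimes> (a \<ominus> y \<otimes> d') = y \<otimes> b \<oplus> z"
      proof -
        have "x \<otimes> (a \<ominus> y \<otimes> d') = x \<otimes> a \<ominus> (x \<otimes> y \<otimes> d')" using x a y d' by algebra
        also have "\<dots> = y \<otimes> b \<oplus> z" unfolding eq deq using x y d' bc zc by algebra
        finally show ?thesis .
      qed
      also have "\<dots> \<in> B" using b z y by (simp add: B.I_l_closed)
      finally have "a \<ominus> y \<otimes> d' \<in> A" using a y d' by (simp add: Adef)
      moreover have "a = d' \<otimes> y \<oplus> (a \<ominus> y \<otimes> d')" using a y d' by algebra
      ultimately show "a \<in> ?A'" unfolding A'el using d' by blast
    qed
    show "regular_mod R ?A' ys" using Cons.prems(6) unfolding regular_mod.simps by blast
    have "Idl (insert y ?C) = Idl (insert x ?B')"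
    proof -
      have c: "insert x B \<subseteq> carrier R" "insert y B \<subseteq> carrier R" "{x} \<subseteq> carrier R" "{y} \<subseteq> carrier R"
        using x y B.Icarr by auto
      have "Idl (?C \<union> {y}) = Idl (insert x B \<union> {y})" by (rule genideal_Un_genideal[OF c(1,4)])
      also have "\<dots> = Idl (insert y B \<union> {x})" by (rule arg_cong[of _ _ "genideal R"]) auto
      also have "\<dots> = Idl (?B' \<union> {x})" by (rule genideal_Un_genideal[OF c(2,3), symmetric])
      finally show ?thesis by simp
    qed
    then show "regular_mod R (Idl (insert x ?B')) ys"
      using Cons.prems(7) unfolding regular_mod.simps by metis
    show "x \<in> carrier R" by (rule x)
    show "set ys \<subseteq> carrier R" using Cons.prems(5) by simp
  qed
  then show ?case unfolding regular_mod.simps using nB by blast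
qed simp

lemma nonzerodivisor_mod_pow:
  assumes "\<And>a. a \<in> carrier R \<Longrightarrow> x \<otimes> a \<in> J \<Longrightarrow> a \<in> J" "x \<in> carrier R" "a \<in> carrier R" "x [^] (n::nat) \<otimes> a \<in> J"
  shows "a \<in> J"
  using assms(4)
proof (induction n)
  case (Suc n)
  have "x [^] Suc n \<otimes> a = x \<otimes> (x [^] n \<otimes> a)" using assms(2,3) by (simp add: m_ac)
  then have "x [^] n \<otimes> a \<in> J" using Suc.prems assms(1)[of "x [^] n \<otimes> a"] assms(2,3) by auto
  then show ?case by (rule Suc.IH)
qed (use assms(3) in simp)

text \<open>By induction on \<open>n\<close>, from the exact sequence \<open>R/(J + x\<^sup>n) \<rightarrow> R/(J + x\<^sup>n\<^sup>+\<^sup>1) \<rightarrow> R/(J + x)\<close>,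
  whose first map is multiplication by \<open>x\<close>.\<close>

lemma regular_mod_head_pow:
  assumes J: "ideal J R" and x: "x \<in> carrier R" and ys: "set ys \<subseteq> carrier R"
    and nzd: "\<And>a. a \<in> carrier R \<Longrightarrow> x \<otimes> a \<in> J \<Longrightarrow> a \<in> J"
    and reg: "regular_mod R (Idl (insert x J)) ys"
  shows "regular_mod R (Idl (insert (x [^] Suc n) J)) ys"
proof (induction n)
  case 0
  have "x [^] Suc 0 = x" using x by simp
  then show ?case using reg by metis
next
  case (Suc n)
  interpret J: ideal J R by (rule J)
  have xn: "x [^] k \<in> carrier R" for k :: nat using x by simp
  let ?A = "Idl (insert (x [^] Suc n) J)" and ?B = "Idl (insert (x [^] Suc (Suc n)) J)"
  have B: "ideal ?B R" by (rule genideal_insert_ideal[OF J xn])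
  have A: "ideal ?A R" by (rule genideal_insert_ideal[OF J xn])
  have Ael: "?A = {c \<otimes> x [^] Suc n \<oplus> z | c z. c \<in> carrier R \<and> z \<in> J}" by (rule genideal_insert[OF J xn])
  have Bel: "?B = {c \<otimes> x [^] Suc (Suc n) \<oplus> z | c z. c \<in> carrier R \<and> z \<in> J}" by (rule genideal_insert[OF J xn])
  show ?case
  proof (rule regular_mod_extension[OF A B x _ ys Suc])
    show "?A = {a \<in> carrier R. x \<otimes> a \<in> ?B}"
    proof (intro equalityI subsetI)
      fix a assume "a \<in> ?A"
      then obtain c z where c: "c \<in> carrier R" and z: "z \<in> J" and eq: "a = c \<otimes> x [^] Suc n \<oplus> z" unfolding Ael by blast
      have zc: "z \<in> carrier R" using z by (rule J.Icarr)
      have "x \<otimes> a = c \<otimes> x [^] Suc (Suc n) \<oplus> x \<otimes> z"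
        unfolding eq using x c zc xn[of n] by (simp add: r_distr m_ac)
      then have "x \<otimes> a \<in> ?B" unfolding Bel using c x z J.I_l_closed by blast
      then show "a \<in> {a \<in> carrier R. x \<otimes> a \<in> ?B}" using eq c zc x by simp
    next
      fix a assume "a \<in> {a \<in> carrier R. x \<otimes> a \<in> ?B}"
      then have a: "a \<in> carrier R" and "x \<otimes> a \<in> ?B" by auto
      then obtain c z where c: "c \<in> carrier R" and z: "z \<in> J" and eq: "x \<otimes> a = c \<otimes> x [^] Suc (Suc n) \<oplus> z"
        unfolding Bel by blast
      let ?y = "x [^] Suc n"
      have zc: "z \<in> carrier R" using z by (rule J.Icarr)
      note yc = xn[of "Suc n"]
      have "x [^] Suc (Suc n) = x \<otimes> ?y" using x by (simp add: m_ac)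
      then have "x \<otimes> a = c \<otimes> (x \<otimes> ?y) \<oplus> z" using eq by simp
      then have "x \<otimes> (a \<ominus> c \<otimes> ?y) = z" using x a c zc yc by algebra
      then have "a \<ominus> c \<otimes> ?y \<in> J" using nzd[of "a \<ominus> c \<otimes> ?y"] a c yc z by simp
      moreover have "a = c \<otimes> ?y \<oplus> (a \<ominus> c \<otimes> ?y)" using a c yc by algebra
      ultimately show "a \<in> ?A" unfolding Ael using c by blast
    qed
    have "Idl (insert x ?B) = Idl (insert x J)"
    proof -
      have c: "insert (x [^] Suc (Suc n)) J \<subseteq> carrier R" "{x} \<subseteq> carrier R" using x J.Icarr by auto
      have I: "ideal (Idl (insert x J)) R" by (rule genideal_insert_ideal[OF J x])
      have "x \<in> Idl (insert x J)" "J \<subseteq> Idl (insert x J)" by (rule genideal_insert_superset[OF J x])+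
      moreover from this have "x [^] Suc n \<otimes> x \<in> Idl (insert x J)" using ideal.I_l_closed[OF I] x by simp
      ultimately have "Idl (insert (x [^] Suc (Suc n)) J \<union> {x}) \<subseteq> Idl (insert x J)"
        by (intro genideal_minimal[OF I]) auto
      moreover have "Idl (insert x J) \<subseteq> Idl (insert (x [^] Suc (Suc n)) J \<union> {x})"
        using c by (intro genideal_mono_gen) auto
      moreover have "Idl (?B \<union> {x}) = Idl (insert (x [^] Suc (Suc n)) J \<union> {x})"
        by (rule genideal_Un_genideal[OF c])
      ultimately show ?thesis by simp
    qed
    then show "regular_mod R (Idl (insert x ?B)) ys" using reg by simp
  qed
qed

lemma regular_mod_pow:
  assumes "ideal J R" "set xs \<subseteq> carrier R" "regular_mod R J xs" "q \<noteq> 0"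
  shows "regular_mod R J (map (\<lambda>x. x [^] (q::nat)) xs)"
  using assms
proof (induction xs arbitrary: J)
  case (Cons x xs)
  obtain n where n: "q = Suc n" using Cons.prems(4) not0_implies_Suc by blast
  have x: "x \<in> carrier R" using Cons.prems by simp
  have xs: "set xs \<subseteq> carrier R" using Cons.prems(2) by simp
  have nzd: "a \<in> J" if "a \<in> carrier R" "x \<otimes> a \<in> J" for a
    using Cons.prems(3) that unfolding regular_mod.simps by blast
  have "regular_mod R (Idl (insert x J)) xs"
    using Cons.prems(3) unfolding regular_mod.simps by blast
  then have "regular_mod R (Idl (insert (x [^] q) J)) xs"
    unfolding n using regular_mod_head_pow[OF Cons.prems(1) x xs] nzd by blast
  then have "regular_mod R (Idl (insert (x [^] q) J)) (map (\<lambda>x. x [^] q) xs)"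
    using Cons.IH[OF genideal_insert_ideal[OF Cons.prems(1)] xs _ Cons.prems(4), of "x [^] q"] x by blast
  moreover have "a \<in> J" if "a \<in> carrier R" "x [^] q \<otimes> a \<in> J" for a
    using nonzerodivisor_mod_pow[of x J a q] nzd x that by blast
  ultimately show ?case unfolding list.map regular_mod.simps by blast
qed simp

end

locale noetherian_local_ring = noetherian_cring +
  fixes m assumes maximal: "maximalideal m R"
    and units: "\<And>s. s \<in> carrier R \<Longrightarrow> s \<notin> m \<Longrightarrow> s \<in> Units R"

lemma (in noetherian_cring) maximalideal_exists:
  assumes I: "ideal I R" "I \<noteq> carrier R"
  obtains N where "maximalideal N R" "I \<subseteq> N"
proof -
  interpret reg: module R "regular_module R" by (rule module_regular_module)
  define good where "good Z \<longleftrightarrow> ideal Z R \<and> I \<subseteq> Z \<and> Z \<noteq> carrier R" for Z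
  have "\<exists>Z. good Z \<and> (\<forall>Z'. good Z' \<longrightarrow> Z \<subseteq> Z' \<longrightarrow> Z' = Z)"
  proof (rule reg.noetherian_sub_maximal)
    show "reg.noetherian_sub (carrier R)" by (rule noetherian_sub_carrier[OF is_cring])
    show "good I" using I by (simp add: good_def)
    show "submodule Y R (regular_module R) \<and> Y \<subseteq> carrier R" if "good Y" for Y
      using that ideal.Icarr[of Y R] by (auto simp: good_def submodule_regular_iff_ideal)
  qed
  then obtain N where "good N" and max: "\<And>Z'. good Z' \<Longrightarrow> N \<subseteq> Z' \<Longrightarrow> Z' = N" by blast
  then have N: "ideal N R" "I \<subseteq> N" "N \<noteq> carrier R" by (auto simp: good_def)
  have "maximalideal N R"
  proof (rule maximalidealI)
    show "ideal N R" "carrier R \<noteq> N" using N by auto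
    fix J assume "ideal J R" "N \<subseteq> J" "J \<subseteq> carrier R"
    then show "J = N \<or> J = carrier R" using max[of J] N(2) unfolding good_def by blast
  qed
  then show thesis using that N by blast
qed

lemma noetherian_local_ringI:
  fixes R (structure)
  assumes "local_ring R" "noetherian_ring R"
  obtains m where "noetherian_local_ring R m" "\<And>N. maximalideal N R \<Longrightarrow> N = m"
proof -
  obtain m where m: "maximalideal m R" and uniq: "\<And>N. maximalideal N R \<Longrightarrow> N = m"
    using assms(1) unfolding local_ring_def by blast
  interpret cring R using assms(1) by (simp add: local_ring_def)
  interpret noetherian_cring R
    using assms(2) is_cring by (simp add: noetherian_cring_def)
  have "s \<in> Units R" if s: "s \<in> carrier R" "s \<notin> m" for s
  proof (rule ccontr)
    assume nu: "s \<notin> Units R"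
    have "\<one> \<notin> PIdl s"
    proof
      assume "\<one> \<in> PIdl s"
      then obtain c where "c \<in> carrier R" "\<one> = c \<otimes> s" by (auto simp: cgenideal_def)
      then show False using nu s m_comm by (auto simp: Units_def)
    qed
    then have "PIdl s \<noteq> carrier R" by auto
    then obtain N where "maximalideal N R" "PIdl s \<subseteq> N"
      using maximalideal_exists[OF cgenideal_ideal[OF s(1)]] by blast
    then show False using uniq s cgenideal_self[OF s(1)] by blast
  qed
  then have "noetherian_local_ring R m"
    using m noetherian_cring_axioms
    by (simp add: noetherian_local_ring_def noetherian_local_ring_axioms_def)
  then show thesis using that uniq by blast
qed

context noetherian_local_ring
begin

lemma prime: "primeideal m R"
  by (rule maximalideal_prime[OF maximal])

lemma proper_ideal_subset:
  assumes "ideal I R" "I \<noteq> carrier R" shows "I \<subseteq> m"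
proof
  fix a assume a: "a \<in> I"
  interpret I: ideal I R by fact
  have ac: "a \<in> carrier R" using a by (rule I.Icarr)
  show "a \<in> m"
  proof (rule ccontr)
    assume "a \<notin> m"
    then have u: "a \<in> Units R" using units ac by blast
    then have "inv a \<otimes> a \<in> I" using a by (intro I.I_l_closed) auto
    then have "\<one> \<in> I" using u by simp
    then show False using assms(2) I.one_imp_carrier by blast
  qed
qed

text \<open>Outside \<open>m\<close> there are only units, so saturation at \<open>m\<close> has no effect.\<close>

lemma nakayama_ideal:
  assumes I: "ideal I R" and J: "ideal J R" and x: "x \<in> m"
    and eq: "\<And>a. a \<in> I \<Longrightarrow> \<exists>y\<in>J. \<exists>b\<in>I. a = y \<oplus> x \<otimes> b"
  shows "I \<subseteq> J"
proof -
  interpret reg: module R "regular_module R" by (rule module_regular_module)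
  interpret m: primeideal m R by (rule prime)
  have Ic: "a \<in> carrier R" if "a \<in> I" for a using ideal.Icarr[OF I that] .
  have noeth: "reg.noetherian_sub I"
    using reg.noetherian_sub_mono[OF noetherian_sub_carrier[OF is_cring]] I Ic
    by (simp add: ideal_submodule_regular subsetI)
  have "I \<subseteq> reg.sat m J"
  proof (rule reg.nakayama_sat[OF noeth ideal_submodule_regular[OF J] prime])
    fix a assume a: "a \<in> I"
    then obtain y b where y: "y \<in> J" and b: "b \<in> I" and ab: "a = y \<oplus> x \<otimes> b" using eq by blast
    have "x \<otimes> b \<in> submodule_span R (regular_module R)
        {p \<odot>\<^bsub>regular_module R\<^esub> b | p b. p \<in> m \<and> b \<in> I}"
      using x b reg.span_superset by fastforce
    moreover have "\<one> \<odot>\<^bsub>regular_module R\<^esub> a = y \<oplus>\<^bsub>regular_module R\<^esub> x \<otimes> b"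
      using ab Ic[OF a] by simp
    ultimately show "\<exists>s\<in>carrier R - m. \<exists>y\<in>J. \<exists>z\<in>submodule_span R (regular_module R)
        {p \<odot>\<^bsub>regular_module R\<^esub> b | p b. p \<in> m \<and> b \<in> I}.
        s \<odot>\<^bsub>regular_module R\<^esub> a = y \<oplus>\<^bsub>regular_module R\<^esub> z"
      using y m.one_compl by blast
  qed
  moreover have "a \<in> J" if aJ: "a \<in> reg.sat m J" for a
  proof -
    obtain s where s: "s \<in> carrier R" "s \<notin> m" and a: "a \<in> carrier R" and sa: "s \<otimes> a \<in> J"
      using aJ by (auto simp: reg.sat_def)
    have u: "s \<in> Units R" by (rule units[OF s])
    then have "inv s \<otimes> (s \<otimes> a) \<in> J" using ideal.I_l_closed[OF J sa] by simp
    moreover have "inv s \<otimes> (s \<otimes> a) = a" using u a s by (simp add: m_assoc[symmetric])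
    ultimately show ?thesis by simp
  qed
  ultimately show ?thesis by blast
qed

text \<open>By \<open>prime_chain_through\<close>, adding a generator to \<open>J\<close> shortens a chain of primes above \<open>J\<close> by at
  most one, and only the trivial chain lies above \<open>m\<close>.\<close>

lemma prime_chain_length_le:
  assumes "ideal J R" "set xs \<subseteq> carrier R" "Idl (J \<union> set xs) = m" "prime_chain R n P m" "J \<subseteq> P"
  shows "n \<le> length xs"
  using assms
proof (induction xs arbitrary: J n P)
  case Nil
  then have "J = m" using genideal_idem by simp
  then have "P = m" using Nil.prems prime_chain_subset by blast
  then show ?case using Nil.prems(4) by (cases n) (auto dest: prime_chain_subset)
next
  case (Cons x xs)
  let ?J = "Idl (insert x J)"
  have x: "x \<in> carrier R" and xs: "set xs \<subseteq> carrier R" using Cons.prems(2) by auto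
  have Jc: "J \<subseteq> carrier R" using ideal.Icarr[OF Cons.prems(1)] by blast
  have J': "ideal ?J R" by (rule genideal_insert_ideal[OF Cons.prems(1) x])
  have gen: "Idl (?J \<union> set xs) = m"
    using genideal_Un_genideal[of "insert x J" "set xs"] x xs Jc Cons.prems(3) by simp
  show ?case
  proof (cases n)
    case (Suc n')
    have "x \<in> m" using genideal_self[of "J \<union> set (x # xs)"] Cons.prems(3) Jc x xs by auto
    then obtain Q where Q: "P \<subset> Q" "x \<in> Q" "prime_chain R n' Q m"
      using prime_chain_through[of n' P m x] Cons.prems(4) Suc by blast
    have "ideal Q R" using prime_chain_prime[OF Q(3)] by (rule primeideal.axioms(1))
    then have "?J \<subseteq> Q" using Q Cons.prems(5) by (intro genideal_minimal) auto
    then have "n' \<le> length xs" using Cons.IH[OF J' xs gen Q(3)] by blast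
    then show ?thesis using Suc by simp
  qed simp
qed

text \<open>A prime \<open>P\<close> at the bottom of a chain of length \<open>length (x # xs)\<close> above \<open>J\<close> does not
  contain \<open>x\<close>, while the next prime of a suitable chain is the prime ideal generated by \<open>J\<close>
  and \<open>x\<close>. So \<open>P = J + xP\<close>, and Nakayama's lemma gives \<open>P = J\<close>.\<close>

lemma regular_mod_of_prime_chain:
  assumes "ideal J R" "set xs \<subseteq> carrier R" "Idl (J \<union> set xs) = m"
    "prime_chain R (length xs) P m" "J \<subseteq> P"
  shows "primeideal J R \<and> regular_mod R J xs"
  using assms
proof (induction xs arbitrary: J P)
  case Nil
  then show ?case using genideal_idem prime by simp
next
  case (Cons x xs)
  let ?J = "Idl (insert x J)"
  have x: "x \<in> carrier R" and xs: "set xs \<subseteq> carrier R" using Cons.prems(2) by auto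
  have Jc: "J \<subseteq> carrier R" using ideal.Icarr[OF Cons.prems(1)] by blast
  have J': "ideal ?J R" by (rule genideal_insert_ideal[OF Cons.prems(1) x])
  have gen: "Idl (?J \<union> set xs) = m"
    using genideal_Un_genideal[of "insert x J" "set xs"] x xs Jc Cons.prems(3) by simp
  have xm: "x \<in> m" using genideal_self[of "J \<union> set (x # xs)"] Cons.prems(3) Jc x xs by auto
  have P: "primeideal P R" using Cons.prems(4) by (rule prime_chain_prime)
  interpret P: primeideal P R by (rule P)
  obtain Q where Q: "P \<subset> Q" "x \<in> Q" "prime_chain R (length xs) Q m"
    using prime_chain_through[of "length xs" P m x] Cons.prems(4) xm by auto
  have "ideal Q R" using prime_chain_prime[OF Q(3)] by (rule primeideal.axioms(1))
  then have JQ: "?J \<subseteq> Q" using Q Cons.prems(5) by (intro genideal_minimal) auto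
  have IH: "primeideal ?J R" "regular_mod R ?J xs" using Cons.IH[OF J' xs gen Q(3) JQ] by auto
  have QJ: "Q = ?J"
  proof (rule ccontr)
    assume "Q \<noteq> ?J"
    then have "prime_chain R (Suc (length xs)) ?J m" using JQ Q(3) IH(1) by auto
    then show False using prime_chain_length_le[OF J' xs gen, of "Suc (length xs)" ?J] by simp
  qed
  have xP: "x \<notin> P"
  proof
    assume "x \<in> P"
    then have "?J \<subseteq> P" using Cons.prems(5) by (intro genideal_minimal P.is_ideal) auto
    then show False using QJ Q(1) by blast
  qed
  have "P \<subseteq> J"
  proof (rule nakayama_ideal[OF P.is_ideal Cons.prems(1) xm])
    fix a assume a: "a \<in> P"
    then have "a \<in> ?J" using Q(1) QJ by blast
    then obtain c z where c: "c \<in> carrier R" and z: "z \<in> J" and eq: "a = c \<otimes> x \<oplus> z"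
      using genideal_insert[OF Cons.prems(1) x] by blast
    have zc: "z \<in> carrier R" using z Jc by blast
    have "c \<otimes> x = a \<ominus> z" unfolding eq using c x zc by algebra
    also have "\<dots> \<in> P" using a z Cons.prems(5) by (auto simp: a_minus_def)
    finally have "c \<in> P" using P.I_prime[OF c x] xP by blast
    moreover have "a = z \<oplus> x \<otimes> c" unfolding eq using c x zc by algebra
    ultimately show "\<exists>y\<in>J. \<exists>b\<in>P. a = y \<oplus> x \<otimes> b" using z by blast
  qed
  then have JP: "J = P" using Cons.prems(5) by blast
  have "\<forall>a\<in>carrier R. x \<otimes> a \<in> J \<longrightarrow> a \<in> J" unfolding JP using P.I_prime[OF x] xP by blast
  then show ?case using P JP IH(2) unfolding regular_mod.simps by blast
qed

end

text \<open>The Krull dimension is attained by a chain of primes, since it is finite and equals the number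
  of generators of \<open>m\<close>.\<close>

lemma regular_local_ring_regular_sequence:
  fixes R (structure)
  assumes reg: "regular_local_ring R" and m: "noetherian_local_ring R m"
  obtains xs where "set xs \<subseteq> carrier R" "genideal R (set xs) = m" "regular_mod R {\<zero>\<^bsub>R\<^esub>} xs"
proof -
  interpret noetherian_local_ring R m by fact
  interpret m: primeideal m R by (rule prime)
  let ?d = "min_generators R m"
  have dim: "enat ?d = krull_dim R" using reg maximal by (simp add: regular_local_ring_def)
  obtain S0 where "S0 \<subseteq> carrier R" "finite S0" "m = Idl S0" using finetely_gen[OF m.is_ideal] by blast
  then have "\<exists>n. \<exists>S \<subseteq> carrier R. finite S \<and> card S = n \<and> Idl S = m" by blast
  then have "\<exists>S \<subseteq> carrier R. finite S \<and> card S = ?d \<and> Idl S = m"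
    unfolding min_generators_def by (rule LeastI_ex)
  then obtain S where S: "S \<subseteq> carrier R" "finite S" "card S = ?d" "Idl S = m" by blast
  obtain xs where xs: "set xs = S" "distinct xs" using finite_distinct_list[OF S(2)] by blast
  have len: "length xs = ?d" using distinct_card[OF xs(2)] xs(1) S(3) by simp
  let ?C = "{n. \<exists>P :: nat \<Rightarrow> 'a set. (\<forall>i\<le>n. primeideal (P i) R) \<and> (\<forall>i<n. P i \<subset> P (Suc i))}"
  have "\<exists>n\<in>?C. ?d \<le> n"
  proof (rule ccontr)
    assume none: "\<not> ?thesis"
    have lt: "n < ?d" if n: "n \<in> ?C" for n
    proof (rule ccontr)
      assume "\<not> n < ?d"
      then have "?d \<le> n" by simp
      then show False using none n by blast
    qed
    have "0 \<in> ?C" using prime by auto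
    then have "?d > 0" using lt by blast
    moreover have "krull_dim R \<le> enat (?d - 1)"
      unfolding krull_dim_def
    proof (rule SUP_least)
      fix n assume "n \<in> ?C"
      then have "n < ?d" by (rule lt)
      then show "enat n \<le> enat (?d - 1)" by simp
    qed
    ultimately show False unfolding dim[symmetric] by simp
  qed
  then obtain n P where n: "?d \<le> n" and P: "\<forall>i\<le>n. primeideal (P i) R" "\<forall>i<n. P i \<subset> P (Suc i)" by blast
  have Pm: "P i \<subseteq> m" if "i \<le> n" for i
  proof (rule proper_ideal_subset)
    have Pi: "primeideal (P i) R" using P(1) that by blast
    then show "ideal (P i) R" by (rule primeideal.axioms(1))
    show "P i \<noteq> carrier R" using primeideal.I_notcarr[OF Pi] by blast
  qed
  \<comment> \<open>Replace the last prime by the maximal ideal.\<close>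
  define P' where "P' i = (if i = ?d then m else P i)" for i
  have "\<forall>i\<le>?d. primeideal (P' i) R" using P(1) n prime by (auto simp: P'_def)
  moreover have "\<forall>i<?d. P' i \<subset> P' (Suc i)"
  proof (intro allI impI)
    fix i assume i: "i < ?d"
    have "P i \<subset> P (Suc i)" using P(2) n i by auto
    then show "P' i \<subset> P' (Suc i)" using Pm[of "Suc i"] i n by (auto simp: P'_def)
  qed
  ultimately have chain: "prime_chain R (length xs) (P' 0) m"
    using prime_chain_extend[of ?d P' R] by (simp add: len P'_def)
  have "\<zero> \<in> P' 0"
    using prime_chain_prime[OF chain] additive_subgroup.zero_closed[OF ideal.axioms(1)[OF primeideal.axioms(1)]] by blast
  moreover have "Idl ({\<zero>} \<union> set xs) = m"
  proof -
    have z: "{\<zero>} \<subseteq> carrier R" "S \<subseteq> carrier R" using S(1) by auto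
    have "Idl (Idl S \<union> {\<zero>}) = Idl (S \<union> {\<zero>})" by (rule genideal_Un_genideal[OF z(2,1)])
    moreover have "Idl S \<union> {\<zero>} = m" using S(4) m.zero_closed by auto
    ultimately show ?thesis using genideal_idem[OF m.is_ideal] xs(1) by (simp add: Un_commute)
  qed
  ultimately have "regular_mod R {\<zero>} xs"
    using regular_mod_of_prime_chain[OF zeroideal _ _ chain] S(1) xs(1) by auto
  then show thesis using that[of xs] xs S by simp
qed

section \<open>The Frobenius in characteristic \<open>p\<close>\<close>

context cring
begin

text \<open>The induction step splits each coefficient by Pascal's rule and shifts the index of one part.\<close>

lemma binomial_ring:
  assumes a: "a \<in> carrier R" and b: "b \<in> carrier R"
  shows "(a \<oplus> b) [^] n = (\<Oplus>k\<in>{..n}. add_pow R (n choose k) (a [^] k \<otimes> b [^] (n - k)))"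
proof (induction n)
  case 0
  then show ?case using a b by simp
next
  case (Suc n)
  define t where "t n k = add_pow R (n choose k) (a [^] k \<otimes> b [^] (n - k))" for n k
  have tc: "t n k \<in> carrier R" for n k using a b by (simp add: t_def)
  have at: "a \<otimes> t n k = add_pow R (n choose k) (a [^] Suc k \<otimes> b [^] (n - k))" for k
    using a b by (simp add: t_def add_pow_rdistr m_ac)
  have bt: "b \<otimes> t n k = add_pow R (n choose k) (a [^] k \<otimes> b [^] (Suc n - k))" if "k \<le> n" for k
    using a b that by (simp add: t_def add_pow_rdistr Suc_diff_le m_ac)
  have S: "(a \<oplus> b) [^] n = (\<Oplus>k\<in>{..n}. t n k)" using Suc by (simp add: t_def)
  have 1: "t (Suc n) (Suc k) = a \<otimes> t n k \<oplus> add_pow R (n choose Suc k) (a [^] Suc k \<otimes> b [^] (n - k))" for k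
  proof -
    have "t (Suc n) (Suc k) = add_pow R ((n choose k) + (n choose Suc k)) (a [^] Suc k \<otimes> b [^] (n - k))"
      by (simp add: t_def)
    then show ?thesis unfolding at using a b by (simp add: add.nat_pow_mult[symmetric])
  qed
  define u where "u k = add_pow R (n choose k) (a [^] k \<otimes> b [^] (Suc n - k))" for k
  have uc: "u k \<in> carrier R" for k using a b by (simp add: u_def)
  have 1: "t (Suc n) (Suc k) = a \<otimes> t n k \<oplus> u (Suc k)" for k using 1 by (simp add: u_def)
  have u0: "t (Suc n) 0 = u 0" by (simp add: t_def u_def)
  have "(\<Oplus>k\<in>{..Suc n}. t (Suc n) k) = (\<Oplus>k\<in>{..n}. t (Suc n) (Suc k)) \<oplus> t (Suc n) 0"
    using tc by (intro finsum_Suc2) auto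
  also have "(\<Oplus>k\<in>{..n}. t (Suc n) (Suc k)) = (\<Oplus>k\<in>{..n}. a \<otimes> t n k \<oplus> u (Suc k))"
    using a tc uc by (intro finsum_cong') (auto simp: 1)
  also have "\<dots> = (\<Oplus>k\<in>{..n}. a \<otimes> t n k) \<oplus> (\<Oplus>k\<in>{..n}. u (Suc k))"
    using a tc uc by (intro finsum_addf) auto
  also have "(\<Oplus>k\<in>{..n}. a \<otimes> t n k) = a \<otimes> (a \<oplus> b) [^] n"
    unfolding S using a tc by (intro finsum_rdistr[symmetric]) auto
  also have "(a \<otimes> (a \<oplus> b) [^] n \<oplus> (\<Oplus>k\<in>{..n}. u (Suc k))) \<oplus> t (Suc n) 0
     = a \<otimes> (a \<oplus> b) [^] n \<oplus> ((\<Oplus>k\<in>{..n}. u (Suc k)) \<oplus> u 0)"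
    unfolding u0 using a b uc by (intro a_assoc) (auto intro!: finsum_closed)
  also have "(\<Oplus>k\<in>{..n}. u (Suc k)) \<oplus> u 0 = (\<Oplus>k\<in>{..Suc n}. u k)"
    using uc by (intro finsum_Suc2[symmetric]) auto
  also have "\<dots> = u (Suc n) \<oplus> (\<Oplus>k\<in>{..n}. u k)" using uc by (intro finsum_Suc) auto
  also have "u (Suc n) = \<zero>" using a b by (simp add: u_def binomial_eq_0)
  also have "(\<Oplus>k\<in>{..n}. u k) = (\<Oplus>k\<in>{..n}. b \<otimes> t n k)"
    using b tc by (intro finsum_cong') (auto simp: bt u_def)
  also have "\<dots> = b \<otimes> (a \<oplus> b) [^] n"
    unfolding S using b tc by (intro finsum_rdistr[symmetric]) auto
  finally have "(\<Oplus>k\<in>{..Suc n}. t (Suc n) k) = (a \<oplus> b) [^] n \<otimes> (a \<oplus> b)"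
    using a b by (simp add: l_distr m_comm)
  then show ?case by (simp add: t_def)
qed

lemma add_pow_char:
  assumes p: "Factorial_Ring.prime p" and char: "add_pow R (p) \<one> = \<zero>"
    and a: "a \<in> carrier R" and b: "b \<in> carrier R"
  shows "(a \<oplus> b) [^] (p::nat) = a [^] p \<oplus> b [^] p"
proof -
  obtain n where n: "p = Suc (Suc n)" using prime_ge_2_nat[OF p] by (metis add_2_eq_Suc le_Suc_ex)
  define t where "t k = add_pow R (p choose k) (a [^] k \<otimes> b [^] (p - k))" for k
  have tc: "t k \<in> carrier R" for k using a b by (simp add: t_def)
  have zero: "t k = \<zero>" if k: "0 < k" "k < p" for k
  proof -
    have "p dvd (p choose k)" by (rule dvd_choose_prime) (use k p in auto)
    then obtain j where j: "p choose k = p * j" by blast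
    let ?x = "a [^] k \<otimes> b [^] (p - k)"
    have x: "?x \<in> carrier R" using a b by simp
    have "add_pow R (p) ?x = \<zero>" using add_pow_ldistr[of \<one> ?x p] char x by simp
    then show ?thesis unfolding t_def j using x add.nat_pow_pow[of ?x j p] by simp
  qed
  have "(a \<oplus> b) [^] p = (\<Oplus>k\<in>{..Suc (Suc n)}. t k)"
    using binomial_ring[OF a b, of p] by (simp add: t_def n)
  also have "\<dots> = t p \<oplus> (\<Oplus>k\<in>{..Suc n}. t k)" unfolding n using tc by (intro finsum_Suc) auto
  also have "(\<Oplus>k\<in>{..Suc n}. t k) = (\<Oplus>k\<in>{..n}. t (Suc k)) \<oplus> t 0" using tc by (intro finsum_Suc2) auto
  also have "(\<Oplus>k\<in>{..n}. t (Suc k)) = (\<Oplus>k\<in>{..n}. \<zero>)" by (rule finsum_cong') (auto simp: n zero)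
  finally show ?thesis using a b tc by (simp add: t_def)
qed

lemma add_pow_char_power:
  assumes p: "Factorial_Ring.prime p" and char: "add_pow R (p) \<one> = \<zero>"
    and a: "a \<in> carrier R" and b: "b \<in> carrier R"
  shows "(a \<oplus> b) [^] (p ^ e :: nat) = a [^] (p ^ e) \<oplus> b [^] (p ^ e)"
proof (induction e)
  case (Suc e)
  have "x [^] (p ^ Suc e) = (x [^] (p ^ e)) [^] p" if "x \<in> carrier R" for x
    using that by (simp add: nat_pow_pow mult.commute)
  then show ?case using Suc a b add_pow_char[OF p char] by simp
qed (use a b in simp)

end

text \<open>The module usually written \<open>F\<^sub>*R\<close>.\<close>

definition frob_push :: "nat \<Rightarrow> ('a, 'r) ring_scheme \<Rightarrow> ('a, 'a) module" where
  "frob_push q R = \<lparr>carrier = carrier R, monoid.mult = monoid.mult R, monoid.one = monoid.one R,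
     ring.zero = ring.zero R, ring.add = ring.add R, smult = (\<lambda>c a. (c [^]\<^bsub>R\<^esub> q) \<otimes>\<^bsub>R\<^esub> a)\<rparr>"

lemma frob_push_simps [simp]:
  "carrier (frob_push q R) = carrier R"
  "ring.add (frob_push q R) = ring.add R"
  "ring.zero (frob_push q R) = ring.zero R"
  "module.smult (frob_push q R) = (\<lambda>c a. (c [^]\<^bsub>R\<^esub> q) \<otimes>\<^bsub>R\<^esub> a)"
  by (simp_all add: frob_push_def)

lemma finsum_frob_push [simp]: "finsum (frob_push q R) f A = finsum R f A"
  by (simp add: finsum_def finprod_def frob_push_def)

lemma a_inv_frob_push [simp]: "a_inv (frob_push q R) x = a_inv R x"
  by (simp add: a_inv_def m_inv_def frob_push_def)

lemma (in cring) module_frob_push_of_additive: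
  assumes "\<And>a b. a \<in> carrier R \<Longrightarrow> b \<in> carrier R \<Longrightarrow> (a \<oplus> b) [^] q = a [^] q \<oplus> b [^] (q::nat)"
  shows "module R (frob_push q R)"
proof (rule moduleI)
  show "abelian_group (frob_push q R)"
  proof (rule abelian_groupI)
    fix x assume "x \<in> carrier (frob_push q R)"
    then show "\<exists>y \<in> carrier (frob_push q R). y \<oplus>\<^bsub>frob_push q R\<^esub> x = \<zero>\<^bsub>frob_push q R\<^esub>"
      by (intro bexI[of _ "\<ominus> x"]) (auto simp: l_neg)
  qed (auto simp: a_ac)
qed (auto simp: is_cring assms nat_pow_distrib l_distr r_distr m_assoc)

locale frobenius_ring = cring +
  fixes q :: nat
  assumes add_pow_q: "\<And>a b. a \<in> carrier R \<Longrightarrow> b \<in> carrier R \<Longrightarrow> (a \<oplus> b) [^] q = a [^] q \<oplus> b [^] q"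
    and q_ge_2: "q \<ge> 2"

lemma (in cring) frobenius_ringI:
  assumes p: "Factorial_Ring.prime p" and char: "has_characteristic R p" and e: "e \<ge> 1"
  shows "frobenius_ring R (p ^ e)"
proof
  have c: "add_pow R (p) \<one> = \<zero>" using char by (simp add: has_characteristic_def)
  show "(a \<oplus> b) [^] (p ^ e) = a [^] (p ^ e) \<oplus> b [^] (p ^ e)" if "a \<in> carrier R" "b \<in> carrier R" for a b
    by (rule add_pow_char_power[OF p c that])
  have "p ^ 1 \<le> p ^ e" using e prime_ge_1_nat[OF p] by (intro power_increasing) auto
  then show "2 \<le> p ^ e" using prime_ge_2_nat[OF p] by simp
qed

context frobenius_ring
begin

lemma zero_pow_q: "\<zero> [^] q = \<zero>"
  using q_ge_2 by (cases q) auto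

lemma module_frob_push: "module R (frob_push q R)"
  by (rule module_frob_push_of_additive) (rule add_pow_q)

end

sublocale frobenius_ring \<subseteq> push: module R "frob_push q R"
  rewrites "carrier (frob_push q R) = carrier R"
    and "ring.add (frob_push q R) = ring.add R"
    and "ring.zero (frob_push q R) = ring.zero R"
  by (rule module_frob_push) simp_all

lemma (in module) sum_submodule:
  assumes Y: "submodule Y R M" and Z: "submodule Z R M"
  shows "submodule {y \<oplus>\<^bsub>M\<^esub> z | y z. y \<in> Y \<and> z \<in> Z} R M"
proof (rule submoduleI_linear)
  have c: "y \<in> carrier M" if "y \<in> Y \<or> y \<in> Z" for y using that submodule_subset Y Z by blast
  show "{y \<oplus>\<^bsub>M\<^esub> z | y z. y \<in> Y \<and> z \<in> Z} \<subseteq> carrier M" using c by auto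
  have "\<zero>\<^bsub>M\<^esub> = \<zero>\<^bsub>M\<^esub> \<oplus>\<^bsub>M\<^esub> \<zero>\<^bsub>M\<^esub>" by simp
  then show "\<zero>\<^bsub>M\<^esub> \<in> {y \<oplus>\<^bsub>M\<^esub> z | y z. y \<in> Y \<and> z \<in> Z}" using submodule_zero Y Z by blast
  fix a b assume "a \<in> {y \<oplus>\<^bsub>M\<^esub> z | y z. y \<in> Y \<and> z \<in> Z}" "b \<in> {y \<oplus>\<^bsub>M\<^esub> z | y z. y \<in> Y \<and> z \<in> Z}"
  then obtain y z y' z' where *: "y \<in> Y" "z \<in> Z" "y' \<in> Y" "z' \<in> Z" "a = y \<oplus>\<^bsub>M\<^esub> z" "b = y' \<oplus>\<^bsub>M\<^esub> z'" by blast
  have "a \<oplus>\<^bsub>M\<^esub> b = (y \<oplus>\<^bsub>M\<^esub> y') \<oplus>\<^bsub>M\<^esub> (z \<oplus>\<^bsub>M\<^esub> z')" using * c by (simp add: M.a_ac)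
  then show "a \<oplus>\<^bsub>M\<^esub> b \<in> {y \<oplus>\<^bsub>M\<^esub> z | y z. y \<in> Y \<and> z \<in> Z}" using * submodule_add Y Z by blast
next
  have c: "y \<in> carrier M" if "y \<in> Y \<or> y \<in> Z" for y using that submodule_subset Y Z by blast
  fix r a assume r: "r \<in> carrier R" and "a \<in> {y \<oplus>\<^bsub>M\<^esub> z | y z. y \<in> Y \<and> z \<in> Z}"
  then obtain y z where *: "y \<in> Y" "z \<in> Z" "a = y \<oplus>\<^bsub>M\<^esub> z" by blast
  have "r \<odot>\<^bsub>M\<^esub> a = r \<odot>\<^bsub>M\<^esub> y \<oplus>\<^bsub>M\<^esub> r \<odot>\<^bsub>M\<^esub> z" using * r c by (simp add: smult_r_distr)
  then show "r \<odot>\<^bsub>M\<^esub> a \<in> {y \<oplus>\<^bsub>M\<^esub> z | y z. y \<in> Y \<and> z \<in> Z}"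
    using * r submodule_smult Y Z by blast
qed

lemma (in module) submodule_finsum:
  assumes N: "submodule N R M" and "finite A" "\<And>i. i \<in> A \<Longrightarrow> f i \<in> N"
  shows "finsum M f A \<in> N"
  using assms(2,3)
proof (induction A)
  case empty
  then show ?case using submodule_zero[OF N] by simp
next
  case (insert x A)
  have "f \<in> insert x A \<rightarrow> carrier M" using insert.prems submodule_subset[OF N] by blast
  then show ?case using insert submodule_add[OF N] by (simp add: Pi_def)
qed

text \<open>If \<open>s\<^sub>i\<close> generate \<open>R\<close> over its \<open>p\<close>-th powers and \<open>t\<^sub>j\<close> generate it over its
  \<open>p^e\<close>-th powers, then the products \<open>s\<^sub>i t\<^sub>j\<^sup>p\<close> generate it over its \<open>p^(e+1)\<close>-th powers.
  Generation is expressed through submodules, so that the two steps can be composed without sums.\<close>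

lemma (in cring) frob_push_fg:
  assumes p: "Factorial_Ring.prime p" and char: "has_characteristic R p" and fin: "F_finite p R"
  shows "\<exists>S \<subseteq> carrier R. finite S \<and> (\<forall>N. submodule N R (frob_push (p ^ e) R) \<and> S \<subseteq> N \<longrightarrow> N = carrier R)"
proof (induction e)
  case 0
  have "N = carrier R" if N: "submodule N R (frob_push (p ^ 0) R)" "{\<one>} \<subseteq> N" for N
  proof -
    have "subgroup N (add_monoid (frob_push (p ^ 0) R))" by (rule submodule.axioms(1)[OF N(1)])
    then have "N \<subseteq> carrier R" using subgroup.subset by fastforce
    moreover have "r \<in> N" if "r \<in> carrier R" for r
      using submodule.smult_closed[OF N(1) that, of \<one>] N(2) that by simp
    ultimately show ?thesis by blast
  qed
  then show ?case by (intro exI[of _ "{\<one>}"]) auto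
next
  case (Suc e)
  then obtain T where T: "T \<subseteq> carrier R" "finite T"
    and Tgen: "\<And>N. submodule N R (frob_push (p ^ e) R) \<Longrightarrow> T \<subseteq> N \<Longrightarrow> N = carrier R" by blast
  let ?Rp = "R\<lparr>carrier := {x [^] p | x. x \<in> carrier R}\<rparr>"
  obtain S where S: "S \<subseteq> carrier R" "finite S"
    and span: "submodule_span ?Rp (regular_module R) S = carrier R"
    using fin unfolding F_finite_def fg_submodule_def by blast
  have Sgen: "carrier R \<subseteq> N" if "submodule N ?Rp (regular_module R)" "S \<subseteq> N" for N
    using hull_minimal[of S N "\<lambda>N. submodule N ?Rp (regular_module R)"] that span
    by (simp add: submodule_span_def)
  have c: "add_pow R (p) \<one> = \<zero>" using char by (simp add: has_characteristic_def)
  note addp = add_pow_char[OF p c]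
  interpret reg: module R "regular_module R" by (rule module_regular_module)
  interpret big: frobenius_ring R "p ^ Suc e" by (rule frobenius_ringI[OF p char]) simp
  interpret sm: module R "frob_push (p ^ e) R" 
    by (rule module_frob_push_of_additive) (rule add_pow_char_power[OF p c])
  define G where "G = (\<lambda>(s, t). s \<otimes> t [^] p) ` (S \<times> T)"
  have "N = carrier R" if N: "submodule N R (frob_push (p ^ Suc e) R)" and G: "G \<subseteq> N" for N
  proof -
    have Nc: "N \<subseteq> carrier R" using big.push.submodule_subset[OF N] by simp
    have Nz: "\<zero> \<in> N" using big.push.submodule_zero[OF N] by simp
    have Na: "a \<oplus> b \<in> N" if "a \<in> N" "b \<in> N" for a b using big.push.submodule_add[OF N that] by simp
    have Ns: "c [^] (p ^ Suc e) \<otimes> a \<in> N" if "c \<in> carrier R" "a \<in> N" for a c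
      using big.push.submodule_smult[OF N that] by simp
    have z: "\<zero> [^] p = \<zero>" using prime_gt_0_nat[OF p] by (cases p) auto
    have powpow: "(c [^] (p ^ e)) [^] p = c [^] (p ^ Suc e)" if "c \<in> carrier R" for c
      using that by (simp add: nat_pow_pow mult.commute)
    have step1: "s \<otimes> r [^] p \<in> N" if s: "s \<in> S" and r: "r \<in> carrier R" for s r
    proof -
      have sc: "s \<in> carrier R" using s S by blast
      have "submodule {r \<in> carrier R. s \<otimes> r [^] p \<in> N} R (frob_push (p ^ e) R)"
      proof (rule sm.submoduleI_linear)
        show "\<zero>\<^bsub>frob_push (p ^ e) R\<^esub> \<in> {r \<in> carrier R. s \<otimes> r [^] p \<in> N}" using sc Nz z by simp
        fix a b assume "a \<in> {r \<in> carrier R. s \<otimes> r [^] p \<in> N}" "b \<in> {r \<in> carrier R. s \<otimes> r [^] p \<in> N}"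
        then show "a \<oplus>\<^bsub>frob_push (p ^ e) R\<^esub> b \<in> {r \<in> carrier R. s \<otimes> r [^] p \<in> N}"
          using sc Na by (simp add: addp r_distr)
      next
        fix c a assume c: "c \<in> carrier R" and a: "a \<in> {r \<in> carrier R. s \<otimes> r [^] p \<in> N}"
        have "s \<otimes> (c [^] (p ^ e) \<otimes> a) [^] p = c [^] (p ^ Suc e) \<otimes> (s \<otimes> a [^] p)"
          using sc c a powpow[OF c] by (simp add: nat_pow_distrib m_ac)
        then show "c \<odot>\<^bsub>frob_push (p ^ e) R\<^esub> a \<in> {r \<in> carrier R. s \<otimes> r [^] p \<in> N}"
          using Ns[OF c, of "s \<otimes> a [^] p"] c a by simp
      qed auto
      moreover have "T \<subseteq> {r \<in> carrier R. s \<otimes> r [^] p \<in> N}" using G s T by (auto simp: G_def)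
      ultimately have "{r \<in> carrier R. s \<otimes> r [^] p \<in> N} = carrier R" by (rule Tgen)
      then show ?thesis using r by blast
    qed
    let ?N' = "{a \<in> carrier R. \<forall>r \<in> carrier R. a \<otimes> r [^] p \<in> N}"
    have ideal': "subgroup ?N' (add_monoid (regular_module R))"
    proof -
      have "subgroup ?N' (add_monoid R)"
      proof (rule add.subgroupI)
        show "?N' \<subseteq> carrier R" by auto
        show "?N' \<noteq> {}" using Nz by (auto intro!: exI[of _ \<zero>])
        fix a assume a: "a \<in> ?N'"
        have "(\<ominus> a) \<otimes> r [^] p \<in> N" if r: "r \<in> carrier R" for r
        proof -
          have "\<ominus>\<^bsub>frob_push (p ^ Suc e) R\<^esub> (a \<otimes> r [^] p) \<in> N"
            using big.push.submoduleE(3)[OF N] a r by simp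
          then show ?thesis using a r by (simp add: l_minus)
        qed
        then show "\<ominus> a \<in> ?N'" using a by simp
      next
        fix a b assume "a \<in> ?N'" "b \<in> ?N'"
        then show "a \<oplus> b \<in> ?N'" using Na by (simp add: l_distr)
      qed
      then show ?thesis by (simp add: regular_module_def subgroup_def m_inv_def)
    qed
    have "submodule ?N' ?Rp (regular_module R)"
      unfolding submodule_def submodule_axioms_def
    proof (intro conjI allI impI)
      show "subgroup ?N' (add_monoid (regular_module R))" by (rule ideal')
      fix x a assume "x \<in> carrier ?Rp" and a: "a \<in> ?N'"
      then obtain y where y: "y \<in> carrier R" "x = y [^] p" by auto
      have "(y [^] p \<otimes> a) \<otimes> r [^] p = a \<otimes> (y \<otimes> r) [^] p" if "r \<in> carrier R" for r
        using that y a by (simp add: nat_pow_distrib m_ac)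
      then show "x \<odot>\<^bsub>regular_module R\<^esub> a \<in> ?N'" using a y by simp
    qed
    moreover have "S \<subseteq> ?N'" using step1 S by auto
    ultimately have "carrier R \<subseteq> ?N'" by (rule Sgen)
    moreover have "a \<in> N" if "a \<in> ?N'" for a
    proof -
      have "a \<otimes> \<one> [^] p \<in> N" using that by blast
      then show ?thesis using that by simp
    qed
    ultimately show ?thesis using Nc by blast
  qed
  moreover have "G \<subseteq> carrier R" using S T by (auto simp: G_def)
  moreover have "finite G" using S T by (simp add: G_def)
  ultimately show ?case by blast
qed

section \<open>Freeness of the Frobenius over a regular local ring\<close>

lemma finsum_regular_module [simp]: "finsum (regular_module R) f A = finsum R f A"
  by (simp add: finsum_def finprod_def regular_module_def)

locale frobenius_local_ring = noetherian_local_ring + frobenius_ring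
begin

text \<open>The linear combination of the elements of \<open>E\<close> in \<open>F\<^sub>*R\<close> with coefficients \<open>f\<close>.\<close>

definition comb :: "'a set \<Rightarrow> ('a \<Rightarrow> 'a) \<Rightarrow> 'a" where
  "comb E f = (\<Oplus>e\<in>E. f e [^] q \<otimes> e)"

lemma comb_closed:
  "E \<subseteq> carrier R \<Longrightarrow> f \<in> E \<rightarrow> carrier R \<Longrightarrow> comb E f \<in> carrier R"
  unfolding comb_def by (rule finsum_closed) auto

lemma comb_add:
  assumes "E \<subseteq> carrier R" "f \<in> E \<rightarrow> carrier R" "g \<in> E \<rightarrow> carrier R"
  shows "comb E (\<lambda>e. f e \<oplus> g e) = comb E f \<oplus> comb E g"
proof -
  have "comb E (\<lambda>e. f e \<oplus> g e) = (\<Oplus>e\<in>E. f e [^] q \<otimes> e \<oplus> g e [^] q \<otimes> e)"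
    unfolding comb_def by (rule finsum_cong') (use assms in \<open>auto simp: add_pow_q l_distr Pi_iff subset_iff\<close>)
  also have "\<dots> = comb E f \<oplus> comb E g"
    unfolding comb_def by (rule finsum_addf) (use assms in \<open>auto simp: Pi_iff subset_iff\<close>)
  finally show ?thesis .
qed

lemma comb_smult:
  assumes "E \<subseteq> carrier R" "finite E" "f \<in> E \<rightarrow> carrier R" "c \<in> carrier R"
  shows "comb E (\<lambda>e. c \<otimes> f e) = c [^] q \<otimes> comb E f"
proof -
  have "comb E (\<lambda>e. c \<otimes> f e) = (\<Oplus>e\<in>E. c [^] q \<otimes> (f e [^] q \<otimes> e))"
    unfolding comb_def
    by (rule finsum_cong') (use assms in \<open>auto simp: nat_pow_distrib m_assoc Pi_iff subset_iff\<close>)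
  also have "\<dots> = c [^] q \<otimes> comb E f"
    unfolding comb_def by (rule finsum_rdistr[symmetric]) (use assms in \<open>auto simp: Pi_iff subset_iff\<close>)
  finally show ?thesis .
qed

lemma comb_zero: "E \<subseteq> carrier R \<Longrightarrow> comb E (\<lambda>e. \<zero>) = \<zero>"
  unfolding comb_def using finsum_zero[of E]
  by (subst finsum_cong'[of E E "\<lambda>_. \<zero>"]) (auto simp: zero_pow_q)

lemma comb_cong:
  "E \<subseteq> carrier R \<Longrightarrow> f \<in> E \<rightarrow> carrier R \<Longrightarrow> (\<And>e. e \<in> E \<Longrightarrow> f e = g e) \<Longrightarrow> comb E f = comb E g"
  unfolding comb_def by (rule finsum_cong') (auto simp: Pi_iff subset_iff)

lemma comb_unit:
  assumes "E \<subseteq> carrier R" "finite E" "e0 \<in> E"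
  shows "comb E (\<lambda>e. if e0 = e then \<one> else \<zero>) = e0"
proof -
  have "comb E (\<lambda>e. if e0 = e then \<one> else \<zero>) = (\<Oplus>e\<in>E. if e0 = e then e else \<zero>)"
    unfolding comb_def by (rule finsum_cong') (use assms in \<open>auto simp: zero_pow_q subset_iff\<close>)
  also have "\<dots> = e0" using finsum_singleton[of e0 E "\<lambda>e. e"] assms by auto
  finally show ?thesis .
qed

lemma comb_surj:
  assumes E: "E \<subseteq> carrier R" "finite E"
    and gen: "submodule_span R (frob_push q R) E = carrier R" and a: "a \<in> carrier R"
  shows "\<exists>f \<in> E \<rightarrow> carrier R. comb E f = a"
proof -
  let ?N = "{comb E f | f. f \<in> E \<rightarrow> carrier R}"
  have "submodule ?N R (frob_push q R)"
  proof (rule push.submoduleI_linear)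
    show "?N \<subseteq> carrier R" using comb_closed[OF E(1)] by auto
    show "\<zero> \<in> ?N" using comb_zero[OF E(1)] by (auto intro!: exI[of _ "\<lambda>e. \<zero>"])
    fix x y assume "x \<in> ?N" "y \<in> ?N"
    then obtain f g where fg: "f \<in> E \<rightarrow> carrier R" "g \<in> E \<rightarrow> carrier R" "x = comb E f" "y = comb E g" by blast
    then have "x \<oplus> y = comb E (\<lambda>e. f e \<oplus> g e)" using comb_add[OF E(1)] by simp
    moreover have "(\<lambda>e. f e \<oplus> g e) \<in> E \<rightarrow> carrier R" using fg by auto
    ultimately show "x \<oplus> y \<in> ?N" by blast
  next
    fix c x assume c: "c \<in> carrier R" and "x \<in> ?N"
    then obtain f where f: "f \<in> E \<rightarrow> carrier R" "x = comb E f" by blast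
    have "c \<odot>\<^bsub>frob_push q R\<^esub> x = comb E (\<lambda>e. c \<otimes> f e)" using comb_smult[OF E(1,2) f(1) c] f by simp
    moreover have "(\<lambda>e. c \<otimes> f e) \<in> E \<rightarrow> carrier R" using c f by auto
    ultimately show "c \<odot>\<^bsub>frob_push q R\<^esub> x \<in> ?N" by blast
  qed
  moreover have "E \<subseteq> ?N"
  proof
    fix e0 assume "e0 \<in> E"
    then have "e0 = comb E (\<lambda>e. if e0 = e then \<one> else \<zero>)" using comb_unit[OF E] by simp
    then show "e0 \<in> ?N" by (auto intro!: exI[of _ "\<lambda>e. if e0 = e then \<one> else \<zero>"])
  qed
  ultimately have "submodule_span R (frob_push q R) E \<subseteq> ?N" by (intro push.span_least)
  then show ?thesis using a unfolding gen by blast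
qed

text \<open>The submodule \<open>m F\<^sub>*R\<close>, which is also the ideal of \<open>R\<close> generated by the \<open>q\<close>-th powers of \<open>m\<close>.\<close>

definition m_push :: "'a set" where
  "m_push = submodule_span R (frob_push q R) {c [^] q \<otimes> a | c a. c \<in> m \<and> a \<in> carrier R}"

lemma m_carrier: "c \<in> m \<Longrightarrow> c \<in> carrier R"
  using ideal.Icarr[OF primeideal.axioms(1)[OF prime]] .

lemma m_push_generator:
  assumes "c \<in> m" "a \<in> carrier R" shows "c [^] q \<otimes> a \<in> m_push"
  unfolding m_push_def by (rule subsetD[OF push.span_superset]) (use assms in blast)

lemma m_push_submodule: "submodule m_push R (frob_push q R)"
  unfolding m_push_def by (rule push.span_submodule) (use m_carrier in auto)

lemma m_push_ideal: "ideal m_push R"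
  unfolding submodule_regular_iff_ideal[symmetric]
proof -
  interpret reg: module R "regular_module R" by (rule module_regular_module)
  note sub = m_push_submodule
  have mc: "m_push \<subseteq> carrier R" using push.submodule_subset[OF sub] .
  let ?N = "{a \<in> carrier R. \<forall>r \<in> carrier R. r \<otimes> a \<in> m_push}"
  have "submodule ?N R (frob_push q R)"
  proof (rule push.submoduleI_linear)
    show "\<zero> \<in> ?N" using push.submodule_zero[OF sub] by simp
    show "a \<oplus> b \<in> ?N" if "a \<in> ?N" "b \<in> ?N" for a b
      using that push.submodule_add[OF sub] by (simp add: r_distr)
    fix c a assume c: "c \<in> carrier R" and a: "a \<in> ?N"
    have "r \<otimes> (c [^] q \<otimes> a) = c [^] q \<otimes> (r \<otimes> a)" if "r \<in> carrier R" for r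
      using that c a by (simp add: m_ac)
    then show "c \<odot>\<^bsub>frob_push q R\<^esub> a \<in> ?N"
      using push.submodule_smult[OF sub c] a c by simp
  qed auto
  moreover have "{c [^] q \<otimes> a | c a. c \<in> m \<and> a \<in> carrier R} \<subseteq> ?N"
  proof
    fix x assume "x \<in> {c [^] q \<otimes> a | c a. c \<in> m \<and> a \<in> carrier R}"
    then obtain c a where c: "c \<in> m" and a: "a \<in> carrier R" and x: "x = c [^] q \<otimes> a" by blast
    have cc: "c \<in> carrier R" by (rule m_carrier[OF c])
    have "r \<otimes> x \<in> m_push" if r: "r \<in> carrier R" for r
    proof -
      have "r \<otimes> x = c [^] q \<otimes> (r \<otimes> a)" unfolding x using r cc a by (simp add: m_ac)
      then show ?thesis using m_push_generator[OF c, of "r \<otimes> a"] a r by simp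
    qed
    then show "x \<in> ?N" using x cc a by simp
  qed
  ultimately have "m_push \<subseteq> ?N" unfolding m_push_def by (intro push.span_least)
  then show "submodule m_push R (regular_module R)"
    using push.submodule_zero[OF sub] push.submodule_add[OF sub] mc
    by (intro reg.submoduleI_linear) auto
qed

lemma Units_pow_cancel:
  assumes u: "u \<in> Units R" and a: "a \<in> carrier R"
  shows "inv u [^] q \<otimes> (u [^] q \<otimes> a) = a"
proof -
  have c: "inv u \<in> carrier R" "u \<in> carrier R" using u by auto
  have "inv u [^] q \<otimes> u [^] q = (inv u \<otimes> u) [^] q" by (rule nat_pow_distrib[OF c, symmetric])
  then have 1: "inv u [^] q \<otimes> u [^] q = \<one>" using u by simp
  have "inv u [^] q \<otimes> (u [^] q \<otimes> a) = (inv u [^] q \<otimes> u [^] q) \<otimes> a"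
    using c a by (intro m_assoc[symmetric]) auto
  then show ?thesis unfolding 1 using a by simp
qed

text \<open>A generating family of least cardinality is a basis modulo \<open>m\<close>: a relation with a
  unit coefficient would allow one generator to be dropped, by Nakayama's lemma.\<close>

lemma comb_mem_m_push:
  assumes E: "E \<subseteq> carrier R" "finite E"
    and gen: "submodule_span R (frob_push q R) E = carrier R"
    and min: "\<And>E'. E' \<subseteq> carrier R \<Longrightarrow> finite E' \<Longrightarrow> submodule_span R (frob_push q R) E' = carrier R \<Longrightarrow> card E \<le> card E'"
    and f: "f \<in> E \<rightarrow> carrier R" and mem: "comb E f \<in> m_push" and e0: "e0 \<in> E"
  shows "f e0 \<in> m"
proof (rule ccontr)
  assume fm: "f e0 \<notin> m"
  have fc: "f e0 \<in> carrier R" using f e0 by auto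
  have u: "f e0 \<in> Units R" by (rule units[OF fc fm])
  let ?E = "E - {e0}"
  let ?Y = "submodule_span R (frob_push q R) ?E"
  have Ec: "?E \<subseteq> carrier R" using E by auto
  have e0c: "e0 \<in> carrier R" using E e0 by auto
  have Y: "submodule ?Y R (frob_push q R)" by (rule push.span_submodule[OF Ec])
  let ?W = "{y \<oplus> z | y z. y \<in> ?Y \<and> z \<in> m_push}"
  have W: "submodule ?W R (frob_push q R)" using push.sum_submodule[OF Y m_push_submodule] by simp
  have Yc: "y \<in> carrier R" if "y \<in> ?Y" for y using push.submodule_subset[OF Y] that by blast
  have mc: "y \<in> carrier R" if "y \<in> m_push" for y using push.submodule_subset[OF m_push_submodule] that by blast
  have YW: "?Y \<subseteq> ?W"
  proof
    fix y assume y: "y \<in> ?Y"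
    then have "y = y \<oplus> \<zero>" using Yc by simp
    then show "y \<in> ?W" using y push.submodule_zero[OF m_push_submodule] by blast
  qed
  have mW: "m_push \<subseteq> ?W"
  proof
    fix z assume z: "z \<in> m_push"
    then have "z = \<zero> \<oplus> z" using mc by simp
    then show "z \<in> ?W" using z push.submodule_zero[OF Y] by blast
  qed
  have rest: "comb ?E f \<in> ?Y"
  proof -
    have "f e [^] q \<otimes> e \<in> ?Y" if e: "e \<in> ?E" for e
    proof -
      have "e \<in> ?Y" by (rule subsetD[OF push.span_superset e])
      moreover have "f e \<in> carrier R" using f e by auto
      ultimately show ?thesis using push.submodule_smult[OF Y] by simp
    qed
    then have "finsum (frob_push q R) (\<lambda>e. f e [^] q \<otimes> e) ?E \<in> ?Y"
      using E(2) by (intro push.submodule_finsum[OF Y]) auto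
    then show ?thesis by (simp add: comb_def)
  qed
  have split: "comb E f = f e0 [^] q \<otimes> e0 \<oplus> comb ?E f"
  proof -
    have "comb (insert e0 ?E) f = f e0 [^] q \<otimes> e0 \<oplus> comb ?E f"
      unfolding comb_def using E f fc e0c by (intro finsum_insert) auto
    then show ?thesis using e0 by (simp add: insert_absorb)
  qed
  have "f e0 [^] q \<otimes> e0 \<in> ?W"
  proof (rule push.submodule_add_cancel[OF W])
    show "f e0 [^] q \<otimes> e0 \<oplus> comb ?E f \<in> ?W" using mem mW split by auto
    show "comb ?E f \<in> ?W" using rest YW by blast
    show "f e0 [^] q \<otimes> e0 \<in> carrier R" using fc e0c by simp
  qed
  then have "(inv f e0) \<odot>\<^bsub>frob_push q R\<^esub> (f e0 [^] q \<otimes> e0) \<in> ?W"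
    using u by (intro push.submodule_smult[OF W]) auto
  moreover have "(inv f e0) \<odot>\<^bsub>frob_push q R\<^esub> (f e0 [^] q \<otimes> e0) = e0"
    using Units_pow_cancel[OF u e0c] by simp
  ultimately have "e0 \<in> ?W" by simp
  then have "E \<subseteq> ?W" using subset_trans[OF push.span_superset[of ?E] YW] by blast
  then have "submodule_span R (frob_push q R) E \<subseteq> ?W" by (rule push.span_least[OF _ W])
  then have carW: "carrier R \<subseteq> ?W" unfolding gen .
  have "fg_submodule R (frob_push q R) (carrier R)"
    using push.fg_submodule_span[OF E(2,1)] gen by simp
  then have noeth: "push.noetherian_sub (carrier R)"
    by (rule push.noetherian_sub_of_fg[OF noetherian_ring_axioms])
  have "carrier R \<subseteq> push.sat m ?Y"
  proof (rule push.nakayama_sat[OF noeth Y prime])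
    fix a assume a: "a \<in> carrier R"
    then obtain y z where y: "y \<in> ?Y" and z: "z \<in> m_push" and eq: "a = y \<oplus> z" using carW by blast
    have "\<one> \<odot>\<^bsub>frob_push q R\<^esub> a = y \<oplus> z" using eq a by simp
    moreover have "\<one> \<in> carrier R - m" by (rule primeideal.one_compl[OF prime])
    moreover have "z \<in> submodule_span R (frob_push q R) {p \<odot>\<^bsub>frob_push q R\<^esub> b |p b. p \<in> m \<and> b \<in> carrier R}"
      using z by (simp add: m_push_def)
    ultimately show "\<exists>s\<in>carrier R - m. \<exists>y\<in>?Y. \<exists>z\<in>submodule_span R (frob_push q R)
        {p \<odot>\<^bsub>frob_push q R\<^esub> b |p b. p \<in> m \<and> b \<in> carrier R}. s \<odot>\<^bsub>frob_push q R\<^esub> a = y \<oplus> z"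
      using y by blast
  qed
  have "carrier R \<subseteq> ?Y"
  proof
    fix a assume a: "a \<in> carrier R"
    then have "a \<in> push.sat m ?Y" using \<open>carrier R \<subseteq> push.sat m ?Y\<close> by blast
    then obtain s where s: "s \<in> carrier R" "s \<notin> m" and sa: "s \<odot>\<^bsub>frob_push q R\<^esub> a \<in> ?Y"
      unfolding push.sat_def by blast
    have us: "s \<in> Units R" by (rule units[OF s])
    have "(inv s) \<odot>\<^bsub>frob_push q R\<^esub> (s \<odot>\<^bsub>frob_push q R\<^esub> a) \<in> ?Y"
      using us by (intro push.submodule_smult[OF Y _ sa]) auto
    then show "a \<in> ?Y" using Units_pow_cancel[OF us a] by simp
  qed
  then have "?Y = carrier R" using Yc by blast
  then have "card E \<le> card ?E" using min[of ?E] Ec E(2) by auto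
  then show False using e0 E(2) by (metis card_Diff1_less not_le)
qed

text \<open>Independence modulo \<open>m\<close> lifts along the regular sequence: if the coefficients lie in
  \<open>J + xR\<close> and \<open>x\<^sup>q\<close> is a nonzerodivisor modulo \<open>JF\<close>, then dividing by \<open>x\<close> shows that each
  coefficient ideal is contained in \<open>J\<close> plus \<open>x\<close> times itself.\<close>

lemma comb_coefficients_mem:
  assumes E: "E \<subseteq> carrier R" "finite E"
    and J: "ideal J R" "ideal JF R" "\<And>c. c \<in> J \<Longrightarrow> c [^] q \<in> JF"
    and xs: "set xs \<subseteq> m" and reg: "regular_mod R JF (map (\<lambda>x. x [^] q) xs)"
    and top: "\<And>f e. f \<in> E \<rightarrow> carrier R \<Longrightarrow> comb E f \<in> Idl (JF \<union> (\<lambda>x. x [^] q) ` set xs) \<Longrightarrow> e \<in> E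
        \<Longrightarrow> f e \<in> Idl (J \<union> set xs)"
    and f: "f \<in> E \<rightarrow> carrier R" "comb E f \<in> JF" and e: "e \<in> E"
  shows "f e \<in> J"
  using J xs reg top f e
proof (induction xs arbitrary: J JF f e)
  case Nil
  show ?case using Nil.prems(6)[of f e] Nil.prems(7-9) genideal_idem[OF Nil.prems(1)] genideal_idem[OF Nil.prems(2)] by simp
next
  case (Cons x xs)
  interpret J: ideal J R by (rule Cons.prems(1))
  interpret JF: ideal JF R by (rule Cons.prems(2))
  have xm: "x \<in> m" and xsm: "set xs \<subseteq> m" using Cons.prems(4) by auto
  have x: "x \<in> carrier R" by (rule m_carrier[OF xm])
  have xsc: "set xs \<subseteq> carrier R" using xsm m_carrier by blast
  have xq: "x [^] q \<in> carrier R" using x by simp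
  let ?J = "Idl (insert x J)" and ?JF = "Idl (insert (x [^] q) JF)"
  have J': "ideal ?J R" by (rule genideal_insert_ideal[OF J.is_ideal x])
  have JF': "ideal ?JF R" by (rule genideal_insert_ideal[OF JF.is_ideal xq])
  have nzd: "a \<in> JF" if "a \<in> carrier R" "x [^] q \<otimes> a \<in> JF" for a
    using Cons.prems(5) that unfolding list.map regular_mod.simps by blast
  have reg': "regular_mod R ?JF (map (\<lambda>x. x [^] q) xs)"
    using Cons.prems(5) unfolding list.map regular_mod.simps by blast
  have IH: "g e \<in> ?J" if g: "g \<in> E \<rightarrow> carrier R" "comb E g \<in> JF" "e \<in> E" for g e
  proof (rule Cons.IH[OF J' JF' _ xsm reg' _ g(1) _ g(3)])
    show "comb E g \<in> ?JF" using g(2) genideal_insert_superset(2)[OF JF.is_ideal xq] by blast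
    show "c [^] q \<in> ?JF" if c: "c \<in> ?J" for c
    proof -
      obtain d z where d: "d \<in> carrier R" and z: "z \<in> J" and eq: "c = d \<otimes> x \<oplus> z"
        using c genideal_insert[OF J.is_ideal x] by blast
      have zc: "z \<in> carrier R" using z by (rule J.Icarr)
      have "c [^] q = d [^] q \<otimes> x [^] q \<oplus> z [^] q"
        unfolding eq using d x zc by (simp add: add_pow_q nat_pow_distrib)
      then show ?thesis using genideal_insert[OF JF.is_ideal xq] d Cons.prems(3)[OF z] by blast
    qed
    show "h e' \<in> Idl (?J \<union> set xs)"
      if h: "h \<in> E \<rightarrow> carrier R" "comb E h \<in> Idl (?JF \<union> (\<lambda>x. x [^] q) ` set xs)" "e' \<in> E" for h e'
    proof -
      have c: "insert (x [^] q) JF \<subseteq> carrier R" "(\<lambda>x. x [^] q) ` set xs \<subseteq> carrier R"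
        "insert x J \<subseteq> carrier R" using x xsc JF.Icarr J.Icarr by auto
      have "comb E h \<in> Idl (JF \<union> (\<lambda>x. x [^] q) ` set (x # xs))"
        using h(2) genideal_Un_genideal[OF c(1,2)] by simp
      then have "h e' \<in> Idl (J \<union> set (x # xs))" using Cons.prems(6) h by blast
      then show ?thesis using genideal_Un_genideal[OF c(3) xsc] by simp
    qed
  qed
  define A where "A = {g e | g. g \<in> E \<rightarrow> carrier R \<and> comb E g \<in> JF}"
  interpret reg: module R "regular_module R" by (rule module_regular_module)
  note e = Cons.prems(9)
  have A: "ideal A R"
    unfolding submodule_regular_iff_ideal[symmetric]
  proof (rule reg.submoduleI_linear)
    show "A \<subseteq> carrier (regular_module R)" using e by (auto simp: A_def)
    show "\<zero>\<^bsub>regular_module R\<^esub> \<in> A" unfolding A_def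
      using comb_zero[OF E(1)] by (auto intro!: exI[of _ "\<lambda>e. \<zero>"])
  next
    fix a b assume "a \<in> A" "b \<in> A"
    then obtain g h where gh: "g \<in> E \<rightarrow> carrier R" "comb E g \<in> JF" "h \<in> E \<rightarrow> carrier R" "comb E h \<in> JF"
      and ab: "a = g e" "b = h e" unfolding A_def by blast
    have "comb E (\<lambda>e. g e \<oplus> h e) \<in> JF" using comb_add[OF E(1) gh(1,3)] gh by simp
    moreover have "(\<lambda>e. g e \<oplus> h e) \<in> E \<rightarrow> carrier R" using gh by auto
    ultimately show "a \<oplus>\<^bsub>regular_module R\<^esub> b \<in> A" unfolding A_def ab by auto
  next
    fix c a assume c: "c \<in> carrier R" and "a \<in> A"
    then obtain g where g: "g \<in> E \<rightarrow> carrier R" "comb E g \<in> JF" and a: "a = g e" unfolding A_def by blast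
    have "comb E (\<lambda>e. c \<otimes> g e) \<in> JF" using comb_smult[OF E(1,2) g(1) c] g c by (simp add: JF.I_l_closed)
    moreover have "(\<lambda>e. c \<otimes> g e) \<in> E \<rightarrow> carrier R" using g c by auto
    ultimately show "c \<odot>\<^bsub>regular_module R\<^esub> a \<in> A" unfolding A_def a by auto
  qed
  have "A \<subseteq> J"
  proof (rule nakayama_ideal[OF A J.is_ideal xm])
    fix a assume "a \<in> A"
    then obtain g where g: "g \<in> E \<rightarrow> carrier R" "comb E g \<in> JF" and a: "a = g e" unfolding A_def by blast
    have "\<forall>e\<in>E. \<exists>d b. d \<in> carrier R \<and> b \<in> J \<and> g e = d \<otimes> x \<oplus> b"
      using IH[OF g] genideal_insert[OF J.is_ideal x] by blast
    then obtain d b where db: "\<And>e. e \<in> E \<Longrightarrow> d e \<in> carrier R \<and> b e \<in> J \<and> g e = d e \<otimes> x \<oplus> b e" by metis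
    have dE: "d \<in> E \<rightarrow> carrier R" and bE: "b \<in> E \<rightarrow> carrier R" using db J.Icarr by auto
    have xdE: "(\<lambda>e. x \<otimes> d e) \<in> E \<rightarrow> carrier R" using dE x by auto
    have "comb E g = comb E (\<lambda>e. x \<otimes> d e \<oplus> b e)"
      using db x J.Icarr by (intro comb_cong[OF E(1) g(1)]) (simp add: m_comm)
    also have "\<dots> = x [^] q \<otimes> comb E d \<oplus> comb E b"
      using comb_add[OF E(1) xdE bE] comb_smult[OF E(1,2) dE x] by simp
    finally have eq: "comb E g = x [^] q \<otimes> comb E d \<oplus> comb E b" .
    have "comb E b \<in> JF"
    proof -
      have "b e [^] q \<otimes> e \<in> JF" if "e \<in> E" for e
        using JF.I_r_closed[OF Cons.prems(3)] db that E(1) by blast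
      then show ?thesis unfolding comb_def
        using reg.submodule_finsum[OF ideal_submodule_regular[OF JF.is_ideal] E(2), of "\<lambda>e. b e [^] q \<otimes> e"]
        by simp
    qed
    then have "x [^] q \<otimes> comb E d \<in> JF"
      using reg.submodule_add_cancel[OF ideal_submodule_regular[OF JF.is_ideal], of "x [^] q \<otimes> comb E d" "comb E b"]
        g(2) eq comb_closed[OF E(1) dE] x by simp
    then have "comb E d \<in> JF" using nzd comb_closed[OF E(1) dE] by blast
    then have "d e \<in> A" using dE by (auto simp: A_def)
    moreover have "a = b e \<oplus> x \<otimes> d e" using db[OF e] x J.Icarr unfolding a by (simp add: m_comm a_comm)
    ultimately show "\<exists>y\<in>J. \<exists>b\<in>A. a = y \<oplus> x \<otimes> b" using db[OF e] by blast
  qed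
  then show ?case using Cons.prems(7,8) by (auto simp: A_def)
qed

text \<open>Kunz's theorem: a generating set \<open>E\<close> of \<open>F\<^sub>*R\<close> of least cardinality is independent modulo \<open>m\<close>, hence
  independent by \<open>comb_coefficients_mem\<close> with \<open>J = JF = 0\<close>. The functions \<open>\<kappa> e\<close> are the coordinates
  with respect to the basis \<open>E\<close>.\<close>

lemma frobenius_free:
  assumes fg: "S \<subseteq> carrier R" "finite S" "submodule_span R (frob_push q R) S = carrier R"
    and xs: "set xs \<subseteq> carrier R" "Idl (set xs) = m" "regular_mod R {\<zero>} xs"
  obtains E \<kappa> where "finite E" "E \<subseteq> carrier R"
    "\<And>e a. e \<in> E \<Longrightarrow> a \<in> carrier R \<Longrightarrow> \<kappa> e a \<in> carrier R"
    "\<And>e a b. e \<in> E \<Longrightarrow> a \<in> carrier R \<Longrightarrow> b \<in> carrier R \<Longrightarrow> \<kappa> e (a \<oplus> b) = \<kappa> e a \<oplus> \<kappa> e b"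
    "\<And>e c a. e \<in> E \<Longrightarrow> c \<in> carrier R \<Longrightarrow> a \<in> carrier R \<Longrightarrow> \<kappa> e (c [^] q \<otimes> a) = c \<otimes> \<kappa> e a"
    "\<And>a. a \<in> carrier R \<Longrightarrow> a = (\<Oplus>e\<in>E. \<kappa> e a [^] q \<otimes> e)"
proof -
  define good where "good n \<longleftrightarrow> (\<exists>E \<subseteq> carrier R. finite E \<and> card E = n \<and> submodule_span R (frob_push q R) E = carrier R)" for n
  have "\<exists>n. good n" using fg by (auto simp: good_def)
  then have "good (LEAST n. good n)" by (rule LeastI_ex)
  then obtain E where E: "E \<subseteq> carrier R" "finite E" "card E = (LEAST n. good n)"
    "submodule_span R (frob_push q R) E = carrier R" unfolding good_def by blast
  have min: "card E \<le> card E'" if "E' \<subseteq> carrier R" "finite E'" "submodule_span R (frob_push q R) E' = carrier R" for E'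
    unfolding E(3) using that by (intro Least_le) (auto simp: good_def)
  interpret m: primeideal m R by (rule prime)
  have xsm: "set xs \<subseteq> m" using genideal_self[OF xs(1)] xs(2) by simp
  have indep: "f e = \<zero>" if f: "f \<in> E \<rightarrow> carrier R" "comb E f = \<zero>" "e \<in> E" for f e
  proof -
    have "f e \<in> {\<zero>}"
    proof (rule comb_coefficients_mem[OF E(1,2) zeroideal zeroideal _ xsm _ _ f(1) _ f(3)])
      show "c [^] q \<in> {\<zero>}" if "c \<in> {\<zero>}" for c using that zero_pow_q by simp
      show "regular_mod R {\<zero>} (map (\<lambda>x. x [^] q) xs)"
        using q_ge_2 by (intro regular_mod_pow[OF zeroideal xs(1,3)]) simp
      show "comb E f \<in> {\<zero>}" using f by simp
      fix g e' assume g: "g \<in> E \<rightarrow> carrier R"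
        "comb E g \<in> Idl ({\<zero>} \<union> (\<lambda>x. x [^] q) ` set xs)" "e' \<in> E"
      have "x [^] q \<in> m_push" if "x \<in> m" for x
      proof -
        have "x [^] q = x [^] q \<otimes> \<one>" using m_carrier[OF that] by simp
        then show ?thesis using m_push_generator[OF that, of \<one>] by simp
      qed
      then have "{\<zero>} \<union> (\<lambda>x. x [^] q) ` set xs \<subseteq> m_push"
        using push.submodule_zero[OF m_push_submodule] xsm by auto
      then have "Idl ({\<zero>} \<union> (\<lambda>x. x [^] q) ` set xs) \<subseteq> m_push"
        by (rule genideal_minimal[OF m_push_ideal])
      then have "g e' \<in> m" using comb_mem_m_push[OF E(1,2,4) min g(1) _ g(3)] g(2) by blast
      moreover have "m \<subseteq> Idl ({\<zero>} \<union> set xs)"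
        using genideal_mono_gen[of "set xs" "{\<zero>} \<union> set xs"] xs by auto
      ultimately show "g e' \<in> Idl ({\<zero>} \<union> set xs)" by blast
    qed
    then show ?thesis by simp
  qed
  have uniq: "f e = g e" if f: "f \<in> E \<rightarrow> carrier R" and g: "g \<in> E \<rightarrow> carrier R"
    and eq: "comb E f = comb E g" and e: "e \<in> E" for f g e
  proof -
    let ?h = "\<lambda>e. f e \<ominus> g e"
    have h: "?h \<in> E \<rightarrow> carrier R" using f g by auto
    have "comb E (\<lambda>e. ?h e \<oplus> g e) = comb E f"
    proof (rule comb_cong[OF E(1), symmetric])
      show "f e = f e \<ominus> g e \<oplus> g e" if "e \<in> E" for e
      proof -
        have "f e \<in> carrier R" "g e \<in> carrier R" using f g that by auto
        then show ?thesis by algebra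
      qed
    qed (rule f)
    then have "comb E ?h \<oplus> comb E g = comb E g" using comb_add[OF E(1) h g] eq by simp
    then have "comb E ?h = \<zero>" using comb_closed[OF E(1) h] comb_closed[OF E(1) g] by simp
    then have "?h e = \<zero>" using indep[OF h _ e] by simp
    then show ?thesis using f g e by (metis PiE r_right_minus_eq)
  qed
  obtain \<phi> where \<phi>: "\<And>a. a \<in> carrier R \<Longrightarrow> \<phi> a \<in> E \<rightarrow> carrier R \<and> comb E (\<phi> a) = a"
    using comb_surj[OF E(1,2,4)] by metis
  show thesis
  proof (rule that[of E "\<lambda>e a. \<phi> a e"])
    show "finite E" "E \<subseteq> carrier R" by (rule E)+
    show "\<phi> a e \<in> carrier R" if "e \<in> E" "a \<in> carrier R" for e a using \<phi>[OF that(2)] that by auto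
    show "\<phi> (a \<oplus> b) e = \<phi> a e \<oplus> \<phi> b e" if "e \<in> E" "a \<in> carrier R" "b \<in> carrier R" for e a b
    proof (rule uniq[OF _ _ _ that(1)])
      show "comb E (\<phi> (a \<oplus> b)) = comb E (\<lambda>e. \<phi> a e \<oplus> \<phi> b e)"
        using \<phi> that comb_add[OF E(1), of "\<phi> a" "\<phi> b"] by simp
    qed (use \<phi> that in \<open>auto simp: Pi_iff\<close>)
    show "\<phi> (c [^] q \<otimes> a) e = c \<otimes> \<phi> a e" if "e \<in> E" "c \<in> carrier R" "a \<in> carrier R" for e c a
    proof (rule uniq[OF _ _ _ that(1)])
      show "comb E (\<phi> (c [^] q \<otimes> a)) = comb E (\<lambda>e. c \<otimes> \<phi> a e)"
        using \<phi> that comb_smult[OF E(1,2), of "\<phi> a" c] by simp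
    qed (use \<phi> that in \<open>auto simp: Pi_iff\<close>)
    show "a = (\<Oplus>e\<in>E. \<phi> a e [^] q \<otimes> e)" if "a \<in> carrier R" for a
      using \<phi>[OF that] by (simp add: comb_def)
  qed
qed

end

section \<open>Coordinates on a unit module\<close>

locale RF_mod = module R M for R (structure) and M (structure) +
  fixes p e :: nat and \<theta> :: "('a \<times> 'c \<Rightarrow>\<^sub>0 int) set \<Rightarrow> 'c"
  assumes linear: "\<theta> \<in> linear_maps R (frob_pullback p e R M) M"
begin

text \<open>The presentation of \<open>R\<^sup>e \<otimes> M\<close>; \<open>scale r\<close> lifts multiplication by \<open>r\<close> to the free group.\<close>

abbreviation "free \<equiv> free_Abelian_group (carrier R \<times> carrier M)"
abbreviation "rels \<equiv> tensor_relations (frob_right p e R) R (regular_module R) M"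
abbreviation "ker \<equiv> tensor_kernel (frob_right p e R) R (regular_module R) M"
abbreviation "cls x \<equiv> ker #>\<^bsub>free\<^esub> x"
abbreviation "act \<equiv> frob_act p e R M \<theta>"
abbreviation "scale r \<equiv> frag_extend (\<lambda>(b, m). frag_of (r \<otimes> b, m))"

lemma free_add: "x \<in> carrier free \<Longrightarrow> y \<in> carrier free \<Longrightarrow> x + y \<in> carrier free"
  using keys_add[of x y] by auto

lemma free_diff: "x \<in> carrier free \<Longrightarrow> y \<in> carrier free \<Longrightarrow> x - y \<in> carrier free"
  using keys_diff[of x y] by auto

lemma free_of: "b \<in> carrier R \<Longrightarrow> m \<in> carrier M \<Longrightarrow> frag_of (b, m) \<in> carrier free"
  by simp

lemma rels_cases:
  assumes "x \<in> rels"
  obtains (left) b b' m where "b \<in> carrier R" "b' \<in> carrier R" "m \<in> carrier M"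
      "x = frag_of (b \<oplus> b', m) - frag_of (b, m) - frag_of (b', m)"
  | (right) b m m' where "b \<in> carrier R" "m \<in> carrier M" "m' \<in> carrier M"
      "x = frag_of (b, m \<oplus>\<^bsub>M\<^esub> m') - frag_of (b, m) - frag_of (b, m')"
  | (middle) b r m where "b \<in> carrier R" "r \<in> carrier R" "m \<in> carrier M"
      "x = frag_of ((r [^] (p ^ e)) \<otimes> b, m) - frag_of (b, r \<odot>\<^bsub>M\<^esub> m)"
  using assms unfolding tensor_relations_def frob_right_def by auto

lemma rels_subset: "rels \<subseteq> carrier free"
proof
  fix x assume "x \<in> rels"
  then show "x \<in> carrier free"
    by (cases rule: rels_cases) (auto simp del: carrier_free_Abelian_group_iff intro!: free_diff free_of)
qed

lemma ker_subgroup: "subgroup ker free"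
  unfolding tensor_kernel_def regular_module_simps by (rule group.generate_is_subgroup[OF group_free_Abelian_group rels_subset])

lemma ker_subset: "ker \<subseteq> carrier free"
  by (rule subgroup.subset[OF ker_subgroup])

lemma rels_ker: "rels \<subseteq> ker"
  unfolding tensor_kernel_def regular_module_simps by (auto intro: generate.incl)

lemma ker_add: "x \<in> ker \<Longrightarrow> y \<in> ker \<Longrightarrow> x + y \<in> ker"
  using subgroup.m_closed[OF ker_subgroup] by simp

lemma ker_uminus: "x \<in> ker \<Longrightarrow> - x \<in> ker"
  using subgroup.m_inv_closed[OF ker_subgroup] ker_subset by fastforce

lemma ker_zero: "0 \<in> ker"
  using subgroup.one_closed[OF ker_subgroup] by simp

lemma ker_normal: "ker \<lhd> free"
  by (rule comm_group.subgroup_imp_normal[OF abelian_free_Abelian_group ker_subgroup])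

lemma cls_mem_iff: "y \<in> cls x \<longleftrightarrow> y - x \<in> ker"
  unfolding r_coset_def by (auto simp: algebra_simps intro!: bexI[of _ "y - x"])

lemma cls_eq_iff: "cls x = cls y \<longleftrightarrow> x - y \<in> ker"
proof
  have "x \<in> cls x" by (simp add: cls_mem_iff ker_zero)
  moreover assume "cls x = cls y"
  ultimately show "x - y \<in> ker" by (simp add: cls_mem_iff)
next
  assume xy: "x - y \<in> ker"
  have "z - x \<in> ker \<longleftrightarrow> z - y \<in> ker" for z
    using ker_add[OF _ xy, of "z - x"] ker_add[OF _ ker_uminus[OF xy], of "z - y"] by auto
  then show "cls x = cls y" by (auto simp: cls_mem_iff)
qed

lemma hom_kills_ker:
  assumes H: "group H" and h: "h \<in> hom free H" and rel: "\<And>x. x \<in> rels \<Longrightarrow> h x = \<one>\<^bsub>H\<^esub>"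
    and x: "x \<in> ker"
  shows "h x = \<one>\<^bsub>H\<^esub>"
proof -
  interpret group_hom free H h
    using H h by (simp add: group_hom_def group_hom_axioms_def)
  have "ker \<subseteq> kernel free H h"
    unfolding tensor_kernel_def regular_module_simps
  proof (rule group.generate_subgroup_incl[OF group_free_Abelian_group _ subgroup_kernel])
    show "rels \<subseteq> kernel free H h" using rel rels_subset by (auto simp: kernel_def simp del: carrier_free_Abelian_group_iff)
  qed
  then show ?thesis using x by (auto simp: kernel_def)
qed

lemma scale_free: "r \<in> carrier R \<Longrightarrow> x \<in> carrier free \<Longrightarrow> scale r x \<in> carrier free"
proof -
  assume r: "r \<in> carrier R" and "x \<in> carrier free"
  then have "Poly_Mapping.keys x \<subseteq> carrier R \<times> carrier M" by simp
  then show ?thesis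
  proof (induction rule: frag_induction)
    case (one x)
    then show ?case using r by auto
  next
    case (diff a b)
    then show ?case using free_diff by (simp add: frag_extend_diff)
  qed simp
qed

lemma scale_hom: "r \<in> carrier R \<Longrightarrow> scale r \<in> hom free free"
  using scale_free by (intro homI) (auto simp: frag_extend_add)

text \<open>The relations are stable under scaling. Hence all representatives of a class give the same
  product with a scalar, and the union in the definition of scalar multiplication is a single class.\<close>

lemma scale_ker:
  assumes r: "r \<in> carrier R" and x: "x \<in> ker"
  shows "scale r x \<in> ker"
proof -
  interpret group_hom free free "scale r"
    using scale_hom[OF r] by (simp add: group_hom_def group_hom_axioms_def)
  let ?N = "{x \<in> carrier free. scale r x \<in> ker}"
  have "subgroup ?N free"
  proof (rule group.subgroupI[OF group_free_Abelian_group])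
    show "?N \<noteq> {}" using ker_zero by (auto intro!: exI[of _ 0])
    show "inv\<^bsub>free\<^esub> a \<in> ?N" if "a \<in> ?N" for a
      using that ker_uminus by (simp add: frag_extend_minus)
    show "a \<otimes>\<^bsub>free\<^esub> b \<in> ?N" if "a \<in> ?N" "b \<in> ?N" for a b
      using that free_add[of a b] ker_add by (simp add: frag_extend_add)
  qed auto
  moreover have "rels \<subseteq> ?N"
  proof
    fix y assume y: "y \<in> rels"
    then have "scale r y \<in> rels"
    proof (cases rule: rels_cases)
      case (left b b' m)
      have "scale r y = frag_of (r \<otimes> b \<oplus> r \<otimes> b', m) - frag_of (r \<otimes> b, m) - frag_of (r \<otimes> b', m)"
        unfolding left using r left by (simp add: frag_extend_diff r_distr)
      then show ?thesis unfolding tensor_relations_def using r left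
        by (intro UnI1 CollectI exI[of _ "r \<otimes> b"] exI[of _ "r \<otimes> b'"] exI[of _ m]) auto
    next
      case (right b m m')
      have "scale r y = frag_of (r \<otimes> b, m \<oplus>\<^bsub>M\<^esub> m') - frag_of (r \<otimes> b, m) - frag_of (r \<otimes> b, m')"
        unfolding right by (simp add: frag_extend_diff)
      then show ?thesis unfolding tensor_relations_def using r right
        by (intro UnI1 UnI2[of _ _ _] CollectI exI[of _ "r \<otimes> b"] exI[of _ m] exI[of _ m']) auto
    next
      case (middle b s m)
      have "r \<otimes> (s [^] (p ^ e) \<otimes> b) = frob_right p e R (r \<otimes> b) s"
        unfolding frob_right_def using r middle by (simp add: m_ac)
      then have "scale r y = frag_of (frob_right p e R (r \<otimes> b) s, m) - frag_of (r \<otimes> b, s \<odot>\<^bsub>M\<^esub> m)"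
        unfolding middle by (simp add: frag_extend_diff)
      then show ?thesis unfolding tensor_relations_def using r middle
        by (intro UnI2 CollectI exI[of _ "r \<otimes> b"] exI[of _ s] exI[of _ m]) auto
    qed
    then show "y \<in> ?N" using y rels_subset rels_ker by blast
  qed
  ultimately have "ker \<subseteq> ?N"
    unfolding tensor_kernel_def regular_module_simps using group.generate_subgroup_incl[OF group_free_Abelian_group] by blast
  then show ?thesis using x by blast
qed

lemma pullback_carrier: "carrier (frob_pullback p e R M) = cls ` carrier free"
  by (auto simp: frob_pullback_def tensor_product_def Let_def FactGroup_def RCOSETS_def simp del: carrier_free_Abelian_group_iff)

lemma pullback_add:
  assumes "x \<in> carrier free" "y \<in> carrier free"
  shows "cls x \<oplus>\<^bsub>frob_pullback p e R M\<^esub> cls y = cls (x + y)"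
  using normal.rcos_sum[OF ker_normal assms]
  by (simp add: frob_pullback_def tensor_product_def Let_def FactGroup_def)

lemma pullback_smult:
  assumes r: "r \<in> carrier R" and x: "x \<in> carrier free"
  shows "r \<odot>\<^bsub>frob_pullback p e R M\<^esub> cls x = cls (scale r x)"
proof -
  have "cls (scale r y) = cls (scale r x)" if "y \<in> cls x" for y
    using scale_ker[OF r] that by (simp add: cls_eq_iff cls_mem_iff flip: frag_extend_diff)
  moreover have "x \<in> cls x" by (simp add: cls_mem_iff ker_zero)
  ultimately have "(\<Union>y\<in>cls x. cls (scale r y)) = cls (scale r x)" by blast
  then show ?thesis by (simp add: frob_pullback_def tensor_product_def Let_def)
qed

lemma theta_closed: "x \<in> carrier free \<Longrightarrow> \<theta> (cls x) \<in> carrier M"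
  using linear unfolding linear_maps_def pullback_carrier by blast

lemma theta_add: "x \<in> carrier free \<Longrightarrow> y \<in> carrier free \<Longrightarrow> \<theta> (cls (x + y)) = \<theta> (cls x) \<oplus>\<^bsub>M\<^esub> \<theta> (cls y)"
  using linear unfolding linear_maps_def pullback_carrier by (auto simp: pullback_add simp del: carrier_free_Abelian_group_iff)

lemma theta_smult: "r \<in> carrier R \<Longrightarrow> x \<in> carrier free \<Longrightarrow> \<theta> (cls (scale r x)) = r \<odot>\<^bsub>M\<^esub> \<theta> (cls x)"
  using linear unfolding linear_maps_def pullback_carrier by (auto simp: pullback_smult simp del: carrier_free_Abelian_group_iff)

lemma act_eq: "act m = \<theta> (cls (frag_of (\<one>, m)))"
  by (simp add: frob_act_def pure_tensor_def)

lemma act_closed: "m \<in> carrier M \<Longrightarrow> act m \<in> carrier M"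
  unfolding act_eq by (rule theta_closed) simp

lemma theta_pure: "r \<in> carrier R \<Longrightarrow> m \<in> carrier M \<Longrightarrow> \<theta> (cls (frag_of (r, m))) = r \<odot>\<^bsub>M\<^esub> act m"
  using theta_smult[of r "frag_of (\<one>, m)"] by (simp add: act_eq)

lemma act_add:
  assumes m: "m \<in> carrier M" "m' \<in> carrier M"
  shows "act (m \<oplus>\<^bsub>M\<^esub> m') = act m \<oplus>\<^bsub>M\<^esub> act m'"
proof -
  have "frag_of (\<one>, m \<oplus>\<^bsub>M\<^esub> m') - frag_of (\<one>, m) - frag_of (\<one>, m') \<in> rels"
    unfolding tensor_relations_def using m
    by (intro UnI1 UnI2 CollectI exI[of _ "\<one>"] exI[of _ m] exI[of _ m']) auto
  then have "cls (frag_of (\<one>, m \<oplus>\<^bsub>M\<^esub> m')) = cls (frag_of (\<one>, m) + frag_of (\<one>, m'))"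
    using rels_ker by (auto simp: cls_eq_iff diff_diff_add)
  then show ?thesis using theta_add[of "frag_of (\<one>, m)" "frag_of (\<one>, m')"] m by (simp add: act_eq)
qed

lemma act_smult:
  assumes r: "r \<in> carrier R" and m: "m \<in> carrier M"
  shows "act (r \<odot>\<^bsub>M\<^esub> m) = r [^] (p ^ e) \<odot>\<^bsub>M\<^esub> act m"
proof -
  have "frag_of (frob_right p e R \<one> r, m) - frag_of (\<one>, r \<odot>\<^bsub>M\<^esub> m) \<in> rels"
    unfolding tensor_relations_def using r m
    by (intro UnI2 CollectI exI[of _ "\<one>"] exI[of _ r] exI[of _ m]) auto
  then have "cls (frag_of (r [^] (p ^ e), m)) = cls (frag_of (\<one>, r \<odot>\<^bsub>M\<^esub> m))"
    using rels_ker r by (auto simp: cls_eq_iff frob_right_def)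
  then show ?thesis using theta_pure[of "r [^] (p ^ e)" m] r m by (simp add: act_eq)
qed

lemma theta_zero: "\<theta> (cls 0) = \<zero>\<^bsub>M\<^esub>"
proof -
  have "\<theta> (cls 0) = \<theta> (cls 0) \<oplus>\<^bsub>M\<^esub> \<theta> (cls 0)" using theta_add[of 0 0] by simp
  then show ?thesis using theta_closed[of 0] by simp
qed

text \<open>Every element of the tensor product is a sum of terms \<open>\<plusminus> r \<otimes> m\<close>, so it suffices that
  \<open>\<theta>(r \<otimes> m) = r F(m)\<close> lies in \<open>N\<close>.\<close>

lemma span_act:
  assumes surj: "carrier M \<subseteq> \<theta> ` carrier (frob_pullback p e R M)"
    and N: "submodule N R M" and act: "\<And>m. m \<in> carrier M \<Longrightarrow> act m \<in> N"
  shows "N = carrier M"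
proof -
  have "x \<in> carrier free \<and> \<theta> (cls x) \<in> N \<and> \<theta> (cls (- x)) \<in> N" if "Poly_Mapping.keys x \<subseteq> carrier R \<times> carrier M" for x
    using that
  proof (induction rule: frag_induction)
    case zero
    then show ?case using theta_zero submodule_zero[OF N] by simp
  next
    case (one x)
    then obtain r m where x: "x = (r, m)" and rm: "r \<in> carrier R" "m \<in> carrier M" by auto
    have 1: "\<theta> (cls (frag_of x)) \<in> N" unfolding x using rm act submodule_smult[OF N] by (simp add: theta_pure)
    have f: "frag_of x \<in> carrier free" "- frag_of x \<in> carrier free" using x rm by auto
    have "\<theta> (cls (- frag_of x)) \<oplus>\<^bsub>M\<^esub> \<theta> (cls (frag_of x)) \<in> N"
      using theta_add[OF f(2,1)] theta_zero submodule_zero[OF N] by simp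
    then have "\<theta> (cls (- frag_of x)) \<in> N" by (rule submodule_add_cancel[OF N _ 1 theta_closed[OF f(2)]])
    then show ?case using 1 f(1) by blast
  next
    case (diff a b)
    have f: "a \<in> carrier free" "b \<in> carrier free" "- a \<in> carrier free" "- b \<in> carrier free"
      using diff by simp_all
    have "\<theta> (cls (a - b)) = \<theta> (cls a) \<oplus>\<^bsub>M\<^esub> \<theta> (cls (- b))" using theta_add[OF f(1,4)] by simp
    moreover have "\<theta> (cls (- (a - b))) = \<theta> (cls (- a)) \<oplus>\<^bsub>M\<^esub> \<theta> (cls b)" using theta_add[OF f(3,2)] by simp
    ultimately show ?case using diff submodule_add[OF N] free_diff[OF f(1,2)] by simp
  qed
  then have "carrier M \<subseteq> N" using surj unfolding pullback_carrier by auto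
  then show ?thesis using submodule_subset[OF N] by blast
qed

text \<open>An additive map \<open>\<kappa> : R \<rightarrow> R\<close> that is inverse-Frobenius linear induces
  \<open>r \<otimes> m \<mapsto> \<kappa>(r) m\<close> on \<open>R\<^sup>e \<otimes> M\<close>, and transporting it through the bijection \<open>\<theta>\<close> gives a map on \<open>M\<close>.\<close>

lemma coordinate_map:
  assumes bij: "bij_betw \<theta> (carrier (frob_pullback p e R M)) (carrier M)"
    and \<kappa>: "\<And>a. a \<in> carrier R \<Longrightarrow> \<kappa> a \<in> carrier R"
      "\<And>a b. a \<in> carrier R \<Longrightarrow> b \<in> carrier R \<Longrightarrow> \<kappa> (a \<oplus> b) = \<kappa> a \<oplus> \<kappa> b"
      "\<And>c a. c \<in> carrier R \<Longrightarrow> a \<in> carrier R \<Longrightarrow> \<kappa> (c [^] (p ^ e) \<otimes> a) = c \<otimes> \<kappa> a"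
  obtains \<pi> where "\<And>m. m \<in> carrier M \<Longrightarrow> \<pi> m \<in> carrier M"
    "\<And>m n. m \<in> carrier M \<Longrightarrow> n \<in> carrier M \<Longrightarrow> \<pi> (m \<oplus>\<^bsub>M\<^esub> n) = \<pi> m \<oplus>\<^bsub>M\<^esub> \<pi> n"
    "\<And>r m. r \<in> carrier R \<Longrightarrow> m \<in> carrier M \<Longrightarrow> \<pi> (r \<odot>\<^bsub>M\<^esub> act m) = \<kappa> r \<odot>\<^bsub>M\<^esub> m"
proof -
  let ?A = "add_monoid M"
  have comm: "comm_group ?A" by (rule M.a_comm_group)
  then have grp: "group ?A" by (rule comm_group.axioms(2))
  have "(\<lambda>(r, m). \<kappa> r \<odot>\<^bsub>M\<^esub> m) ` (carrier R \<times> carrier M) \<subseteq> carrier ?A" using \<kappa>(1) by auto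
  then obtain h where h: "h \<in> hom free ?A"
    and "\<And>x. x \<in> carrier R \<times> carrier M \<Longrightarrow> h (frag_of x) = (\<lambda>(r, m). \<kappa> r \<odot>\<^bsub>M\<^esub> m) x"
    using comm_group.free_Abelian_group_universal[OF comm] by metis
  then have h_of: "h (frag_of (r, m)) = \<kappa> r \<odot>\<^bsub>M\<^esub> m" if "r \<in> carrier R" "m \<in> carrier M" for r m
    using that by auto
  have h_closed: "h x \<in> carrier M" if "x \<in> carrier free" for x using hom_in_carrier[OF h that] by simp
  have h_add: "h (x + y) = h x \<oplus>\<^bsub>M\<^esub> h y" if "x \<in> carrier free" "y \<in> carrier free" for x y
    using hom_mult[OF h that] by simp
  have h_rel: "h x = \<zero>\<^bsub>M\<^esub>" if x: "x \<in> rels" for x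
  proof -
    \<comment> \<open>Each relation has the form \<open>u - v\<close> with \<open>h u = h v\<close>.\<close>
    have *: "h (u - v) = \<zero>\<^bsub>M\<^esub>" if uv: "u \<in> carrier free" "v \<in> carrier free" "h u = h v" for u v
    proof -
      have "h u = h (u - v) \<oplus>\<^bsub>M\<^esub> h v" using h_add[OF free_diff[OF uv(1,2)] uv(2)] by simp
      then show ?thesis using uv(3) h_closed[OF uv(2)] h_closed[OF free_diff[OF uv(1,2)]] by simp
    qed
    from x show ?thesis
    proof (cases rule: rels_cases)
      case (left b b' m)
      let ?v = "frag_of (b, m) + frag_of (b', m)"
      have f: "frag_of (b, m) \<in> carrier free" "frag_of (b', m) \<in> carrier free" "frag_of (b \<oplus> b', m) \<in> carrier free"
        using left by simp_all
      have "h (frag_of (b \<oplus> b', m) - ?v) = \<zero>\<^bsub>M\<^esub>"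
        using left \<kappa>(1) by (intro * f free_add) (simp add: h_add[OF f(1,2)] h_of \<kappa>(2) smult_l_distr)
      then show ?thesis unfolding left(4) by (simp add: diff_diff_add)
    next
      case (right b m m')
      let ?v = "frag_of (b, m) + frag_of (b, m')"
      have f: "frag_of (b, m) \<in> carrier free" "frag_of (b, m') \<in> carrier free" "frag_of (b, m \<oplus>\<^bsub>M\<^esub> m') \<in> carrier free"
        using right by simp_all
      have "h (frag_of (b, m \<oplus>\<^bsub>M\<^esub> m') - ?v) = \<zero>\<^bsub>M\<^esub>"
        using right \<kappa>(1) by (intro * f free_add) (simp add: h_add[OF f(1,2)] h_of smult_r_distr)
      then show ?thesis unfolding right(4) by (simp add: diff_diff_add)
    next
      case (middle b r m)
      have "h (frag_of (r [^] (p ^ e) \<otimes> b, m)) = h (frag_of (b, r \<odot>\<^bsub>M\<^esub> m))"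
        using middle \<kappa>(1)[OF middle(1)]
        by (simp add: h_of \<kappa>(3) m_comm[of r "\<kappa> b"] smult_assoc1)
      then show ?thesis unfolding middle(4) using middle by (intro *) auto
    qed
  qed
  have h_ker: "h x = \<zero>\<^bsub>M\<^esub>" if "x \<in> ker" for x
    using hom_kills_ker[OF grp h _ that] h_rel by simp
  have h_cls: "h x = h y" if xy: "x \<in> carrier free" "y \<in> carrier free" "\<theta> (cls x) = \<theta> (cls y)" for x y
  proof -
    have "cls x = cls y"
      using bij xy unfolding bij_betw_def inj_on_def pullback_carrier by blast
    then have "h (x - y) = \<zero>\<^bsub>M\<^esub>" by (simp add: cls_eq_iff h_ker)
    moreover have "h x = h (x - y) \<oplus>\<^bsub>M\<^esub> h y" using h_add[OF free_diff[OF xy(1,2)] xy(2)] by simp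
    ultimately show ?thesis using h_closed[OF xy(2)] by simp
  qed
  have img: "\<theta> ` (\<lambda>x. cls x) ` carrier free = carrier M"
    using bij by (simp only: bij_betw_def pullback_carrier)
  have "\<exists>x. x \<in> carrier free \<and> \<theta> (cls x) = m" if "m \<in> carrier M" for m
  proof -
    have "m \<in> \<theta> ` (\<lambda>x. cls x) ` carrier free" using that img by simp
    then show ?thesis by (auto simp del: carrier_free_Abelian_group_iff)
  qed
  then obtain rep where rep: "\<And>m. m \<in> carrier M \<Longrightarrow> rep m \<in> carrier free \<and> \<theta> (cls (rep m)) = m" by metis
  show thesis
  proof (rule that[of "\<lambda>m. h (rep m)"])
    show "h (rep m) \<in> carrier M" if "m \<in> carrier M" for m using rep[OF that] h_closed by blast
    show "h (rep (m \<oplus>\<^bsub>M\<^esub> n)) = h (rep m) \<oplus>\<^bsub>M\<^esub> h (rep n)" if "m \<in> carrier M" "n \<in> carrier M" for m n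
    proof -
      have r: "rep m \<in> carrier free" "rep n \<in> carrier free" "rep (m \<oplus>\<^bsub>M\<^esub> n) \<in> carrier free"
        using rep that by blast+
      have "\<theta> (cls (rep (m \<oplus>\<^bsub>M\<^esub> n))) = \<theta> (cls (rep m + rep n))"
        using theta_add[OF r(1,2)] rep that by simp
      then have "h (rep (m \<oplus>\<^bsub>M\<^esub> n)) = h (rep m + rep n)" by (rule h_cls[OF r(3) free_add[OF r(1,2)]])
      then show ?thesis using h_add[OF r(1,2)] by simp
    qed
    show "h (rep (r \<odot>\<^bsub>M\<^esub> act m)) = \<kappa> r \<odot>\<^bsub>M\<^esub> m" if "r \<in> carrier R" "m \<in> carrier M" for r m
    proof -
      have c: "r \<odot>\<^bsub>M\<^esub> act m \<in> carrier M" using that act_closed by simp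
      have "h (rep (r \<odot>\<^bsub>M\<^esub> act m)) = h (frag_of (r, m))"
        using rep[OF c] theta_pure[OF that] free_of[OF that] by (intro h_cls) auto
      then show ?thesis using h_of[OF that] by simp
    qed
  qed
qed

end

section \<open>Roots\<close>

lemma (in module) finsum_smult_rdistr:
  assumes "finite A" "f \<in> A \<rightarrow> carrier R" "x \<in> carrier M"
  shows "(\<Oplus>\<^bsub>M\<^esub>i\<in>A. f i \<odot>\<^bsub>M\<^esub> x) = (\<Oplus>i\<in>A. f i) \<odot>\<^bsub>M\<^esub> x"
  using assms
proof (induction A)
  case (insert a A)
  then show ?case by (simp add: Pi_def smult_l_distr R.finsum_closed)
qed simp

locale unit_coordinates = RF_mod R M p e \<theta>
  for R (structure) and M (structure) and p e :: nat and \<theta> +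
  fixes m :: "'a set" and E :: "'a set" and \<kappa> :: "'a \<Rightarrow> 'a \<Rightarrow> 'a" and \<pi> :: "'a \<Rightarrow> 'c \<Rightarrow> 'c"
  assumes local: "noetherian_local_ring R m"
    and q_ge_2: "p ^ e \<ge> 2"
    and surj: "carrier M \<subseteq> \<theta> ` carrier (frob_pullback p e R M)"
    and E: "finite E" "E \<subseteq> carrier R"
    and \<kappa>_closed: "\<And>i a. i \<in> E \<Longrightarrow> a \<in> carrier R \<Longrightarrow> \<kappa> i a \<in> carrier R"
    and \<kappa>_pow: "\<And>i c a. i \<in> E \<Longrightarrow> c \<in> carrier R \<Longrightarrow> a \<in> carrier R \<Longrightarrow> \<kappa> i (c [^] (p ^ e) \<otimes> a) = c \<otimes> \<kappa> i a"
    and \<kappa>_sum: "\<And>a. a \<in> carrier R \<Longrightarrow> a = (\<Oplus>i\<in>E. \<kappa> i a [^] (p ^ e) \<otimes> i)"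
    and \<pi>_closed: "\<And>i a. i \<in> E \<Longrightarrow> a \<in> carrier M \<Longrightarrow> \<pi> i a \<in> carrier M"
    and \<pi>_add: "\<And>i a b. i \<in> E \<Longrightarrow> a \<in> carrier M \<Longrightarrow> b \<in> carrier M \<Longrightarrow> \<pi> i (a \<oplus>\<^bsub>M\<^esub> b) = \<pi> i a \<oplus>\<^bsub>M\<^esub> \<pi> i b"
    and \<pi>_act: "\<And>i r a. i \<in> E \<Longrightarrow> r \<in> carrier R \<Longrightarrow> a \<in> carrier M \<Longrightarrow> \<pi> i (r \<odot>\<^bsub>M\<^esub> act a) = \<kappa> i r \<odot>\<^bsub>M\<^esub> a"
begin

interpretation local: noetherian_local_ring R m by (rule local)

lemma \<pi>_zero: "i \<in> E \<Longrightarrow> \<pi> i \<zero>\<^bsub>M\<^esub> = \<zero>\<^bsub>M\<^esub>"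
  using \<pi>_add[of i "\<zero>\<^bsub>M\<^esub>" "\<zero>\<^bsub>M\<^esub>"] \<pi>_closed[of i "\<zero>\<^bsub>M\<^esub>"] by simp

lemma act_zero: "act \<zero>\<^bsub>M\<^esub> = \<zero>\<^bsub>M\<^esub>"
  using act_add[of "\<zero>\<^bsub>M\<^esub>" "\<zero>\<^bsub>M\<^esub>"] act_closed[of "\<zero>\<^bsub>M\<^esub>"] by simp

text \<open>Both sides are additive in \<open>a\<close> and agree on the elements \<open>r F(x)\<close>, which generate \<open>M\<close> additively. The
  quantifier over \<open>r\<close> in the proof turns this additive statement into one about a submodule.\<close>

lemma \<pi>_pow_smult:
  assumes i: "i \<in> E" and c: "c \<in> carrier R" and a: "a \<in> carrier M"
  shows "\<pi> i (c [^] (p ^ e) \<odot>\<^bsub>M\<^esub> a) = c \<odot>\<^bsub>M\<^esub> \<pi> i a"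
proof -
  let ?N = "{a \<in> carrier M. \<forall>r \<in> carrier R. \<pi> i (c [^] (p ^ e) \<odot>\<^bsub>M\<^esub> (r \<odot>\<^bsub>M\<^esub> a)) = c \<odot>\<^bsub>M\<^esub> \<pi> i (r \<odot>\<^bsub>M\<^esub> a)}"
  have cq: "c [^] (p ^ e) \<in> carrier R" using c by simp
  have "submodule ?N R M"
  proof (rule submoduleI_linear)
    show "\<zero>\<^bsub>M\<^esub> \<in> ?N" using cq c \<pi>_zero[OF i] by simp
    show "a \<oplus>\<^bsub>M\<^esub> b \<in> ?N" if "a \<in> ?N" "b \<in> ?N" for a b
      using that c cq i by (simp add: smult_r_distr \<pi>_add \<pi>_closed)
    show "s \<odot>\<^bsub>M\<^esub> a \<in> ?N" if "s \<in> carrier R" "a \<in> ?N" for s a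
      using that by (simp add: smult_assoc1[symmetric] del: smult_assoc1)
  qed auto
  moreover have "act x \<in> ?N" if x: "x \<in> carrier M" for x
  proof -
    have "\<pi> i (c [^] (p ^ e) \<odot>\<^bsub>M\<^esub> (r \<odot>\<^bsub>M\<^esub> act x)) = c \<odot>\<^bsub>M\<^esub> \<pi> i (r \<odot>\<^bsub>M\<^esub> act x)" if r: "r \<in> carrier R" for r
    proof -
      have "c [^] (p ^ e) \<odot>\<^bsub>M\<^esub> (r \<odot>\<^bsub>M\<^esub> act x) = (c [^] (p ^ e) \<otimes> r) \<odot>\<^bsub>M\<^esub> act x"
        using r cq act_closed[OF x] by (simp add: smult_assoc1)
      then show ?thesis using r c cq x i by (simp add: \<pi>_act \<kappa>_pow \<kappa>_closed smult_assoc1)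
    qed
    then show ?thesis using act_closed[OF x] by simp
  qed
  ultimately have "?N = carrier M" by (rule span_act[OF surj])
  then have "\<pi> i (c [^] (p ^ e) \<odot>\<^bsub>M\<^esub> (\<one> \<odot>\<^bsub>M\<^esub> a)) = c \<odot>\<^bsub>M\<^esub> \<pi> i (\<one> \<odot>\<^bsub>M\<^esub> a)" using a R.one_closed by blast
  then show ?thesis using a by simp
qed

text \<open>For \<open>a = r F(x)\<close> this is the expansion of \<open>r\<close> in the basis \<open>E\<close>, multiplied by \<open>F(x)\<close>.\<close>

lemma \<pi>_expansion:
  assumes a: "a \<in> carrier M"
  shows "a = (\<Oplus>\<^bsub>M\<^esub>i\<in>E. i \<odot>\<^bsub>M\<^esub> act (\<pi> i a))"
proof -
  let ?N = "{a \<in> carrier M. \<forall>r \<in> carrier R. r \<odot>\<^bsub>M\<^esub> a = (\<Oplus>\<^bsub>M\<^esub>i\<in>E. i \<odot>\<^bsub>M\<^esub> act (\<pi> i (r \<odot>\<^bsub>M\<^esub> a)))}"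
  have Ec: "i \<in> carrier R" if "i \<in> E" for i using that E by blast
  have "submodule ?N R M"
  proof (rule submoduleI_linear)
    have "(\<Oplus>\<^bsub>M\<^esub>i\<in>E. i \<odot>\<^bsub>M\<^esub> act (\<pi> i \<zero>\<^bsub>M\<^esub>)) = (\<Oplus>\<^bsub>M\<^esub>i\<in>E. \<zero>\<^bsub>M\<^esub>)"
      by (rule M.finsum_cong') (use Ec in \<open>auto simp: \<pi>_zero act_zero\<close>)
    then show "\<zero>\<^bsub>M\<^esub> \<in> ?N" by simp
    show "a \<oplus>\<^bsub>M\<^esub> b \<in> ?N" if ab: "a \<in> ?N" "b \<in> ?N" for a b
    proof -
      have "r \<odot>\<^bsub>M\<^esub> (a \<oplus>\<^bsub>M\<^esub> b) = (\<Oplus>\<^bsub>M\<^esub>i\<in>E. i \<odot>\<^bsub>M\<^esub> act (\<pi> i (r \<odot>\<^bsub>M\<^esub> (a \<oplus>\<^bsub>M\<^esub> b))))" if r: "r \<in> carrier R" for r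
      proof -
        have c: "r \<odot>\<^bsub>M\<^esub> a \<in> carrier M" "r \<odot>\<^bsub>M\<^esub> b \<in> carrier M" using ab r by auto
        have "(\<Oplus>\<^bsub>M\<^esub>i\<in>E. i \<odot>\<^bsub>M\<^esub> act (\<pi> i (r \<odot>\<^bsub>M\<^esub> (a \<oplus>\<^bsub>M\<^esub> b))))
          = (\<Oplus>\<^bsub>M\<^esub>i\<in>E. i \<odot>\<^bsub>M\<^esub> act (\<pi> i (r \<odot>\<^bsub>M\<^esub> a)) \<oplus>\<^bsub>M\<^esub> i \<odot>\<^bsub>M\<^esub> act (\<pi> i (r \<odot>\<^bsub>M\<^esub> b)))"
          using ab r c Ec
          by (intro M.finsum_cong') (auto simp: smult_r_distr \<pi>_add act_add \<pi>_closed act_closed)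
        also have "\<dots> = (\<Oplus>\<^bsub>M\<^esub>i\<in>E. i \<odot>\<^bsub>M\<^esub> act (\<pi> i (r \<odot>\<^bsub>M\<^esub> a))) \<oplus>\<^bsub>M\<^esub> (\<Oplus>\<^bsub>M\<^esub>i\<in>E. i \<odot>\<^bsub>M\<^esub> act (\<pi> i (r \<odot>\<^bsub>M\<^esub> b)))"
          using c Ec by (intro M.finsum_addf) (auto simp: \<pi>_closed act_closed)
        also have "\<dots> = r \<odot>\<^bsub>M\<^esub> a \<oplus>\<^bsub>M\<^esub> r \<odot>\<^bsub>M\<^esub> b" using ab r by auto
        finally show ?thesis using ab r by (simp add: smult_r_distr)
      qed
      then show ?thesis using ab by auto
    qed
    show "s \<odot>\<^bsub>M\<^esub> a \<in> ?N" if "s \<in> carrier R" "a \<in> ?N" for s a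
      using that by (simp add: smult_assoc1[symmetric] del: smult_assoc1)
  qed auto
  moreover have "act x \<in> ?N" if x: "x \<in> carrier M" for x
  proof -
    have "r \<odot>\<^bsub>M\<^esub> act x = (\<Oplus>\<^bsub>M\<^esub>i\<in>E. i \<odot>\<^bsub>M\<^esub> act (\<pi> i (r \<odot>\<^bsub>M\<^esub> act x)))" if r: "r \<in> carrier R" for r
    proof -
      have "(\<Oplus>\<^bsub>M\<^esub>i\<in>E. i \<odot>\<^bsub>M\<^esub> act (\<pi> i (r \<odot>\<^bsub>M\<^esub> act x))) = (\<Oplus>\<^bsub>M\<^esub>i\<in>E. (\<kappa> i r [^] (p ^ e) \<otimes> i) \<odot>\<^bsub>M\<^esub> act x)"
      proof (rule M.finsum_cong')
        fix i assume i: "i \<in> E"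
        have "\<kappa> i r \<in> carrier R" by (rule \<kappa>_closed[OF i r])
        then show "i \<odot>\<^bsub>M\<^esub> act (\<pi> i (r \<odot>\<^bsub>M\<^esub> act x)) = (\<kappa> i r [^] (p ^ e) \<otimes> i) \<odot>\<^bsub>M\<^esub> act x"
          using Ec[OF i] act_closed[OF x] by (simp add: \<pi>_act[OF i r x] act_smult[OF _ x] smult_assoc1[symmetric] R.m_comm)
      qed (use Ec \<kappa>_closed[OF _ r] act_closed[OF x] in auto)
      also have "\<dots> = (\<Oplus>i\<in>E. \<kappa> i r [^] (p ^ e) \<otimes> i) \<odot>\<^bsub>M\<^esub> act x"
        using E(1) Ec \<kappa>_closed[OF _ r] act_closed[OF x] by (intro finsum_smult_rdistr) auto
      finally show ?thesis using \<kappa>_sum[OF r] by simp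
    qed
    then show ?thesis using act_closed[OF x] by simp
  qed
  ultimately have "?N = carrier M" by (rule span_act[OF surj])
  then have "\<one> \<odot>\<^bsub>M\<^esub> a = (\<Oplus>\<^bsub>M\<^esub>i\<in>E. i \<odot>\<^bsub>M\<^esub> act (\<pi> i (\<one> \<odot>\<^bsub>M\<^esub> a)))" using a R.one_closed by blast
  then show ?thesis using a by simp
qed

definition frob :: "'c set \<Rightarrow> 'c set" where
  "frob N = submodule_span R M (act ` N)"

text \<open>The least submodule \<open>N\<close> with \<open>A \<subseteq> frob N\<close>, see \<open>subset_frob_iff\<close>.\<close>

definition coord :: "'c set \<Rightarrow> 'c set" where
  "coord A = submodule_span R M {\<pi> i a | i a. i \<in> E \<and> a \<in> A}"

abbreviation "img r N \<equiv> frob_image p e R M \<theta> r N"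
abbreviation "rooted N \<equiv> Defs.is_root p e R M \<theta> N"

lemma act_image_subset: "N \<subseteq> carrier M \<Longrightarrow> act ` N \<subseteq> carrier M"
  using act_closed by blast

lemma frob_submodule: "N \<subseteq> carrier M \<Longrightarrow> submodule (frob N) R M"
  unfolding frob_def by (intro span_submodule act_image_subset)

lemma act_frob: "a \<in> N \<Longrightarrow> act a \<in> frob N"
  unfolding frob_def by (rule subsetD[OF span_superset]) simp

text \<open>The coordinates of \<open>c F(n)\<close> are the multiples \<open>\<kappa> i c n\<close> of \<open>n\<close>; conversely an element is recovered from
  its coordinates by \<open>\<pi>_expansion\<close>. This turns membership in \<open>frob N\<close> into a condition that
  commutes with intersections.\<close>

lemma mem_frob_iff:
  assumes N: "submodule N R M"
  shows "a \<in> frob N \<longleftrightarrow> a \<in> carrier M \<and> (\<forall>i\<in>E. \<pi> i a \<in> N)"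
proof
  have Nc: "N \<subseteq> carrier M" by (rule submodule_subset[OF N])
  let ?W = "{a \<in> carrier M. \<forall>i\<in>E. \<forall>c\<in>carrier R. \<pi> i (c \<odot>\<^bsub>M\<^esub> a) \<in> N}"
  have "submodule ?W R M"
  proof (rule submoduleI_linear)
    show "\<zero>\<^bsub>M\<^esub> \<in> ?W" using \<pi>_zero submodule_zero[OF N] by simp
    show "a \<oplus>\<^bsub>M\<^esub> b \<in> ?W" if "a \<in> ?W" "b \<in> ?W" for a b
      using that submodule_add[OF N] by (simp add: smult_r_distr \<pi>_add)
    show "s \<odot>\<^bsub>M\<^esub> a \<in> ?W" if "s \<in> carrier R" "a \<in> ?W" for s a
      using that by (simp add: smult_assoc1[symmetric] del: smult_assoc1)
  qed auto
  moreover have "act ` N \<subseteq> ?W"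
  proof
    fix x assume "x \<in> act ` N"
    then obtain n where n: "n \<in> N" "x = act n" by blast
    then have "n \<in> carrier M" using Nc by blast
    then show "x \<in> ?W" using n act_closed submodule_smult[OF N] by (simp add: \<pi>_act \<kappa>_closed)
  qed
  ultimately have *: "frob N \<subseteq> ?W" unfolding frob_def by (intro span_least)
  show "a \<in> carrier M \<and> (\<forall>i\<in>E. \<pi> i a \<in> N)" if "a \<in> frob N"
  proof -
    have a: "a \<in> ?W" using * that by blast
    then have "\<pi> i (\<one> \<odot>\<^bsub>M\<^esub> a) \<in> N" if "i \<in> E" for i using that R.one_closed by blast
    then show ?thesis using a by simp
  qed
  show "a \<in> frob N" if "a \<in> carrier M \<and> (\<forall>i\<in>E. \<pi> i a \<in> N)"
  proof -
    have "(\<Oplus>\<^bsub>M\<^esub>i\<in>E. i \<odot>\<^bsub>M\<^esub> act (\<pi> i a)) \<in> frob N"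
      using that act_frob E submodule_smult[OF frob_submodule[OF Nc]]
      by (intro submodule_finsum[OF frob_submodule[OF Nc]]) auto
    then show ?thesis using \<pi>_expansion[of a] that by simp
  qed
qed

lemma coord_gens: "A \<subseteq> carrier M \<Longrightarrow> {\<pi> i a | i a. i \<in> E \<and> a \<in> A} \<subseteq> carrier M"
  using \<pi>_closed by blast

lemma coord_submodule: "A \<subseteq> carrier M \<Longrightarrow> submodule (coord A) R M"
  unfolding coord_def by (intro span_submodule coord_gens)

lemma coord_mem: "i \<in> E \<Longrightarrow> a \<in> A \<Longrightarrow> \<pi> i a \<in> coord A"
  unfolding coord_def by (rule subsetD[OF span_superset]) blast

lemma subset_frob_iff:
  assumes "A \<subseteq> carrier M" "submodule N R M"
  shows "A \<subseteq> frob N \<longleftrightarrow> coord A \<subseteq> N"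
proof
  assume "A \<subseteq> frob N"
  then have "{\<pi> i a | i a. i \<in> E \<and> a \<in> A} \<subseteq> N" using mem_frob_iff[OF assms(2)] by blast
  then show "coord A \<subseteq> N" unfolding coord_def by (rule span_least[OF _ assms(2)])
next
  assume "coord A \<subseteq> N"
  then show "A \<subseteq> frob N" using coord_mem mem_frob_iff[OF assms(2)] assms(1) by blast
qed

lemma act_span:
  assumes S: "S \<subseteq> carrier M" and a: "a \<in> submodule_span R M S"
  shows "act a \<in> submodule_span R M (act ` S)"
proof -
  let ?T = "submodule_span R M (act ` S)"
  have T: "submodule ?T R M" by (intro span_submodule act_image_subset S)
  have "submodule {a \<in> carrier M. act a \<in> ?T} R M"
  proof (rule submoduleI_linear)
    show "\<zero>\<^bsub>M\<^esub> \<in> {a \<in> carrier M. act a \<in> ?T}" using act_zero submodule_zero[OF T] by simp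
  qed (use submodule_add[OF T] submodule_smult[OF T] in \<open>auto simp: act_add act_smult\<close>)
  moreover have "S \<subseteq> {a \<in> carrier M. act a \<in> ?T}"
    using S span_superset[of "act ` S"] by blast
  ultimately have "submodule_span R M S \<subseteq> {a \<in> carrier M. act a \<in> ?T}" by (intro span_least)
  then show ?thesis using a by blast
qed

lemma act_pow_closed: "N \<subseteq> carrier M \<Longrightarrow> (act ^^ r) ` N \<subseteq> carrier M"
  by (induction r) (auto simp: act_closed)

lemma img_0: "submodule N R M \<Longrightarrow> img 0 N = N"
  unfolding frob_image_def by (simp add: span_of_submodule)

lemma img_1: "img 1 N = frob N"
  by (simp add: frob_image_def frob_def)

lemma img_Suc:
  assumes N: "N \<subseteq> carrier M"
  shows "img (Suc r) N = frob (img r N)"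
proof
  let ?S = "(act ^^ r) ` N"
  have S: "?S \<subseteq> carrier M" by (rule act_pow_closed[OF N])
  have eq: "(act ^^ Suc r) ` N = act ` ?S" by (auto simp: image_comp)
  have "act ` submodule_span R M ?S \<subseteq> submodule_span R M (act ` ?S)" using act_span[OF S] by blast
  then show "frob (img r N) \<subseteq> img (Suc r) N"
    unfolding frob_def frob_image_def eq using S
    by (intro span_least span_submodule act_image_subset) auto
  show "img (Suc r) N \<subseteq> frob (img r N)"
    unfolding frob_def frob_image_def eq by (intro span_mono image_mono span_superset)
qed

lemma img_submodule: "N \<subseteq> carrier M \<Longrightarrow> submodule (img r N) R M"
  unfolding frob_image_def by (intro span_submodule act_pow_closed)

lemma img_mono: "N \<subseteq> N' \<Longrightarrow> img r N \<subseteq> img r N'"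
  unfolding frob_image_def by (intro span_mono image_mono)

lemma img_frob:
  assumes N: "submodule N R M"
  shows "img r (frob N) = img (Suc r) N"
proof -
  note Nc = submodule_subset[OF N]
  show ?thesis
  proof (induction r)
    case 0
    then show ?case using img_0[OF frob_submodule[OF Nc]] img_Suc[OF Nc, of 0] img_0[OF N] by simp
  next
    case (Suc r)
    then show ?case
      using img_Suc[OF submodule_subset[OF frob_submodule[OF Nc]], of r] img_Suc[OF Nc, of "Suc r"] by simp
  qed
qed

lemma img_chain:
  assumes N: "submodule N R M" "N \<subseteq> frob N"
  shows "img r N \<subseteq> img (Suc r) N"
  using img_mono[OF N(2), of r] img_frob[OF N(1)] by simp

lemma rootD:
  assumes "rooted N"
  shows "fg_submodule R M N" "submodule N R M" "N \<subseteq> frob N" "(\<Union>r. img r N) = carrier M"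
  using assms by (auto simp: Defs.is_root_def img_1[unfolded One_nat_def] fg_submodule_def)

lemma rootI:
  assumes "fg_submodule R M N" "N \<subseteq> frob N" "carrier M \<subseteq> (\<Union>r. img r N)"
  shows "rooted N"
proof -
  have "N \<subseteq> carrier M" using assms(1) submodule_subset by (auto simp: fg_submodule_def)
  then have "img r N \<subseteq> carrier M" for r using submodule_subset[OF img_submodule] by blast
  then show ?thesis using assms by (auto simp: Defs.is_root_def img_1[unfolded One_nat_def])
qed

text \<open>The span \<open>N k\<close> of the \<open>act ^^ j\<close>-translates, \<open>j \<le> k\<close>, of a finite generating set is a root as
  soon as it contains the coordinates of the generators.\<close>

lemma root_exists:
  assumes fg: "fg_RF_module p e R M \<theta>"
  shows "\<exists>N. rooted N"
proof -
  obtain S where S: "S \<subseteq> carrier M" "finite S" and hull: "RF_submodule p e R M \<theta> hull S = carrier M"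
    using fg unfolding fg_RF_module_def by blast
  have gen: "carrier M \<subseteq> U" if "submodule U R M" "S \<subseteq> U" "\<And>a. a \<in> U \<Longrightarrow> act a \<in> U" for U
    using hull_minimal[of S U "RF_submodule p e R M \<theta>"] that hull by (auto simp: RF_submodule_def)
  define G where "G k = (\<Union>j\<le>k. (act ^^ j) ` S)" for k :: nat
  define N where "N k = submodule_span R M (G k)" for k
  have Gc: "G k \<subseteq> carrier M" for k using act_pow_closed[OF S(1)] by (auto simp: G_def)
  have Gfin: "finite (G k)" for k using S(2) by (auto simp: G_def)
  have Nsub: "submodule (N k) R M" for k unfolding N_def by (rule span_submodule[OF Gc])
  have GN: "G k \<subseteq> N k" for k unfolding N_def by (rule span_superset)
  have G_Suc: "G k \<subseteq> G (Suc k)" "act ` G k \<subseteq> G (Suc k)" for k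
    unfolding G_def by (force, force simp: image_iff)
  have N_Suc: "N k \<subseteq> N (Suc k)" for k unfolding N_def by (intro span_mono G_Suc)
  have N_act: "act a \<in> N (Suc k)" if "a \<in> N k" for a k
    using act_span[OF Gc] that span_mono[OF G_Suc(2), of k] unfolding N_def by blast
  have SN: "S \<subseteq> N k" for k
  proof -
    have "S \<subseteq> G k" unfolding G_def by (force intro: bexI[of _ 0])
    then show ?thesis using GN by blast
  qed
  have all: "carrier M \<subseteq> (\<Union>k. N k)"
  proof (rule gen)
    show "submodule (\<Union>k. N k) R M" by (rule submodule_UN_chain[of N, OF Nsub N_Suc])
  qed (use SN N_act in blast)+
  let ?T = "{\<pi> i s | i s. i \<in> E \<and> s \<in> S}"
  have T: "?T \<subseteq> carrier M" by (rule coord_gens[OF S(1)])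
  have "?T = (\<lambda>(i, s). \<pi> i s) ` (E \<times> S)" by auto
  then have "finite ?T" using E(1) S(2) by simp
  then have fgT: "fg_submodule R M (submodule_span R M ?T)" by (rule fg_submodule_span[OF _ T])
  obtain k where k: "submodule_span R M ?T \<subseteq> N k"
  proof (rule fg_submodule_subset_chain[OF fgT, of N])
    show "submodule_span R M ?T \<subseteq> (\<Union>k. N k)" using span_subset_carrier[OF T] all by (rule subset_trans)
  qed (rule Nsub N_Suc | assumption)+
  have "coord S \<subseteq> N k" using k by (simp add: coord_def)
  then have Sfrob: "S \<subseteq> frob (N k)" using subset_frob_iff[OF S(1) Nsub] by blast
  note Nc = submodule_subset[OF Nsub]
  have "G k \<subseteq> frob (N k)"
  proof
    fix x assume "x \<in> G k"
    then obtain j s where j: "j \<le> k" and s: "s \<in> S" and x: "x = (act ^^ j) s" by (auto simp: G_def)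
    show "x \<in> frob (N k)"
    proof (cases j)
      case 0
      then show ?thesis using x s Sfrob by auto
    next
      case (Suc i)
      have "(act ^^ i) s \<in> G k" using s j Suc by (auto simp: G_def intro!: bexI[of _ i])
      then have "act ((act ^^ i) s) \<in> frob (N k)" using GN act_frob by blast
      then show ?thesis using x Suc by simp
    qed
  qed
  then have Nfrob: "N k \<subseteq> frob (N k)"
    using span_least[OF _ frob_submodule[OF Nc]] unfolding N_def by blast
  have "rooted (N k)"
  proof (rule rootI[OF _ Nfrob])
    show "fg_submodule R M (N k)" unfolding N_def by (rule fg_submodule_span[OF Gfin Gc])
    show "carrier M \<subseteq> (\<Union>r. img r (N k))"
    proof (rule gen)
      show "submodule (\<Union>r. img r (N k)) R M"
        by (rule submodule_UN_chain[of "\<lambda>r. img r (N k)", OF img_submodule[OF Nc] img_chain[OF Nsub Nfrob]])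
      show "S \<subseteq> (\<Union>r. img r (N k))" using SN[of k] img_0[OF Nsub, of k] by blast
      show "act a \<in> (\<Union>r. img r (N k))" if a: "a \<in> (\<Union>r. img r (N k))" for a
      proof -
        obtain r where "a \<in> img r (N k)" using a by blast
        then have "act a \<in> img (Suc r) (N k)" unfolding img_Suc[OF Nc] by (rule act_frob)
        then show ?thesis by blast
      qed
    qed
  qed
  then show ?thesis ..
qed

text \<open>\<open>N \<subseteq> F(C)\<close> for \<open>C = coord N\<close> implies \<open>F\<^sup>r(N) \<subseteq> F\<^sup>r\<^sup>+\<^sup>1(C)\<close>, so that the images of \<open>C\<close> still exhaust \<open>M\<close>.\<close>

lemma coord_root:
  assumes N: "rooted N"
  shows "rooted (coord N)" "coord N \<subseteq> N"
proof -
  note fg = rootD(1)[OF N] and sub = rootD(2)[OF N] and frob = rootD(3)[OF N]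
  note Nc = submodule_subset[OF sub]
  note csub = coord_submodule[OF Nc]
  show cN: "coord N \<subseteq> N" using subset_frob_iff[OF Nc sub] frob by blast
  have Nf: "N \<subseteq> frob (coord N)" using subset_frob_iff[OF Nc csub] by blast
  show "rooted (coord N)"
  proof (rule rootI)
    show "fg_submodule R M (coord N)"
      using noetherian_subD(2)[OF noetherian_sub_of_fg[OF local.noetherian_ring_axioms fg] csub cN] .
    show "coord N \<subseteq> frob (coord N)" using cN Nf by blast
    have step: "img r N \<subseteq> img (Suc r) (coord N)" for r
      using img_mono[OF Nf, of r] img_frob[OF csub] by simp
    show "carrier M \<subseteq> (\<Union>r. img r (coord N))"
    proof
      fix x assume "x \<in> carrier M"
      then have "x \<in> (\<Union>r. img r N)" by (simp only: rootD(4)[OF N])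
      then obtain r where "x \<in> img r N" by blast
      then show "x \<in> (\<Union>r. img r (coord N))" using step by blast
    qed
  qed
qed

text \<open>The adjunction \<open>subset_frob_iff\<close>, iterated.\<close>

lemma coord_pow_subset:
  assumes N: "submodule N R M" and A: "A \<subseteq> carrier M" "A \<subseteq> img k N"
  shows "(coord ^^ k) A \<subseteq> N"
  using A
proof (induction k arbitrary: A)
  case 0
  then show ?case using img_0[OF N] by simp
next
  case (Suc k)
  note Nc = submodule_subset[OF N]
  have "coord A \<subseteq> img k N"
    using Suc.prems subset_frob_iff[OF _ img_submodule[OF Nc]] img_Suc[OF Nc] by simp
  then have "(coord ^^ k) (coord A) \<subseteq> N"
    using Suc.IH submodule_subset[OF coord_submodule[OF Suc.prems(1)]] by blast
  then show ?case by (simp add: funpow_swap1)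
qed

text \<open>A scalar passes through the coordinates as its \<open>q\<close>-th power: \<open>x \<pi>\<^sub>i(a) = \<pi>\<^sub>i(x\<^sup>q a)\<close>.\<close>

lemma smult_coord:
  assumes x: "x \<in> carrier R" and A: "A \<subseteq> carrier M" and B: "B \<subseteq> carrier M"
    and sub: "\<And>a. a \<in> A \<Longrightarrow> x [^] (p ^ e) \<odot>\<^bsub>M\<^esub> a \<in> B" and b: "b \<in> coord A"
  shows "x \<odot>\<^bsub>M\<^esub> b \<in> coord B"
proof -
  have "\<pi> i a \<in> {b \<in> carrier M. x \<odot>\<^bsub>M\<^esub> b \<in> coord B}" if i: "i \<in> E" and a: "a \<in> A" for i a
  proof -
    have ac: "a \<in> carrier M" using a A by blast
    have "\<pi> i (x [^] (p ^ e) \<odot>\<^bsub>M\<^esub> a) \<in> coord B" by (rule coord_mem[OF i sub[OF a]])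
    then show ?thesis using \<pi>_pow_smult[OF i x ac] \<pi>_closed[OF i ac] by simp
  qed
  then have "coord A \<subseteq> {b \<in> carrier M. x \<odot>\<^bsub>M\<^esub> b \<in> coord B}"
    unfolding coord_def[of A]
    by (intro span_least[OF _ scalar_preimage_submodule[OF coord_submodule[OF B] x]]) blast
  then show ?thesis using b by blast
qed

text \<open>The ideals \<open>ann r = (L (Suc r) : L r)\<close> increase: for \<open>x \<in> ann r\<close>, the scalar \<open>x\<close> acts on \<open>L (Suc r)\<close>
  through \<open>x\<^sup>q\<close> on \<open>L r\<close>, and \<open>q \<ge> 1\<close>. Let \<open>ann r0\<close> be the largest one. For \<open>t \<in> ann r0\<close> the same device and
  \<open>q \<ge> 2\<close> show by induction that \<open>t\<^sup>2\<close> multiplies \<open>L r0\<close> into every later term. If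
  \<open>ann r0\<close> were proper, then \<open>descending_chain_sat\<close> at a minimal prime \<open>P\<close> of \<open>ann r0\<close> would give an
  \<open>s \<notin> P\<close> and an \<open>r \<ge> r0\<close> with \<open>s \<in> ann r = ann r0 \<subseteq> P\<close>.\<close>

lemma coord_pow_stabilizes:
  assumes N: "rooted N"
  shows "\<exists>r0. \<forall>r\<ge>r0. (coord ^^ r) N \<subseteq> (coord ^^ Suc r) N"
proof -
  define L where "L r = (coord ^^ r) N" for r
  have LS: "L (Suc r) = coord (L r)" for r by (simp add: L_def)
  have Lroot: "rooted (L r)" for r
    by (induction r) (simp_all add: L_def N coord_root(1))
  note Lsub = rootD(2)[OF Lroot] and Lfg = rootD(1)[OF Lroot]
  note Lc = submodule_subset[OF Lsub]
  have dec: "L (Suc r) \<subseteq> L r" for r unfolding LS by (rule coord_root(2)[OF Lroot])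
  interpret reg: module R "regular_module R" by (rule R.module_regular_module)
  define ann where "ann r = {x \<in> carrier R. \<forall>a \<in> L r. x \<odot>\<^bsub>M\<^esub> a \<in> L (Suc r)}" for r
  have annI: "ideal (ann r) R" for r
    unfolding R.submodule_regular_iff_ideal[symmetric]
  proof (rule reg.submoduleI_linear)
    have c: "a \<in> carrier M" if "a \<in> L r" for a using that Lc by blast
    show "\<zero>\<^bsub>regular_module R\<^esub> \<in> ann r" using c submodule_zero[OF Lsub] by (simp add: ann_def)
    show "x \<oplus>\<^bsub>regular_module R\<^esub> y \<in> ann r" if "x \<in> ann r" "y \<in> ann r" for x y
      using that c submodule_add[OF Lsub] by (simp add: ann_def smult_l_distr)
    show "x \<odot>\<^bsub>regular_module R\<^esub> y \<in> ann r" if "x \<in> carrier R" "y \<in> ann r" for x y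
      using that c submodule_smult[OF Lsub] by (simp add: ann_def smult_assoc1)
  qed (auto simp: ann_def)
  have ann_inc: "ann r \<subseteq> ann (Suc r)" for r
  proof
    fix x assume x: "x \<in> ann r"
    then have xc: "x \<in> carrier R" by (simp add: ann_def)
    have "x \<odot>\<^bsub>M\<^esub> b \<in> L (Suc (Suc r))" if b: "b \<in> L (Suc r)" for b
      unfolding LS[of "Suc r"]
    proof (rule smult_coord[OF xc Lc Lc])
      show "b \<in> coord (L r)" using b by (simp add: LS)
      fix a assume a: "a \<in> L r"
      obtain k where k: "p ^ e = Suc k" using q_ge_2 by (metis Suc_le_D numeral_2_eq_2)
      have "x [^] (p ^ e) \<odot>\<^bsub>M\<^esub> a = x [^] k \<odot>\<^bsub>M\<^esub> (x \<odot>\<^bsub>M\<^esub> a)"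
        unfolding k using xc a Lc by (simp add: smult_assoc1[symmetric] subset_iff)
      then show "x [^] (p ^ e) \<odot>\<^bsub>M\<^esub> a \<in> L (Suc r)"
        using x a xc submodule_smult[OF Lsub] by (simp add: ann_def)
    qed
    then show "x \<in> ann (Suc r)" using xc by (simp add: ann_def)
  qed
  have ann_mono: "ann i \<subseteq> ann j" if "i \<le> j" for i j
    using lift_Suc_mono_le[of ann, OF ann_inc that] .
  define isann where "isann I \<longleftrightarrow> (\<exists>r. I = ann r)" for I
  have "\<exists>Z. isann Z \<and> (\<forall>Z'. isann Z' \<longrightarrow> Z \<subseteq> Z' \<longrightarrow> Z' = Z)"
  proof (rule reg.noetherian_sub_maximal)
    show "reg.noetherian_sub (carrier R)" by (rule local.noetherian_sub_carrier[OF R.is_cring])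
    show "isann (ann 0)" by (auto simp: isann_def)
    show "submodule Y R (regular_module R) \<and> Y \<subseteq> carrier R" if "isann Y" for Y
      using that annI by (auto simp: isann_def R.submodule_regular_iff_ideal ann_def)
  qed
  then obtain Z where "isann Z" and max: "\<And>Z'. isann Z' \<Longrightarrow> Z \<subseteq> Z' \<Longrightarrow> Z' = Z" by blast
  then obtain r0 where r0: "Z = ann r0" by (auto simp: isann_def)
  have stable: "ann r = ann r0" if "r0 \<le> r" for r
  proof -
    have "isann (ann r)" by (auto simp: isann_def)
    then show ?thesis using max[of "ann r"] ann_mono[OF that] unfolding r0 by simp
  qed
  have "\<one> \<in> ann r0"
  proof (rule ccontr)
    assume "\<one> \<notin> ann r0"
    then have "ann r0 \<noteq> carrier R" by auto
    then have sub_m: "ann r0 \<subseteq> m" by (rule local.proper_ideal_subset[OF annI])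
    obtain P where P: "primeideal P R" "ann r0 \<subseteq> P" "P \<subseteq> m"
      and nil: "\<And>y. y \<in> P \<Longrightarrow> \<exists>s \<in> carrier R - P. \<exists>n::nat. s \<otimes> y [^] n \<in> ann r0"
      by (rule local.minimal_prime_exists[OF annI[of r0] local.prime sub_m]) (rule that)
    interpret P: primeideal P R by (rule P(1))
    \<comment> \<open>Squares of elements of \<open>ann r0\<close> multiply \<open>L r0\<close> into every later term.\<close>
    have square: "(t \<otimes> t) \<odot>\<^bsub>M\<^esub> a \<in> L (r0 + r)" if t: "t \<in> ann r0" and a: "a \<in> L r0" for t a r
      using a
    proof (induction r arbitrary: a)
      case 0
      then show ?case using t submodule_smult[OF Lsub] by (simp add: ann_def)
    next
      case (Suc r)
      have tc: "t \<in> carrier R" using t by (simp add: ann_def)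
      have ac: "a \<in> carrier M" using Suc.prems Lc by blast
      have ta: "t \<odot>\<^bsub>M\<^esub> a \<in> coord (L r0)" using t Suc.prems by (simp add: ann_def LS)
      have "t \<odot>\<^bsub>M\<^esub> (t \<odot>\<^bsub>M\<^esub> a) \<in> coord (L (r0 + r))"
      proof (rule smult_coord[OF tc Lc Lc _ ta])
        fix b assume b: "b \<in> L r0"
        then have bc: "b \<in> carrier M" using Lc by blast
        obtain k where k: "p ^ e = k + 2" using q_ge_2 by (metis add.commute le_Suc_ex)
        have "x [^] (k + 2) = x [^] k \<otimes> (x \<otimes> x)" if "x \<in> carrier R" for x
          using that by (simp add: m_assoc numeral_2_eq_2)
        then have "t [^] (p ^ e) \<odot>\<^bsub>M\<^esub> b = t [^] k \<odot>\<^bsub>M\<^esub> ((t \<otimes> t) \<odot>\<^bsub>M\<^esub> b)"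
          using tc bc k by (simp add: smult_assoc1)
        then show "t [^] (p ^ e) \<odot>\<^bsub>M\<^esub> b \<in> L (r0 + r)"
          using submodule_smult[OF Lsub _ Suc.IH[OF b]] tc by simp
      qed
      then show ?case using tc ac by (simp add: smult_assoc1 LS)
    qed
    have "\<exists>r. L (r0 + r) \<subseteq> sat P (L (r0 + Suc r))"
    proof (rule descending_chain_sat[where L = "\<lambda>r. L (r0 + r)", OF local.noetherian_ring_axioms _ Lsub _ P(1)])
      show "noetherian_sub (L (r0 + 0))" by (rule noetherian_sub_of_fg[OF local.noetherian_ring_axioms Lfg])
      show "L (r0 + Suc r) \<subseteq> L (r0 + r)" for r using dec[of "r0 + r"] by simp
      fix y assume y: "y \<in> P"
      then obtain s n where s: "s \<in> carrier R - P" and sn: "s \<otimes> y [^] (n::nat) \<in> ann r0" using nil by blast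
      have yc: "y \<in> carrier R" using y by (rule P.Icarr)
      have "(s \<otimes> y [^] n) \<otimes> (s \<otimes> y [^] n) = (s \<otimes> s) \<otimes> y [^] (n + n)"
        using s yc by (simp add: R.nat_pow_mult[symmetric] R.m_ac)
      then have "\<forall>r. \<forall>a \<in> L (r0 + 0). ((s \<otimes> s) \<otimes> y [^] (n + n)) \<odot>\<^bsub>M\<^esub> a \<in> L (r0 + r)"
        using square[OF sn] by simp
      then show "\<exists>s\<in>carrier R - P. \<exists>n::nat. \<forall>r. \<forall>a\<in>L (r0 + 0). (s \<otimes> y [^] n) \<odot>\<^bsub>M\<^esub> a \<in> L (r0 + r)"
        using P.compl_mult[OF s s] by blast
    qed
    then obtain r where r: "L (r0 + r) \<subseteq> sat P (L (r0 + Suc r))" ..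
    obtain s where s: "s \<in> carrier R - P" "\<And>a. a \<in> L (r0 + r) \<Longrightarrow> s \<odot>\<^bsub>M\<^esub> a \<in> L (r0 + Suc r)"
      using sat_uniform_denominator[OF P(1) Lfg Lsub r] by blast
    then have "s \<in> ann (r0 + r)" by (simp add: ann_def)
    then have "s \<in> P" using stable[of "r0 + r"] P(2) by auto
    then show False using s(1) by blast
  qed
  have "L r \<subseteq> L (Suc r)" if "r0 \<le> r" for r
  proof
    fix a assume a: "a \<in> L r"
    have "\<one> \<in> ann r" using stable[OF that] \<open>\<one> \<in> ann r0\<close> by simp
    then have "\<one> \<odot>\<^bsub>M\<^esub> a \<in> L (Suc r)" using a unfolding ann_def by blast
    moreover have "a \<in> carrier M" using a Lc by blast
    ultimately show "a \<in> L (Suc r)" by simp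
  qed
  then show ?thesis unfolding L_def by blast
qed

text \<open>The stationary value of \<open>coord ^^ r\<close> lies in every root \<open>N'\<close>, because \<open>N\<close>, being finitely generated, lies
  in some \<open>F\<^sup>k(N')\<close>.\<close>

lemma minimal_root_exists:
  assumes N: "rooted N"
  shows "\<exists>N. is_minimal_root p e R M \<theta> N"
proof -
  obtain r0 where r0: "\<And>r. r0 \<le> r \<Longrightarrow> (coord ^^ r) N \<subseteq> (coord ^^ Suc r) N"
    using coord_pow_stabilizes[OF N] by blast
  have Lroot: "rooted ((coord ^^ r) N)" for r
    by (induction r) (simp_all add: N coord_root(1))
  have dec: "(coord ^^ Suc r) N \<subseteq> (coord ^^ r) N" for r using coord_root(2)[OF Lroot] by simp
  have later: "(coord ^^ r0) N \<subseteq> (coord ^^ (r0 + j)) N" for j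
  proof (induction j)
    case (Suc j)
    then show ?case using r0[of "r0 + j"] by simp
  qed simp
  have "(coord ^^ r0) N \<subseteq> N'" if N': "rooted N'" for N'
  proof -
    note sub = rootD(2)[OF N']
    have Nc: "N \<subseteq> carrier M" by (rule submodule_subset[OF rootD(2)[OF N]])
    obtain k where k: "N \<subseteq> img k N'"
    proof (rule fg_submodule_subset_chain[OF rootD(1)[OF N], where Y = "\<lambda>k. img k N'"])
      show "submodule (img k N') R M" for k by (rule img_submodule[OF submodule_subset[OF sub]])
      show "img k N' \<subseteq> img (Suc k) N'" for k by (rule img_chain[OF sub rootD(3)[OF N']])
      show "N \<subseteq> (\<Union>k. img k N')" using rootD(4)[OF N'] Nc by simp
    qed
    have "(coord ^^ (r0 + k)) N \<subseteq> (coord ^^ k) N"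
      using lift_Suc_antimono_le[of "\<lambda>r. (coord ^^ r) N" k "r0 + k", OF dec] by simp
    then show ?thesis using later[of k] coord_pow_subset[OF sub Nc k] by blast
  qed
  then have "is_minimal_root p e R M \<theta> ((coord ^^ r0) N)" using Lroot by (simp add: is_minimal_root_def)
  then show ?thesis ..
qed

end

theorem theorem2p10:
  fixes R :: "('a, 'r) ring_scheme" and M :: "('a, 'm, 'x) module_scheme"
    and \<theta> :: "('a \<times> 'm \<Rightarrow>\<^sub>0 int) set \<Rightarrow> 'm" and p e :: nat
  assumes "Factorial_Ring.prime p" and "e \<ge> 1"
    and "regular_local_ring R" and "has_characteristic R p" and "F_finite p R"
    and "unit_RF_module p e R M \<theta>" and "fg_RF_module p e R M \<theta>"
  shows "\<exists>!N. is_minimal_root p e R M \<theta> N"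
proof -
  have mod: "module R M" and lin: "\<theta> \<in> linear_maps R (frob_pullback p e R M) M"
    and bij: "bij_betw \<theta> (carrier (frob_pullback p e R M)) (carrier M)"
    using assms(6) by (auto simp: unit_RF_module_def RF_module_def)
  have rf: "RF_mod R M p e \<theta>"
    using mod lin by (simp add: RF_mod_def RF_mod_axioms_def)
  interpret module R M by (rule mod)
  have "local_ring R" "noetherian_ring R" using assms(3) by (auto simp: regular_local_ring_def)
  then obtain m where m: "noetherian_local_ring R m" by (rule noetherian_local_ringI)
  interpret local: noetherian_local_ring R m by (rule m)
  have frob: "frobenius_ring R (p ^ e)" by (rule R.frobenius_ringI[OF assms(1,4,2)])
  interpret fr: frobenius_local_ring R m "p ^ e"
    using m frob by (simp add: frobenius_local_ring_def)
  obtain xs where xs: "set xs \<subseteq> carrier R" "genideal R (set xs) = m" "regular_mod R {\<zero>\<^bsub>R\<^esub>} xs"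
    by (rule regular_local_ring_regular_sequence[OF assms(3) m])
  obtain S where S: "S \<subseteq> carrier R" "finite S"
    and gen: "\<And>N. submodule N R (frob_push (p ^ e) R) \<Longrightarrow> S \<subseteq> N \<Longrightarrow> N = carrier R"
    using R.frob_push_fg[OF assms(1,4,5), of e] by blast
  have span: "submodule_span R (frob_push (p ^ e) R) S = carrier R"
    by (rule gen[OF fr.push.span_submodule[OF S(1)] fr.push.span_superset])
  obtain E \<kappa> where E: "finite E" "E \<subseteq> carrier R"
    and \<kappa>: "\<And>i a. i \<in> E \<Longrightarrow> a \<in> carrier R \<Longrightarrow> \<kappa> i a \<in> carrier R"
      "\<And>i a b. i \<in> E \<Longrightarrow> a \<in> carrier R \<Longrightarrow> b \<in> carrier R \<Longrightarrow> \<kappa> i (a \<oplus>\<^bsub>R\<^esub> b) = \<kappa> i a \<oplus>\<^bsub>R\<^esub> \<kappa> i b"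
      "\<And>i c a. i \<in> E \<Longrightarrow> c \<in> carrier R \<Longrightarrow> a \<in> carrier R \<Longrightarrow>
        \<kappa> i (c [^]\<^bsub>R\<^esub> (p ^ e) \<otimes>\<^bsub>R\<^esub> a) = c \<otimes>\<^bsub>R\<^esub> \<kappa> i a"
      "\<And>a. a \<in> carrier R \<Longrightarrow> a = (\<Oplus>\<^bsub>R\<^esub>i\<in>E. \<kappa> i a [^]\<^bsub>R\<^esub> (p ^ e) \<otimes>\<^bsub>R\<^esub> i)"
    by (rule fr.frobenius_free[OF S span xs]) (rule that)
  interpret RF_mod R M p e \<theta> by (rule rf)
  have "\<exists>\<pi>. (\<forall>a \<in> carrier M. \<pi> a \<in> carrier M) \<and>
      (\<forall>a \<in> carrier M. \<forall>b \<in> carrier M. \<pi> (a \<oplus>\<^bsub>M\<^esub> b) = \<pi> a \<oplus>\<^bsub>M\<^esub> \<pi> b) \<and>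
      (\<forall>r \<in> carrier R. \<forall>a \<in> carrier M. \<pi> (r \<odot>\<^bsub>M\<^esub> act a) = \<kappa> i r \<odot>\<^bsub>M\<^esub> a)" if i: "i \<in> E" for i
    by (rule coordinate_map[OF bij, of "\<kappa> i"]) (use i \<kappa> in blast)+
  then obtain \<pi> where \<pi>: "\<And>i. i \<in> E \<Longrightarrow> (\<forall>a \<in> carrier M. \<pi> i a \<in> carrier M) \<and>
      (\<forall>a \<in> carrier M. \<forall>b \<in> carrier M. \<pi> i (a \<oplus>\<^bsub>M\<^esub> b) = \<pi> i a \<oplus>\<^bsub>M\<^esub> \<pi> i b) \<and>
      (\<forall>r \<in> carrier R. \<forall>a \<in> carrier M. \<pi> i (r \<odot>\<^bsub>M\<^esub> act a) = \<kappa> i r \<odot>\<^bsub>M\<^esub> a)" by metis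
  then have \<pi>1: "\<And>i a. i \<in> E \<Longrightarrow> a \<in> carrier M \<Longrightarrow> \<pi> i a \<in> carrier M"
    and \<pi>2: "\<And>i a b. i \<in> E \<Longrightarrow> a \<in> carrier M \<Longrightarrow> b \<in> carrier M \<Longrightarrow>
      \<pi> i (a \<oplus>\<^bsub>M\<^esub> b) = \<pi> i a \<oplus>\<^bsub>M\<^esub> \<pi> i b"
    and \<pi>3: "\<And>i r a. i \<in> E \<Longrightarrow> r \<in> carrier R \<Longrightarrow> a \<in> carrier M \<Longrightarrow>
      \<pi> i (r \<odot>\<^bsub>M\<^esub> act a) = \<kappa> i r \<odot>\<^bsub>M\<^esub> a"
    by simp_all
  have "unit_coordinates R M p e \<theta> m E \<kappa> \<pi>"
  proof (intro unit_coordinates.intro unit_coordinates_axioms.intro)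
    show "RF_mod R M p e \<theta>" by (rule rf)
    show "noetherian_local_ring R m" by (rule m)
    show "2 \<le> p ^ e" by (rule fr.q_ge_2)
    show "carrier M \<subseteq> \<theta> ` carrier (frob_pullback p e R M)" using bij by (simp add: bij_betw_def)
  qed (rule E \<kappa>(1,3,4) \<pi>1 \<pi>2 \<pi>3; assumption)+
  then interpret unit_coordinates R M p e \<theta> m E \<kappa> \<pi> .
  obtain N0 where "Defs.is_root p e R M \<theta> N0" using root_exists[OF assms(7)] by blast
  then obtain N where N: "is_minimal_root p e R M \<theta> N" using minimal_root_exists by blast
  have "N' = N" if "is_minimal_root p e R M \<theta> N'" for N'
    using that N unfolding is_minimal_root_def by blast
  with N show ?thesis by blast
qed

end
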